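(* Let $\Omega$ be a proper convex open domain of $\mathbb{RP}^n$. Then the volume entropy of the Hilbert metric $h^H$ on $\Omega$ satisfies $$\mathrm{Ent}(h^H)\leq n-1.$$
   Context: An open domain $\Omega\subset\mathbb{RP}^n$ is convex if its intersection with any projective line is connected, and proper if its closure does not contain a projective line. Hilbert distance: the cross-ratio $[x_1,x_2,x_3,x_4]$ of four points on a projective line is the number $t$ such that $(x_1,x_2,x_3,x_4)$ is sent to $(0,1,\infty,t)$ in some affine chart of the line. For $x,y\in\Omega$, let $a,b$ be the two intersection points of the projective line through $x$ and $y$ with $\partial\Omega$, with $x$ between $a$ and $y$; then $d^H(x,y)=\frac12\log|[a,x,b,y]|$ (and $d^H(x,x)=0$). The Hilbert metric is the Finsler metric (squared norm) $h^H_x(u)=\frac12\frac{d^2}{dt^2}\big|_{t=0}d^H(x,x+tu)^2$ for $u\in T_x\Omega$ (in an affine chart); it is the square of a norm on $T_x\Omega$, and it generates $d^H$. A volume form $\mathrm{vol}$ on $\Omega$ is uniform if there is a constant $K>1$ such that for all $x\in\Omega$, $\frac1K\leq \mathrm{vol}(\{u\in T_x\Omega\mid h^H(u)\leq1\})\leq K$. Volume entropy: $\mathrm{Ent}(h^H)=\limsup_{R\to+\infty}\frac1R\log\mathrm{Vol}(B^H(o,R))$, where $o\in\Omega$ is a base point, $B^H(o,R)$ is the ball of center $o$ and radius $R$ for $d^H$, and $\mathrm{Vol}$ is computed with respect to a uniform volume form. It does not depend on the choice of $o$ or of the uniform volume form. *)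

theory Defs
  imports "HOL-Analysis.Analysis"
begin

text \<open>The projective space of a Euclidean space \<open>V\<close> is \<open>V - {0}\<close> modulo scaling, with the
  quotient topology. \<open>proj_point v\<close> is the point \<open>[v]\<close>; it is meaningful only for \<open>v \<noteq> 0\<close>.\<close>

definition proportional :: "'a::euclidean_space \<Rightarrow> 'a \<Rightarrow> bool" where
  "proportional v w \<longleftrightarrow> v \<noteq> 0 \<and> w \<noteq> 0 \<and> (\<exists>c. w = c *\<^sub>R v)"

lemma part_equivp_proportional: "part_equivp proportional"
proof (rule part_equivpI)
  obtain b :: 'a where "b \<in> Basis"
    using nonempty_Basis by blast
  then have "proportional b b"
    unfolding proportional_def by (metis nonzero_Basis scaleR_one)
  then show "\<exists>x::'a. proportional x x" by blast
  show "symp (proportional :: 'a \<Rightarrow> _)"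
  proof (rule sympI)
    fix v w :: 'a
    assume "proportional v w"
    then obtain c where c: "v \<noteq> 0" "w \<noteq> 0" "w = c *\<^sub>R v"
      unfolding proportional_def by blast
    then have "c \<noteq> 0" by (metis scaleR_zero_left)
    with c have "v = inverse c *\<^sub>R w" by simp
    with c show "proportional w v" unfolding proportional_def by blast
  qed
  show "transp (proportional :: 'a \<Rightarrow> _)"
  proof (rule transpI)
    fix u v w :: 'a
    assume "proportional u v" "proportional v w"
    then obtain c d where "u \<noteq> 0" "w \<noteq> 0" "v = c *\<^sub>R u" "w = d *\<^sub>R v"
      unfolding proportional_def by blast
    then have "w = (d * c) *\<^sub>R u" by simp
    with \<open>u \<noteq> 0\<close> \<open>w \<noteq> 0\<close> show "proportional u w"
      unfolding proportional_def by blast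
  qed
qed

quotient_type (overloaded) 'a proj = "'a::euclidean_space" / partial: proportional
  morphisms rep_proj proj_point
  by (rule part_equivp_proportional)

instantiation proj :: (euclidean_space) topological_space
begin

definition open_proj :: "'a proj set \<Rightarrow> bool" where
  "open_proj U \<longleftrightarrow> open {v. v \<noteq> 0 \<and> proj_point v \<in> U}"

instance
proof
  have "{v::'a. v \<noteq> 0 \<and> proj_point v \<in> UNIV} = - {0}" by blast
  then show "open (UNIV :: 'a proj set)"
    unfolding open_proj_def by (simp add: open_Compl)
next
  fix S T :: "'a proj set"
  assume "open S" "open T"
  then have "open ({v. v \<noteq> 0 \<and> proj_point v \<in> S} \<inter> {v. v \<noteq> 0 \<and> proj_point v \<in> T})"
    unfolding open_proj_def by (rule open_Int)
  moreover have "{v. v \<noteq> 0 \<and> proj_point v \<in> S} \<inter> {v. v \<noteq> 0 \<and> proj_point v \<in> T} =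
      {v. v \<noteq> 0 \<and> proj_point v \<in> S \<inter> T}"
    by blast
  ultimately show "open (S \<inter> T)"
    unfolding open_proj_def by (simp only:)
next
  fix K :: "'a proj set set"
  assume "\<forall>S\<in>K. open S"
  then have "open (\<Union>S\<in>K. {v. v \<noteq> 0 \<and> proj_point v \<in> S})"
    unfolding open_proj_def by (rule open_UN)
  moreover have "(\<Union>S\<in>K. {v. v \<noteq> 0 \<and> proj_point v \<in> S}) =
      {v. v \<noteq> 0 \<and> proj_point v \<in> \<Union>K}"
    by blast
  ultimately show "open (\<Union>K)"
    unfolding open_proj_def by (simp only:)
qed

end

type_synonym 'n rp = "((real, 'n) vec \<times> real) proj"

definition proj_line :: "'a::euclidean_space proj set \<Rightarrow> bool" where
  "proj_line l \<longleftrightarrow> (\<exists>W. subspace W \<and> dim W = 2 \<and> l = proj_point ` (W - {0}))"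

definition proj_convex :: "'a::euclidean_space proj set \<Rightarrow> bool" where
  "proj_convex \<Omega> \<longleftrightarrow> (\<forall>l. proj_line l \<longrightarrow> connected (\<Omega> \<inter> l))"

definition proj_proper :: "'a::euclidean_space proj set \<Rightarrow> bool" where
  "proj_proper \<Omega> \<longleftrightarrow> \<not> (\<exists>l. proj_line l \<and> l \<subseteq> closure \<Omega>)"

definition proper_convex_domain :: "'a::euclidean_space proj set \<Rightarrow> bool" where
  "proper_convex_domain \<Omega> \<longleftrightarrow>
     open \<Omega> \<and> connected \<Omega> \<and> \<Omega> \<noteq> {} \<and> proj_convex \<Omega> \<and> proj_proper \<Omega>"

text \<open>Linearly independent \<open>e\<close>, \<open>f\<close> give an affine chart of the projective line spanned by
  \<open>[e]\<close> and \<open>[f]\<close>: the point with coordinate \<open>s\<close> is \<open>[s e + f]\<close>, and the point at infinity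
  is \<open>[e]\<close>. Every affine chart of the line arises in this way.\<close>

definition line_chart :: "'a::euclidean_space \<Rightarrow> 'a \<Rightarrow> bool" where
  "line_chart e f \<longleftrightarrow> e \<noteq> f \<and> independent {e, f}"

definition line_at :: "'a::euclidean_space \<Rightarrow> 'a \<Rightarrow> real \<Rightarrow> 'a proj" where
  "line_at e f s = proj_point (s *\<^sub>R e + f)"

definition cross_ratio ::
    "'a::euclidean_space proj \<Rightarrow> 'a proj \<Rightarrow> 'a proj \<Rightarrow> 'a proj \<Rightarrow> real" where
  "cross_ratio x1 x2 x3 x4 = (THE t. \<exists>e f. line_chart e f \<and>
     x1 = line_at e f 0 \<and> x2 = line_at e f 1 \<and> x3 = proj_point e \<and> x4 = line_at e f t)"

text \<open>A projective line carries no betweenness relation of its own; \<open>x\<close> is between \<open>a\<close> and \<open>y\<close>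
  inside the segment that the line cuts out of the closure of \<open>\<Omega>\<close>, so the chart is required to
  have its point at infinity outside that segment.\<close>

definition between_in ::
    "'a::euclidean_space proj set \<Rightarrow> 'a proj set \<Rightarrow> 'a proj \<Rightarrow> 'a proj \<Rightarrow> 'a proj \<Rightarrow> bool" where
  "between_in \<Omega> l a x y \<longleftrightarrow> (\<exists>e f \<alpha> \<xi> \<eta>. line_chart e f \<and>
     closure \<Omega> \<inter> l \<subseteq> range (line_at e f) \<and>
     a = line_at e f \<alpha> \<and> x = line_at e f \<xi> \<and> y = line_at e f \<eta> \<and> \<alpha> < \<xi> \<and> \<xi> < \<eta>)"

definition hilbert_dist ::
    "'a::euclidean_space proj set \<Rightarrow> 'a proj \<Rightarrow> 'a proj \<Rightarrow> real" where
  "hilbert_dist \<Omega> x y = (if x = y then 0 else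
     (THE d. \<exists>l a b. proj_line l \<and> x \<in> l \<and> y \<in> l \<and>
        l \<inter> frontier \<Omega> = {a, b} \<and> a \<noteq> b \<and> between_in \<Omega> l a x y \<and>
        d = 1 / 2 * ln \<bar>cross_ratio a x b y\<bar>))"

definition hilbert_ball ::
    "'a::euclidean_space proj set \<Rightarrow> 'a proj \<Rightarrow> real \<Rightarrow> 'a proj set" where
  "hilbert_ball \<Omega> p R = {x \<in> \<Omega>. hilbert_dist \<Omega> p x < R}"

text \<open>An affine chart of the projective space is given by a linear automorphism \<open>A\<close> of
  \<open>\<real>\<^sup>n \<times> \<real>\<close>: the point with coordinates \<open>x\<close> is \<open>[A (x, 1)]\<close>, and the hyperplane at infinity
  is the image of \<open>\<real>\<^sup>n \<times> {0}\<close>. A chart identifies the tangent spaces at all its points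
  with \<open>\<real>\<^sup>n\<close>.\<close>

definition affine_chart :: "((real, 'n::finite) vec \<times> real \<Rightarrow> (real, 'n) vec \<times> real) \<Rightarrow> bool" where
  "affine_chart A \<longleftrightarrow> linear A \<and> bij A"

definition chart_at ::
    "((real, 'n::finite) vec \<times> real \<Rightarrow> (real, 'n) vec \<times> real) \<Rightarrow> real ^ 'n \<Rightarrow> 'n rp" where
  "chart_at A x = proj_point (A (x, 1))"

text \<open>The squared Finsler norm of the tangent vector with coordinates \<open>u\<close> at the point with
  coordinates \<open>x\<close>, in the chart \<open>A\<close>.\<close>

definition hilbert_metric ::
    "'n::finite rp set \<Rightarrow> ((real, 'n) vec \<times> real \<Rightarrow> (real, 'n) vec \<times> real) \<Rightarrow>
     real ^ 'n \<Rightarrow> real ^ 'n \<Rightarrow> real" where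
  "hilbert_metric \<Omega> A x u = 1 / 2 *
     (deriv ^^ 2) (\<lambda>t. (hilbert_dist \<Omega> (chart_at A x) (chart_at A (x + t *\<^sub>R u)))\<^sup>2) 0"

text \<open>A (continuous) volume form on \<open>\<Omega>\<close>, taken up to sign, is represented by the measure it
  induces. Its coefficient in a chart is the continuous positive density of this measure with
  respect to Lebesgue measure, which is determined by the measure at every point of \<open>\<Omega>\<close>
  in the chart.\<close>

definition chart_density ::
    "'n::finite rp set \<Rightarrow> 'n rp measure \<Rightarrow> ((real, 'n) vec \<times> real \<Rightarrow> (real, 'n) vec \<times> real) \<Rightarrow>
     (real ^ 'n \<Rightarrow> real) \<Rightarrow> bool" where
  "chart_density \<Omega> vol A w \<longleftrightarrow>
     continuous_on (chart_at A -` \<Omega>) w \<and> (\<forall>x\<in>chart_at A -` \<Omega>. 0 < w x) \<and>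
     (\<forall>X\<in>sets borel. X \<subseteq> chart_at A -` \<Omega> \<longrightarrow>
        emeasure vol (chart_at A ` X) = (\<integral>\<^sup>+x\<in>X. ennreal (w x) \<partial>lborel))"

definition volume_form :: "'n::finite rp set \<Rightarrow> 'n rp measure \<Rightarrow> bool" where
  "volume_form \<Omega> vol \<longleftrightarrow> sets vol = sets borel \<and>
     (\<forall>A. affine_chart A \<longrightarrow> (\<exists>w. chart_density \<Omega> vol A w))"

definition uniform_volume_form :: "'n::finite rp set \<Rightarrow> 'n rp measure \<Rightarrow> bool" where
  "uniform_volume_form \<Omega> vol \<longleftrightarrow> volume_form \<Omega> vol \<and>
     (\<exists>K>1. \<forall>A w x. affine_chart A \<and> chart_density \<Omega> vol A w \<and> chart_at A x \<in> \<Omega> \<longrightarrow>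
        ennreal (1 / K) \<le> ennreal (w x) * emeasure lebesgue {u. hilbert_metric \<Omega> A x u \<le> 1} \<and>
        ennreal (w x) * emeasure lebesgue {u. hilbert_metric \<Omega> A x u \<le> 1} \<le> ennreal K)"

text \<open>Hilbert balls are relatively compact in \<open>\<Omega>\<close>, so their volume is finite.\<close>

definition volume_entropy :: "'n::finite rp set \<Rightarrow> 'n rp measure \<Rightarrow> 'n rp \<Rightarrow> ereal" where
  "volume_entropy \<Omega> vol p =
     Limsup at_top (\<lambda>R::real. ereal (1 / R * ln (measure vol (hilbert_ball \<Omega> p R))))"

end

theory Submission imports Defs begin

text \<open>In a suitable affine chart the domain is a bounded convex open set \<open>U\<close>, the section at height
  \<open>1\<close> of an open convex cone in dimension \<open>N = n + 1\<close>. Up to constants the density of a uniform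
  volume at \<open>x\<close> is the volume \<open>\<rho>(x)\<close> of \<open>T(x) = {\<xi>. <\<xi>, (x, 1)> \<le> 1}\<close>, a truncation of the dual cone.
  For \<open>\<xi> \<in> T(x)\<close> the symmetric body \<open>(T(x) - \<xi>) \<inter> (\<xi> - T(x))\<close> and the truncation \<open>S(\<xi>)\<close> of the
  cone by \<open>\<xi>\<close> each lie in the polar of the other, so the product of their volumes is bounded. Averaging over
  midpoints \<open>\<xi>\<close> of pairs of points of \<open>T(x)\<close> gives
  \<open>\<rho>(x)\<^sup>2 \<le> 2\<^sup>N \<integral> min (\<rho>(x)) (4\<^sup>N / vol (S(\<xi>))) d\<xi>\<close> over \<open>T(x)\<close>.

  Decompose \<open>T(x)\<close> by the size \<open>s = 4\<^sup>k\<close> of \<open>\<xi>\<close>. If \<open>\<rho>(x) \<le> s\<close> to the power \<open>N / 2\<close>, use that \<open>x\<close> lies in a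
  boundary layer of \<open>U\<close> of width \<open>O(1 / s)\<close>; otherwise exchange the integrals over \<open>x\<close> and \<open>\<xi>\<close> and
  use that \<open>\<xi>\<close> lies in a boundary layer of the dual cone of bounded width. Both contributions are
  \<open>O(s)\<close> to the power \<open>(n - 1) / 2\<close>. On a ball of radius \<open>R\<close> only scales \<open>s \<le> O(exp (2 R))\<close>
  occur, so its volume is \<open>O(R exp ((n - 1) R))\<close>.\<close>

text \<open>Exchanging integrals directly rewrites the integral of \<rho> as the integral of
  \<open>vol (cap \<xi>)\<close> over a boundary layer of the dual cone of height \<open>s\<close>.
  This only yields O(s^n), that is exp (2 n R) at \<open>s\<close> = exp (2 R). The gain comes from
  polarity, which applies because \<rho> is squared: one factor \<rho> is cancelled at the end, the
  other is compared with a threshold, separately for each \<open>x\<close> and each scale. The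
  threshold s^(N/2) balances the two regimes. Below it, the bound s^(N/2) on a layer of volume
  O(1/s) gives s^(N/2 - 1). Above it, the dual layer of volume O(s^n) is divided by s^(N/2). Both
  exponents equal (n - 1)/2. The bound on \<open>s\<close> holds because a ball of radius
  \<open>R\<close> about the origin of the chart lies in the closure of \<open>U\<close> contracted
  by 1 - exp (- 2 R), and there functionals in \<open>T(x)\<close> have size at most exp (2 R).
  Constants do not affect the exponential rate, so crude volume bounds for polar pairs suffice,
  obtained from parallelepipeds of maximal determinant instead of sharp affine inequalities.\<close>

section \<open>Volumes of polar pairs\<close>

text \<open>The library relates determinants and volumes only for index types of class
  \<^class>\<open>wellorder\<close>, hence this index type for the coordinates of an arbitrary Euclidean space.\<close>

typedef (overloaded) 'a coord = "{..<DIM('a::euclidean_space)}"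
  by (metis DIM_positive lessThan_iff)

lemma bij_betw_Rep_coord: "bij_betw Rep_coord (UNIV :: 'a::euclidean_space coord set) {..<DIM('a)}"
  by (metis type_definition.Rep_range type_definition_coord bij_betw_def inj_def Rep_coord_inject)

instance coord :: (euclidean_space) finite
  by standard (use bij_betw_Rep_coord bij_betw_finite in blast)

lemma CARD_coord: "CARD('a::euclidean_space coord) = DIM('a)"
  using bij_betw_same_card[OF bij_betw_Rep_coord] by simp

instantiation coord :: (euclidean_space) wellorder
begin

definition less_eq_coord :: "'a coord \<Rightarrow> 'a coord \<Rightarrow> bool" where
  "less_eq_coord i j \<longleftrightarrow> Rep_coord i \<le> Rep_coord j"

definition less_coord :: "'a coord \<Rightarrow> 'a coord \<Rightarrow> bool" where
  "less_coord i j \<longleftrightarrow> Rep_coord i < Rep_coord j"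

instance
proof
  fix P and i :: "'a coord"
  assume *: "\<And>i::'a coord. (\<And>j. j < i \<Longrightarrow> P j) \<Longrightarrow> P i"
  show "P i"
    by (induction i rule: measure_induct_rule[of Rep_coord]) (rule *, simp add: less_coord_def)
qed (auto simp: less_eq_coord_def less_coord_def Rep_coord_inject)

end

text \<open>Supplies a tuple from \<open>D\<close> with nonzero determinant, so that the maximal
  absolute determinant over such tuples is positive.\<close>

lemma span_rows_eq_UNIV_of_spanning:
  fixes D :: "(real^'m) set"
  assumes "span D = UNIV"
  obtains V :: "real^'m^'m" where "\<And>i. V $ i \<in> D" "det V \<noteq> 0"
proof -
  obtain B where B: "B \<subseteq> D" "independent B" "D \<subseteq> span B" "card B = dim D"
    using basis_exists by blast
  have sp: "span B = UNIV"
    using B(3) assms by (metis span_mono span_span top.extremum_uniqueI)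
  have cB: "card B = CARD('m)"
    using B(4) assms by (metis dim_UNIV dim_span DIM_cart DIM_real mult.right_neutral)
  have "finite B" using B(2) independent_imp_finite by blast
  then obtain f where f: "bij_betw f (UNIV::'m set) B"
    using cB finite_same_card_bij[of "UNIV::'m set" B] by auto
  define V :: "real^'m^'m" where "V = (\<chi> i. f i)"
  have "rows V = B"
    using f by (auto simp: V_def rows_def row_def vec_eq_iff bij_betw_def vec_lambda_eta)
  then have "\<exists>C. V ** C = mat 1 \<or> C ** V = mat 1"
    using sp matrix_left_invertible_span_rows_gen matrix_right_invertible_span_columns
    by (metis matrix_left_invertible_span_rows)
  then have "invertible V"
    using invertible_left_inverse invertible_right_inverse by blast
  then have "det V \<noteq> 0" by (simp add: invertible_det_nz)
  moreover have "V $ i \<in> D" for i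
    using f B(1) by (auto simp: V_def bij_betw_def)
  ultimately show ?thesis using that by blast
qed

lemma compact_vecs_in:
  fixes D :: "(real^'m) set"
  assumes "compact D"
  shows "compact {V::real^'m^'m. \<forall>i. V $ i \<in> D}"
proof -
  have "bounded {V::real^'m^'m. \<forall>i. V $ i \<in> D}"
  proof -
    obtain b where b: "\<And>x. x \<in> D \<Longrightarrow> norm x \<le> b"
      using assms compact_imp_bounded bounded_iff by metis
    have "norm V \<le> (\<Sum>i\<in>(UNIV::'m set). b)" if "\<forall>i. V $ i \<in> D" for V :: "real^'m^'m"
    proof -
      have "norm V \<le> (\<Sum>i\<in>UNIV. norm (V $ i))"
        unfolding norm_vec_def by (rule L2_set_le_sum) auto
      also have "\<dots> \<le> (\<Sum>i\<in>(UNIV::'m set). b)" by (rule sum_mono) (use that b in auto)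
      finally show ?thesis .
    qed
    then show ?thesis unfolding bounded_iff by blast
  qed
  moreover have "closed {V::real^'m^'m. \<forall>i. V $ i \<in> D}"
  proof -
    have "closed D" using assms compact_imp_closed by blast
    then have "closed ((\<lambda>V::real^'m^'m. V $ i) -` D)" for i
      by (intro continuous_closed_vimage continuous_intros)
    then have "closed (\<Inter>i. (\<lambda>V::real^'m^'m. V $ i) -` D)" by blast
    moreover have "(\<Inter>i. (\<lambda>V::real^'m^'m. V $ i) -` D) = {V. \<forall>i. V $ i \<in> D}" by auto
    ultimately show ?thesis by simp
  qed
  ultimately show ?thesis by (simp add: compact_eq_bounded_closed)
qed

text \<open>The maximizing vectors play the role of an Auerbach basis: by Cramer's rule every point of
  \<open>D\<close> has coordinates in \<open>[-1, 1]\<close> with respect to them.\<close>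

lemma compact_max_det:
  fixes D :: "(real^'m) set"
  assumes "compact D" "emeasure lborel D \<noteq> 0"
  obtains V :: "real^'m^'m" where "\<And>i. V $ i \<in> D" "det V \<noteq> 0"
    "\<And>x. x \<in> D \<Longrightarrow> \<exists>c. x = transpose V *v c \<and> (\<forall>i. \<bar>c $ i\<bar> \<le> 1)"
proof -
  \<comment> \<open>A set inside a proper subspace is negligible, so positive volume forces
    spanning.\<close>
  have sp: "span D = UNIV"
  proof (rule ccontr)
    assume "span D \<noteq> UNIV"
    then have "dim D < DIM(real^'m)"
      by (metis dim_eq_full dim_subset_UNIV order_less_le)
    then have "negligible D" by (rule negligible_lowdim)
    then have "emeasure lebesgue D = 0" by (meson negligible_iff_null_sets null_setsD1)
    moreover have "D \<in> sets lborel" using assms(1) by (simp add: borel_compact)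
    ultimately have "emeasure lborel D = 0" by simp
    with assms(2) show False by simp
  qed
  obtain W :: "real^'m^'m" where W: "\<And>i. W $ i \<in> D" "det W \<noteq> 0"
    using span_rows_eq_UNIV_of_spanning[OF sp] by blast
  let ?S = "{V::real^'m^'m. \<forall>i. V $ i \<in> D}"
  have "continuous_on ?S (\<lambda>V. \<bar>det V\<bar>)"
    unfolding det_def by (intro continuous_intros)
  then obtain V where V: "V \<in> ?S" "\<And>U. U \<in> ?S \<Longrightarrow> \<bar>det U\<bar> \<le> \<bar>det V\<bar>"
    using continuous_attains_sup[OF compact_vecs_in[OF assms(1)], of "\<lambda>V. \<bar>det V\<bar>"] W(1) by blast
  have d: "det V \<noteq> 0" using V(2)[of W] W by auto
  have "\<exists>c. x = transpose V *v c \<and> (\<forall>i. \<bar>c $ i\<bar> \<le> 1)" if x: "x \<in> D" for x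
  proof -
    have "invertible (transpose V)" using d by (simp add: invertible_det_nz det_transpose)
    then obtain c where c: "transpose V *v c = x"
      by (metis invertible_def matrix_vector_mul_assoc matrix_vector_mul_lid)
    have xs: "x = (\<Sum>i\<in>UNIV. c $ i *s row i V)"
      using matrix_mult_sum[of "transpose V" c] unfolding c column_transpose .
    have "\<bar>c $ k\<bar> \<le> 1" for k
    proof -
      \<comment> \<open>Exchanging row \<open>k\<close> for \<open>x\<close> multiplies the
        determinant by \<open>c $ k\<close>; maximality then bounds that coordinate.\<close>
      have "(\<chi> i. if i = k then x else row i V) \<in> ?S"
        using V(1) x by (auto simp: row_def vec_lambda_eta)
      then have "\<bar>det (\<chi> i. if i = k then x else row i V)\<bar> \<le> \<bar>det V\<bar>" by (rule V(2))
      moreover have "det (\<chi> i. if i = k then x else row i V) = c $ k * det V"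
        using cramer_lemma_transpose[where x=c and A=V and k=k, folded xs] .
      ultimately have "\<bar>c $ k\<bar> * \<bar>det V\<bar> \<le> \<bar>det V\<bar>"
        by (simp add: abs_mult)
      then show ?thesis using d by simp
    qed
    then show ?thesis using c by blast
  qed
  then show ?thesis using that V(1) d by blast
qed

lemma compact_matrix_cbox: "compact ((*v) M ` cbox a b)" for M :: "real^'m^'k"
  by (intro compact_continuous_image compact_cbox linear_continuous_on
      matrix_vector_mul_bounded_linear)

lemma emeasure_lborel_matrix_cbox:
  fixes M :: "real^'m::{finite,wellorder}^'m::{finite,wellorder}"
  assumes "\<And>i. a $ i \<le> b $ i"
  shows "emeasure lborel ((*v) M ` cbox a b) = ennreal (\<bar>det M\<bar> * (\<Prod>i\<in>UNIV. b $ i - a $ i))"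
proof -
  have c: "compact ((*v) M ` cbox a b)"
    by (rule compact_matrix_cbox)
  have "emeasure lborel ((*v) M ` cbox a b) = emeasure lebesgue ((*v) M ` cbox a b)"
    using c by (simp add: compact_imp_closed borel_closed)
  also have "\<dots> = ennreal (measure lebesgue ((*v) M ` cbox a b))"
    using c by (simp add: lmeasurable_compact emeasure_eq_measure2)
  also have "measure lebesgue ((*v) M ` cbox a b) = \<bar>det M\<bar> * measure lebesgue (cbox a b)"
    using measure_linear_image[OF matrix_vector_mul_linear, of "cbox a b" M]
    by (simp only: matrix_of_matrix_vector_mul lmeasurable_cbox simp_thms)
  also have "measure lebesgue (cbox a b) = (\<Prod>i\<in>UNIV. b $ i - a $ i)"
    using assms by (metis content_cbox_cart interval_ne_empty_cart(1) measure_completion borel_closed closed_cbox sets_lborel)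
  finally show ?thesis .
qed

text \<open>With \<open>V\<close> a tuple of maximal determinant in \<open>D\<close>, the set
  \<open>D\<close> lies in the parallelepiped with coordinates in [-1, 1] along \<open>V\<close>,
  and \<open>Q\<close> in the one for the inverse \<open>H\<close>, because each row of
  \<open>V\<close> is itself a point of \<open>D\<close>. The determinants cancel and two cubes of
  side 2 leave 4 to the dimension.\<close>

lemma emeasure_polar_pair_le_cart:
  fixes D Q :: "(real^'m::{finite,wellorder}) set"
  assumes D: "compact D" and DQ: "\<And>x y. x \<in> D \<Longrightarrow> y \<in> Q \<Longrightarrow> \<bar>x \<bullet> y\<bar> \<le> 1"
  shows "emeasure lborel D * emeasure lborel Q \<le> 4 ^ CARD('m)"
proof (cases "emeasure lborel D = 0")
  case True
  then show ?thesis by simp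
next
  case False
  obtain V where V: "\<And>i. V $ i \<in> D" "det V \<noteq> 0"
    and VD: "\<And>x. x \<in> D \<Longrightarrow> \<exists>c. x = transpose V *v c \<and> (\<forall>i. \<bar>c $ i\<bar> \<le> 1)"
    using compact_max_det[OF D False] by blast
  obtain H where H: "H ** V = mat 1" "V ** H = mat 1"
    using V(2) by (metis invertible_det_nz invertible_def)
  have dH: "det H * det V = 1" using H by (metis det_mul det_I)
  let ?a = "(\<chi> i. -1)::(real,'m) vec" and ?b = "(\<chi> i. 1)::(real,'m) vec"
  have "D \<subseteq> (*v) (transpose V) ` cbox ?a ?b"
    using VD by (force simp: mem_box_cart abs_le_iff)
  then have "emeasure lborel D \<le> emeasure lborel ((*v) (transpose V) ` cbox ?a ?b)"
    using borel_compact[OF compact_matrix_cbox] by (intro emeasure_mono) (simp_all only: sets_lborel)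
  also have "\<dots> = ennreal (\<bar>det V\<bar> * 2 ^ CARD('m))"
    by (subst emeasure_lborel_matrix_cbox) (auto simp: det_transpose)
  finally have 1: "emeasure lborel D \<le> ennreal (\<bar>det V\<bar> * 2 ^ CARD('m))" .
  have "y \<in> (*v) H ` cbox ?a ?b" if "y \<in> Q" for y
  proof (rule image_eqI)
    show "y = H *v (V *v y)" by (simp add: matrix_vector_mul_assoc H)
    show "V *v y \<in> cbox ?a ?b"
      using DQ[OF V(1) that] by (auto simp: mem_box_cart matrix_vector_mul_component abs_le_iff minus_le_iff)
  qed
  then have "emeasure lborel Q \<le> emeasure lborel ((*v) H ` cbox ?a ?b)"
    using borel_compact[OF compact_matrix_cbox] by (intro emeasure_mono subsetI) (simp_all only: sets_lborel)
  also have "\<dots> = ennreal (\<bar>det H\<bar> * 2 ^ CARD('m))"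
    by (subst emeasure_lborel_matrix_cbox) auto
  finally have 2: "emeasure lborel Q \<le> ennreal (\<bar>det H\<bar> * 2 ^ CARD('m))" .
  have "emeasure lborel D * emeasure lborel Q
      \<le> ennreal (\<bar>det V\<bar> * 2 ^ CARD('m)) * ennreal (\<bar>det H\<bar> * 2 ^ CARD('m))"
    by (rule mult_mono[OF 1 2]) auto
  also have "\<dots> = ennreal (\<bar>det H * det V\<bar> * (2 ^ CARD('m) * 2 ^ CARD('m)))"
    by (simp add: abs_mult ac_simps flip: ennreal_mult)
  also have "\<dots> = 4 ^ CARD('m)"
    unfolding dH by (simp flip: power_mult_distrib) (metis ennreal_numeral ennreal_power zero_le_numeral)
  finally show ?thesis .
qed

lemma closed_polar: "closed {y::'a::euclidean_space. \<forall>x\<in>T. \<bar>x \<bullet> y\<bar> \<le> 1}"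
proof -
  have "closed {y::'a. \<bar>x \<bullet> y\<bar> \<le> 1}" for x
    by (intro closed_Collect_le continuous_intros)
  then have "closed (\<Inter>x\<in>T. {y. \<bar>x \<bullet> y\<bar> \<le> 1})" by blast
  moreover have "(\<Inter>x\<in>T. {y. \<bar>x \<bullet> y\<bar> \<le> 1}) = {y. \<forall>x\<in>T. \<bar>x \<bullet> y\<bar> \<le> 1}" by auto
  ultimately show ?thesis by simp
qed

text \<open>Converse inclusions: \<open>T\<close> contains the simplex on 0 and the rows of
  \<open>V\<close>, hence the image of a cube of side 1/m. Points of \<open>T\<close> have
  \<open>V\<close>-coordinates in [-1, 1], so the polar contains the image under \<open>H\<close> of
  a cube of side 2/m.\<close>

lemma emeasure_polar_pair_ge_cart:
  fixes T :: "(real^'m::{finite,wellorder}) set"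
  assumes T: "compact T" "convex T" "0 \<in> T" "emeasure lborel T \<noteq> 0"
  shows "ennreal ((2 / real CARD('m) ^ 2) ^ CARD('m))
    \<le> emeasure lborel T * emeasure lborel {y. \<forall>x\<in>T. \<bar>x \<bullet> y\<bar> \<le> 1}"
proof -
  let ?m = "CARD('m)"
  obtain V where V: "\<And>i. V $ i \<in> T" "det V \<noteq> 0"
    and VD: "\<And>x. x \<in> T \<Longrightarrow> \<exists>c. x = transpose V *v c \<and> (\<forall>i. \<bar>c $ i\<bar> \<le> 1)"
    using compact_max_det[OF T(1,4)] by blast
  obtain H where H: "H ** V = mat 1" "V ** H = mat 1"
    using V(2) by (metis invertible_det_nz invertible_def)
  have dH: "det H * det V = 1" using H by (metis det_mul det_I)
  let ?a = "(\<chi> i. - 1 / ?m)::(real,'m) vec" and ?b = "(\<chi> i. 1 / ?m)::(real,'m) vec"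
  have "(*v) (transpose V) ` cbox 0 ?b \<subseteq> T"
  proof
    fix x assume "x \<in> (*v) (transpose V) ` cbox 0 ?b"
    then obtain c where c: "x = transpose V *v c" "\<And>i. 0 \<le> c $ i" "\<And>i. c $ i \<le> 1 / ?m"
      by (auto simp: mem_box_cart)
    have "(\<Sum>i\<in>UNIV. c $ i) \<le> (\<Sum>i\<in>(UNIV::'m set). 1 / ?m)" by (rule sum_mono) (rule c)
    then have s: "(\<Sum>i\<in>UNIV. c $ i) \<le> 1" by simp
    have "x = (\<Sum>i\<in>UNIV. c $ i *\<^sub>R V $ i)"
      by (simp add: c(1) matrix_mult_sum column_transpose row_def vec_lambda_eta scalar_mult_eq_scaleR)
    also have "\<dots> = (\<Sum>i\<in>UNIV. c $ i *\<^sub>R V $ i) + (1 - (\<Sum>i\<in>UNIV. c $ i)) *\<^sub>R 0" by simp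
    also have "\<dots> \<in> T"
    proof -
      \<comment> \<open>The extra index \<open>None\<close> gives the origin the leftover weight,
        which makes this a convex combination.\<close>
      let ?w = "\<lambda>j. case j of Some i \<Rightarrow> c $ i | None \<Rightarrow> 1 - (\<Sum>i\<in>UNIV. c $ i)"
      let ?v = "\<lambda>j. case j of Some i \<Rightarrow> V $ i | None \<Rightarrow> 0"
      have "(\<Sum>j\<in>(UNIV::'m option set). ?w j *\<^sub>R ?v j) \<in> T"
      proof (rule convex_sum)
        show "sum ?w UNIV = 1" by (simp add: UNIV_option_conv sum.reindex)
        show "?w j \<ge> 0" "?v j \<in> T" for j using c(2) s V(1) T(3) by (auto split: option.split)
      qed (use T(2) in auto)
      then show ?thesis by (simp add: UNIV_option_conv sum.reindex)
    qed
    finally show "x \<in> T" .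
  qed
  then have "emeasure lborel ((*v) (transpose V) ` cbox 0 ?b) \<le> emeasure lborel T"
    using T(1) by (intro emeasure_mono) (auto intro: borel_compact)
  moreover have "emeasure lborel ((*v) (transpose V) ` cbox 0 ?b) = ennreal (\<bar>det V\<bar> * (1 / ?m) ^ ?m)"
    by (subst emeasure_lborel_matrix_cbox) (auto simp: det_transpose)
  ultimately have 1: "ennreal (\<bar>det V\<bar> * (1 / ?m) ^ ?m) \<le> emeasure lborel T" by simp
  let ?Z = "{y. \<forall>x\<in>T. \<bar>x \<bullet> y\<bar> \<le> 1}"
  have "closed ?Z" by (rule closed_polar)
  moreover have "(*v) H ` cbox ?a ?b \<subseteq> ?Z"
  proof
    fix y assume "y \<in> (*v) H ` cbox ?a ?b"
    then obtain z where z: "y = H *v z" "\<And>i. - 1 / ?m \<le> z $ i" "\<And>i. z $ i \<le> 1 / ?m"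
      by (auto simp: mem_box_cart)
    have "\<bar>x \<bullet> y\<bar> \<le> 1" if x: "x \<in> T" for x
    proof -
      obtain c where c: "x = transpose V *v c" "\<And>i. \<bar>c $ i\<bar> \<le> 1" using VD[OF x] by blast
      have "x \<bullet> y = c \<bullet> (V *v y)"
        by (simp add: c dot_lmul_matrix[symmetric] transpose_matrix_vector)
      also have "V *v y = z" by (simp add: z matrix_vector_mul_assoc H)
      finally have "\<bar>x \<bullet> y\<bar> \<le> (\<Sum>i\<in>UNIV. \<bar>c $ i * z $ i\<bar>)"
        by (simp add: inner_vec_def)
      also have "\<dots> \<le> (\<Sum>i\<in>(UNIV::'m set). 1 * (1 / ?m))"
      proof (rule sum_mono)
        fix i
        have "\<bar>z $ i\<bar> \<le> 1 / ?m" using z(2,3)[of i] by (simp add: abs_le_iff minus_le_iff)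
        then show "\<bar>c $ i * z $ i\<bar> \<le> 1 * (1 / ?m)"
          unfolding abs_mult by (intro mult_mono c) auto
      qed
      finally show ?thesis by simp
    qed
    then show "y \<in> ?Z" by blast
  qed
  ultimately have "emeasure lborel ((*v) H ` cbox ?a ?b) \<le> emeasure lborel ?Z"
    by (intro emeasure_mono) (auto intro: borel_closed)
  moreover have "emeasure lborel ((*v) H ` cbox ?a ?b) = ennreal (\<bar>det H\<bar> * (2 / ?m) ^ ?m)"
    by (subst emeasure_lborel_matrix_cbox) auto
  ultimately have 2: "ennreal (\<bar>det H\<bar> * (2 / ?m) ^ ?m) \<le> emeasure lborel ?Z" by simp
  have "(2 / real ?m ^ 2) ^ ?m = \<bar>det H * det V\<bar> * ((1 / ?m) ^ ?m * (2 / ?m) ^ ?m)"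
    unfolding dH by (simp add: power2_eq_square flip: power_mult_distrib)
  also have "ennreal \<dots> = ennreal (\<bar>det V\<bar> * (1 / ?m) ^ ?m) * ennreal (\<bar>det H\<bar> * (2 / ?m) ^ ?m)"
    by (simp add: abs_mult ac_simps flip: ennreal_mult)
  also have "\<dots> \<le> emeasure lborel T * emeasure lborel ?Z"
    by (rule mult_mono[OF 1 2]) auto
  finally show ?thesis .
qed

section \<open>Transfer to arbitrary Euclidean spaces by a measure-preserving isometry\<close>

lemma isometric_coordinates:
  obtains f :: "real^'a coord \<Rightarrow> 'a::euclidean_space" where "linear f" "bij f" "\<And>x y. f x \<bullet> f y = x \<bullet> y"
    "distr lborel borel f = lborel"
proof -
  obtain \<beta> where \<beta>: "bij_betw \<beta> (UNIV::'a coord set) (Basis::'a set)"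
    using CARD_coord finite_same_card_bij[of "UNIV::'a coord set" "Basis::'a set"] by auto
  have \<beta>B: "\<beta> i \<in> Basis" for i using \<beta> by (auto simp: bij_betw_def)
  define f where "f w = (\<Sum>i\<in>UNIV. w $ i *\<^sub>R \<beta> i)" for w :: "real^'a coord"
  have lf: "linear f" unfolding f_def
    by (intro linearI) (simp_all add: scaleR_add_left sum.distrib scaleR_sum_right)
  have \<beta>\<beta>: "\<beta> i \<bullet> \<beta> j = (if i = j then 1 else 0)" for i j
    using \<beta> \<beta>B by (auto simp: inner_Basis bij_betw_def inj_def)
  have fi: "f w \<bullet> \<beta> j = w $ j" for w j
    by (simp add: f_def inner_sum_left \<beta>\<beta> if_distrib cong: if_cong)
  have inn: "f x \<bullet> f y = x \<bullet> y" for x y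
    by (subst (2) f_def) (simp add: inner_sum_right fi inner_vec_def mult.commute)
  have inj: "inj f" by (rule injI) (metis fi vec_eq_iff)
  have f2: "f (\<chi> i. y \<bullet> \<beta> i) = y" for y
  proof -
    have "f (\<chi> i. y \<bullet> \<beta> i) = (\<Sum>b\<in>Basis. (y \<bullet> b) *\<^sub>R b)"
      unfolding f_def using sum.reindex_bij_betw[OF \<beta>, of "\<lambda>b. (y \<bullet> b) *\<^sub>R b"] by simp
    then show ?thesis by (simp add: euclidean_representation)
  qed
  then have "surj f" by (rule surjI)
  with inj have bij: "bij f" by (simp add: bij_def)
  have meas: "f \<in> borel_measurable borel"
    by (intro borel_measurable_continuous_onI linear_continuous_on lf[unfolded linear_conv_bounded_linear])
  have "lborel = distr lborel borel f"
  proof (rule lborel_eqI)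
    fix l u :: 'a assume lu: "\<And>b. b \<in> Basis \<Longrightarrow> l \<bullet> b \<le> u \<bullet> b"
    let ?l = "(\<chi> i. l \<bullet> \<beta> i)::real^'a coord" and ?u = "(\<chi> i. u \<bullet> \<beta> i)::real^'a coord"
    have "f -` box l u = box ?l ?u"
    proof -
      have "(\<forall>b\<in>Basis. l \<bullet> b < f w \<bullet> b \<and> f w \<bullet> b < u \<bullet> b) \<longleftrightarrow> (\<forall>i. l \<bullet> \<beta> i < w $ i \<and> w $ i < u \<bullet> \<beta> i)" for w
      proof -
        have B: "Basis = range \<beta>" using \<beta> by (simp add: bij_betw_def)
        show ?thesis unfolding B ball_simps fi by simp
      qed
      then show ?thesis by (auto simp: set_eq_iff mem_box(1)[where 'a='a] mem_box_cart)
    qed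
    then have "emeasure (distr lborel borel f) (box l u) = emeasure lborel (box ?l ?u)"
      using meas by (subst emeasure_distr) auto
    also have "\<dots> = ennreal (\<Prod>i\<in>UNIV. (u - l) \<bullet> \<beta> i)"
    proof -
      have "emeasure lborel (box ?l ?u) = emeasure lborel (cbox ?l ?u)"
        by (simp add: emeasure_lborel_box_eq emeasure_lborel_cbox_eq)
      also have "\<dots> = emeasure lborel ((*v) (mat 1) ` cbox ?l ?u)"
        by simp
      also have "\<dots> = ennreal (\<Prod>i\<in>UNIV. (u - l) \<bullet> \<beta> i)"
        by (subst emeasure_lborel_matrix_cbox) (use lu \<beta>B in \<open>auto simp: inner_diff_left\<close>)
      finally show ?thesis .
    qed
    also have "(\<Prod>i\<in>UNIV. (u - l) \<bullet> \<beta> i) = prod ((\<bullet>) (u - l)) Basis"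
      by (rule prod.reindex_bij_betw[OF \<beta>])
    finally show "emeasure (distr lborel borel f) (box l u) = ennreal (prod ((\<bullet>) (u - l)) Basis)" .
  qed simp
  then show ?thesis using that lf bij inn by metis
qed

lemma emeasure_polar_pair_le:
  fixes D Q :: "'a::euclidean_space set"
  assumes D: "compact D" and Q: "Q \<in> sets borel"
    and DQ: "\<And>x y. x \<in> D \<Longrightarrow> y \<in> Q \<Longrightarrow> \<bar>x \<bullet> y\<bar> \<le> 1"
  shows "emeasure lborel D * emeasure lborel Q \<le> 4 ^ DIM('a)"
proof -
  obtain f :: "real^'a coord \<Rightarrow> 'a" where f: "linear f" "bij f" "\<And>x y. f x \<bullet> f y = x \<bullet> y"
    "distr lborel borel f = lborel" using isometric_coordinates by blast
  have meas: "f \<in> borel_measurable lborel"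
    using f(1) by (auto intro!: borel_measurable_continuous_onI linear_continuous_on simp: linear_conv_bounded_linear)
  have em: "emeasure lborel S = emeasure lborel (f -` S)" if "S \<in> sets borel" for S
    using emeasure_distr[OF meas that] f(4) by simp
  obtain g where g: "linear g" "g \<circ> f = id" "f \<circ> g = id"
  proof -
    obtain g where "linear g" "g \<circ> f = id"
      using linear_injective_left_inverse[OF f(1)] f(2) bij_is_inj by blast
    moreover from this have "f \<circ> g = id"
      using f(2) by (metis bij_is_inj bij_is_surj comp_assoc comp_id inv_o_cancel surj_iff id_comp)
    ultimately show ?thesis using that by blast
  qed
  have "f -` D = g ` D" 
  proof (intro set_eqI iffI)
    show "x \<in> g ` D" if "x \<in> f -` D" for x
      using that g(2) by (intro image_eqI[of _ _ "f x"]) (auto simp: fun_eq_iff)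
  qed (use g(3) in \<open>auto simp: fun_eq_iff\<close>)
  then have "compact (f -` D)"
    using D g(1) compact_continuous_image linear_continuous_on linear_conv_bounded_linear by metis
  moreover have "\<bar>x \<bullet> y\<bar> \<le> 1" if "x \<in> f -` D" "y \<in> f -` Q" for x y
    using DQ[of "f x" "f y"] that f(3) by simp
  ultimately have "emeasure lborel (f -` D) * emeasure lborel (f -` Q) \<le> 4 ^ CARD('a coord)"
    by (rule emeasure_polar_pair_le_cart)
  then show ?thesis using em[of D] em[of Q] D Q by (simp add: CARD_coord borel_compact)
qed

lemma emeasure_polar_pair_ge:
  fixes T :: "'a::euclidean_space set"
  assumes T: "compact T" "convex T" "0 \<in> T" "emeasure lborel T \<noteq> 0"
  shows "ennreal ((2 / real DIM('a) ^ 2) ^ DIM('a))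
    \<le> emeasure lborel T * emeasure lborel {y. \<forall>x\<in>T. \<bar>x \<bullet> y\<bar> \<le> 1}"
proof -
  obtain f :: "real^'a coord \<Rightarrow> 'a" where f: "linear f" "bij f" "\<And>x y. f x \<bullet> f y = x \<bullet> y"
    "distr lborel borel f = lborel" using isometric_coordinates by blast
  have meas: "f \<in> borel_measurable lborel"
    using f(1) by (auto intro!: borel_measurable_continuous_onI linear_continuous_on simp: linear_conv_bounded_linear)
  have em: "emeasure lborel S = emeasure lborel (f -` S)" if "S \<in> sets borel" for S
    using emeasure_distr[OF meas that] f(4) by simp
  obtain g where g: "linear g" "g \<circ> f = id" "f \<circ> g = id"
  proof -
    obtain g where "linear g" "g \<circ> f = id"
      using linear_injective_left_inverse[OF f(1)] f(2) bij_is_inj by blast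
    moreover from this have "f \<circ> g = id"
      using f(2) by (metis bij_is_inj bij_is_surj comp_assoc comp_id inv_o_cancel surj_iff id_comp)
    ultimately show ?thesis using that by blast
  qed
  have fT: "f -` T = g ` T" 
  proof (intro set_eqI iffI)
    show "x \<in> g ` T" if "x \<in> f -` T" for x
      using that g(2) by (intro image_eqI[of _ _ "f x"]) (auto simp: fun_eq_iff)
  qed (use g(3) in \<open>auto simp: fun_eq_iff\<close>)
  then have "compact (f -` T)"
    using T g(1) compact_continuous_image linear_continuous_on linear_conv_bounded_linear by metis
  moreover have "convex (f -` T)" using f(1) T(2) by (rule convex_linear_vimage)
  moreover have "0 \<in> f -` T" using f(1) T(3) by (simp add: linear_0)
  moreover have "emeasure lborel (f -` T) \<noteq> 0" using em[of T] T(1,4) by (simp add: borel_compact)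
  ultimately have "ennreal ((2 / real CARD('a coord) ^ 2) ^ CARD('a coord))
    \<le> emeasure lborel (f -` T) * emeasure lborel {y. \<forall>x\<in>f -` T. \<bar>x \<bullet> y\<bar> \<le> 1}"
    by (rule emeasure_polar_pair_ge_cart)
  moreover have "{y. \<forall>x\<in>f -` T. \<bar>x \<bullet> y\<bar> \<le> 1} = f -` {y. \<forall>x\<in>T. \<bar>x \<bullet> y\<bar> \<le> 1}"
  proof -
    have "(\<forall>x\<in>T. \<bar>x \<bullet> f y\<bar> \<le> 1) \<longleftrightarrow> (\<forall>x\<in>f -` T. \<bar>x \<bullet> y\<bar> \<le> 1)" for y
      using f(2,3) by (metis (no_types, lifting) bij_def surjD vimageE vimageI)
    then show ?thesis by auto
  qed
  moreover have "{y. \<forall>x\<in>T. \<bar>x \<bullet> y\<bar> \<le> 1} \<in> sets borel" by (simp add: closed_polar borel_closed)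
  ultimately show ?thesis using em[of T] em T by (simp add: CARD_coord borel_compact)
qed

section \<open>Truncations of a convex cone and of its dual\<close>

lemma sets_lborel_pair:
  "sets (lborel \<Otimes>\<^sub>M lborel) = sets (borel :: ('a::euclidean_space \<times> 'b::euclidean_space) measure)"
  by (metis lborel_prod sets_lborel)

lemma emeasure_lborel_affine_image:
  fixes S :: "'a::euclidean_space set"
  assumes "c \<noteq> 0" "S \<in> sets borel"
  shows "(\<lambda>x. c *\<^sub>R x + d) ` S \<in> sets borel"
    and "emeasure lborel ((\<lambda>x. c *\<^sub>R x + d) ` S) = ennreal (\<bar>c\<bar> ^ DIM('a)) * emeasure lborel S"
proof -
  have "(\<lambda>x. c *\<^sub>R x + d) ` S = (\<lambda>y. inverse c *\<^sub>R (y - d)) -` S"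
  proof (intro set_eqI iffI)
    show "y \<in> (\<lambda>x. c *\<^sub>R x + d) ` S" if "y \<in> (\<lambda>y. inverse c *\<^sub>R (y - d)) -` S" for y
      using that assms(1) by (intro image_eqI[of _ _ "inverse c *\<^sub>R (y - d)"]) auto
  qed (use assms(1) in auto)
  moreover have "(\<lambda>y. inverse c *\<^sub>R (y - d)) \<in> borel_measurable borel" by measurable
  ultimately show *: "(\<lambda>x. c *\<^sub>R x + d) ` S \<in> sets borel"
    using measurable_sets[of "\<lambda>y. inverse c *\<^sub>R (y - d)" borel borel S] assms(2) by simp
  show "emeasure lborel ((\<lambda>x. c *\<^sub>R x + d) ` S) = ennreal (\<bar>c\<bar> ^ DIM('a)) * emeasure lborel S"
    using emeasure_lebesgue_affine[of c d S] assms(2) * by simp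
qed

lemma emeasure_lborel_scaleR_image:
  fixes S :: "'a::euclidean_space set"
  assumes "c \<noteq> 0" "S \<in> sets borel"
  shows "(*\<^sub>R) c ` S \<in> sets borel"
    and "emeasure lborel ((*\<^sub>R) c ` S) = ennreal (\<bar>c\<bar> ^ DIM('a)) * emeasure lborel S"
  using emeasure_lborel_affine_image[OF assms, of 0] by simp_all

lemma emeasure_lborel_open_pos:
  fixes S :: "'a::euclidean_space set"
  assumes "open S" "S \<noteq> {}"
  shows "0 < emeasure lborel S"
proof -
  have "emeasure lborel S \<noteq> 0"
  proof
    assume "emeasure lborel S = 0"
    then have "S \<in> null_sets lborel" using assms(1) by (intro null_setsI) auto
    then have "negligible S" unfolding negligible_iff_null_sets by (rule null_sets_completionI)
    then show False using assms open_not_negligible by blast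
  qed
  then show ?thesis by (simp add: zero_less_iff_neq_zero)
qed

lemma emeasure_lborel_sections:
  fixes A :: "('a::euclidean_space \<times> 'b::euclidean_space) set"
  assumes "A \<in> sets borel"
  shows "emeasure lborel A = (\<integral>\<^sup>+s. emeasure lborel {u. (u, s) \<in> A} \<partial>lborel)"
    and "{u. (u, s) \<in> A} \<in> sets borel"
proof -
  have A: "A \<in> sets (lborel \<Otimes>\<^sub>M lborel)" using assms unfolding sets_lborel_pair .
  have v: "(\<lambda>x. (x, s)) -` A = {u. (u, s) \<in> A}" for s by auto
  show "emeasure lborel A = (\<integral>\<^sup>+s. emeasure lborel {u. (u, s) \<in> A} \<partial>lborel)"
    using lborel_pair.emeasure_pair_measure_alt2[OF A] unfolding v lborel_prod .
  show "{u. (u, s) \<in> A} \<in> sets borel"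
    using sets_Pair2[OF A, of s] unfolding v by simp
qed

text \<open>For two points of \<open>T\<close>, use one of them and their midpoint \<open>\<xi>\<close> as coordinates.\<close>

lemma emeasure_square_eq_midpoints:
  fixes T :: "'a::euclidean_space set"
  assumes T: "closed T" "convex T"
  shows "emeasure lborel T * emeasure lborel T =
    2 ^ DIM('a) * (\<integral>\<^sup>+\<xi>\<in>T. emeasure lborel {\<zeta>\<in>T. 2 *\<^sub>R \<xi> - \<zeta> \<in> T} \<partial>lborel)"
proof -
  let ?A = "{(\<xi>, \<zeta>). \<zeta> \<in> T \<and> 2 *\<^sub>R \<xi> - \<zeta> \<in> T}"
  have "?A = snd -` T \<inter> (\<lambda>p. 2 *\<^sub>R fst p - snd p) -` T" by auto
  moreover have "closed (snd -` T \<inter> (\<lambda>p::'a\<times>'a. 2 *\<^sub>R fst p - snd p) -` T)"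
    using T(1) by (intro closed_Int continuous_closed_vimage continuous_intros)
  ultimately have clA: "closed ?A" by simp
  \<comment> \<open>A midpoint of two points of \<open>T\<close> lies in \<open>T\<close>, so
    restricting the outer integral to \<open>T\<close> loses nothing.\<close>
  have mem: "\<xi> \<in> T" if "\<zeta> \<in> T" "2 *\<^sub>R \<xi> - \<zeta> \<in> T" for \<xi> \<zeta>
  proof -
    have "(1/2) *\<^sub>R \<zeta> + (1/2) *\<^sub>R (2 *\<^sub>R \<xi> - \<zeta>) \<in> T"
      by (rule convexD[OF T(2)]) (use that in auto)
    then show ?thesis by (simp add: scaleR_diff_right)
  qed
  have "(\<integral>\<^sup>+\<xi>\<in>T. emeasure lborel {\<zeta>\<in>T. 2 *\<^sub>R \<xi> - \<zeta> \<in> T} \<partial>lborel)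
      = (\<integral>\<^sup>+\<xi>. emeasure lborel {\<zeta>\<in>T. 2 *\<^sub>R \<xi> - \<zeta> \<in> T} \<partial>lborel)"
  proof (intro nn_integral_cong)
    fix \<xi>
    show "emeasure lborel {\<zeta>\<in>T. 2 *\<^sub>R \<xi> - \<zeta> \<in> T} * indicator T \<xi>
      = emeasure lborel {\<zeta>\<in>T. 2 *\<^sub>R \<xi> - \<zeta> \<in> T}"
    proof (cases "\<xi> \<in> T")
      case False
      then have "{\<zeta>\<in>T. 2 *\<^sub>R \<xi> - \<zeta> \<in> T} = {}" using mem by blast
      then show ?thesis by (simp only: emeasure_empty mult_zero_left)
    qed simp
  qed
  also have "\<dots> = emeasure (lborel \<Otimes>\<^sub>M lborel) ?A"
  proof -
    have "?A \<in> sets (lborel \<Otimes>\<^sub>M lborel)" using clA unfolding sets_lborel_pair by (rule borel_closed)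
    then show ?thesis
      by (subst lborel.emeasure_pair_measure_alt) (auto intro!: nn_integral_cong arg_cong[where f="emeasure lborel"])
  qed
  also have "\<dots> = (\<integral>\<^sup>+\<zeta>. emeasure lborel {\<xi>. (\<xi>, \<zeta>) \<in> ?A} \<partial>lborel)"
    unfolding lborel_prod using clA by (intro emeasure_lborel_sections borel_closed)
  also have "\<dots> = (\<integral>\<^sup>+\<zeta>. ennreal ((1/2) ^ DIM('a)) * emeasure lborel T * indicator T \<zeta> \<partial>lborel)"
  proof (intro nn_integral_cong)
    fix \<zeta>
    \<comment> \<open>For a fixed endpoint \<zeta> the midpoints form a copy of \<open>T\<close> at
      scale 1/2: this is the source of the factor \<open>2 ^ DIM('a)\<close>.\<close>
    have "{\<xi>. (\<xi>, \<zeta>) \<in> ?A} = (\<lambda>\<omega>. (1/2) *\<^sub>R \<omega> + (1/2) *\<^sub>R \<zeta>) ` T" if "\<zeta> \<in> T"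
    proof (intro set_eqI iffI)
      fix \<xi> assume "\<xi> \<in> {\<xi>. (\<xi>, \<zeta>) \<in> ?A}"
      then show "\<xi> \<in> (\<lambda>\<omega>. (1/2) *\<^sub>R \<omega> + (1/2) *\<^sub>R \<zeta>) ` T"
        by (intro image_eqI[of _ _ "2 *\<^sub>R \<xi> - \<zeta>"]) (auto simp: scaleR_diff_right)
    next
      fix \<xi> assume "\<xi> \<in> (\<lambda>\<omega>. (1/2) *\<^sub>R \<omega> + (1/2) *\<^sub>R \<zeta>) ` T"
      then show "\<xi> \<in> {\<xi>. (\<xi>, \<zeta>) \<in> ?A}"
        using that by (auto simp: scaleR_add_right)
    qed
    then show "emeasure lborel {\<xi>. (\<xi>, \<zeta>) \<in> ?A}
        = ennreal ((1/2) ^ DIM('a)) * emeasure lborel T * indicator T \<zeta>"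
      using emeasure_lborel_affine_image(2)[of "1/2" T "(1/2) *\<^sub>R \<zeta>"] T(1) by (cases "\<zeta> \<in> T") auto
  qed
  also have "\<dots> = ennreal ((1/2) ^ DIM('a)) * emeasure lborel T * emeasure lborel T"
    using T(1) by (subst nn_integral_cmult_indicator) auto
  finally show ?thesis
  proof -
    assume *: "(\<integral>\<^sup>+\<xi>\<in>T. emeasure lborel {\<zeta>\<in>T. 2 *\<^sub>R \<xi> - \<zeta> \<in> T} \<partial>lborel)
      = ennreal ((1/2) ^ DIM('a)) * emeasure lborel T * emeasure lborel T"
    have "2 ^ DIM('a) * ennreal ((1/2) ^ DIM('a)) = ennreal (2 ^ DIM('a) * (1/2) ^ DIM('a))"
      by (simp add: ennreal_mult' flip: ennreal_power)
    also have "\<dots> = 1" by (simp flip: power_mult_distrib)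
    finally show ?thesis unfolding * by (simp flip: mult.assoc)
  qed
qed

locale bounded_convex_domain =
  fixes U :: "'a::euclidean_space set"
  assumes open_U: "open U" and bounded_U: "bounded U" and convex_U: "convex U"
    and zero_in_U: "0 \<in> U"
begin

text \<open>\<open>U\<close> is the affine section at height \<open>1\<close> of an open convex cone in \<open>'a \<times> real\<close>.
  \<open>dual_cone\<close> is the dual of that cone; \<open>dual_cap x\<close> and \<open>cone_cap \<xi>\<close> are the truncations of
  the two cones by a vector of the other one.\<close>

definition dual_cone :: "('a \<times> real) set" where
  "dual_cone = {\<xi>. \<forall>y\<in>U. 0 \<le> (y, 1) \<bullet> \<xi>}"

definition dual_cap :: "'a \<Rightarrow> ('a \<times> real) set" where
  "dual_cap x = {\<xi>\<in>dual_cone. (x, 1) \<bullet> \<xi> \<le> 1}"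

definition cone_cap :: "'a \<times> real \<Rightarrow> ('a \<times> real) set" where
  "cone_cap \<xi> = {v. 0 < snd v \<and> inverse (snd v) *\<^sub>R fst v \<in> U \<and> v \<bullet> \<xi> \<le> 1}"

definition cap :: "'a \<times> real \<Rightarrow> 'a set" where
  "cap \<xi> = {x\<in>U. (x, 1) \<bullet> \<xi> \<le> 1}"

definition dual_volume :: "'a \<Rightarrow> ennreal" where
  "dual_volume x = emeasure lborel (dual_cap x)"

lemma closed_dual_cone: "closed dual_cone" and convex_dual_cone: "convex dual_cone"
proof -
  have "dual_cone = (\<Inter>y\<in>U. {\<xi>. (y, 1) \<bullet> \<xi> \<ge> 0})" by (auto simp: dual_cone_def)
  then show "closed dual_cone" "convex dual_cone"
    by (simp_all add: closed_halfspace_ge closed_INT convex_INT convex_halfspace_ge)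
qed

lemma closed_dual_cap: "closed (dual_cap x)" and convex_dual_cap: "convex (dual_cap x)"
proof -
  have "dual_cap x = dual_cone \<inter> {\<xi>. (x, 1) \<bullet> \<xi> \<le> 1}" by (auto simp: dual_cap_def)
  then show "closed (dual_cap x)" "convex (dual_cap x)"
    by (simp_all add: closed_halfspace_le closed_Int convex_Int convex_halfspace_le
        closed_dual_cone convex_dual_cone)
qed

text \<open>Evaluate \<xi> at the point of the ball where it is smallest, the one opposite to
  \<open>fst \<xi>\<close>; positivity there is the claim.\<close>

lemma dual_cone_norm_le:
  assumes "cball x r \<subseteq> U" "0 < r" "\<xi> \<in> dual_cone"
  shows "r * norm (fst \<xi>) \<le> (x, 1) \<bullet> \<xi>"
proof (cases "fst \<xi> = 0")
  case True
  have "x \<in> U" using assms(1,2) by (auto simp: subset_iff)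
  then show ?thesis using assms(3) True by (auto simp: dual_cone_def)
next
  case False
  let ?y = "x - (r / norm (fst \<xi>)) *\<^sub>R fst \<xi>"
  have "?y \<in> cball x r" using False assms(2) by (simp add: dist_norm)
  then have "?y \<in> U" using assms(1) by blast
  then have "0 \<le> (?y, 1) \<bullet> \<xi>" using assms(3) unfolding dual_cone_def by blast
  also have "(?y, 1) \<bullet> \<xi> = (x, 1) \<bullet> \<xi> - r * norm (fst \<xi>)"
    using False by (simp add: inner_prod_def inner_diff_left power2_norm_eq_inner[symmetric] power2_eq_square)
  finally show ?thesis by simp
qed

lemma dual_cone_snd_nonneg: "\<xi> \<in> dual_cone \<Longrightarrow> 0 \<le> snd \<xi>"
  using zero_in_U by (force simp: dual_cone_def inner_prod_def)

lemma e_in_dual_cap: "(0, 1) \<in> dual_cap x" and zero_in_dual_cap: "0 \<in> dual_cap x"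
  by (auto simp: dual_cap_def dual_cone_def inner_prod_def)

lemma bounded_dual_cap:
  assumes "x \<in> U"
  shows "bounded (dual_cap x)"
proof -
  obtain r where r: "0 < r" "cball x r \<subseteq> U" using open_U assms open_contains_cball by blast
  have "norm \<xi> \<le> 1 / r + (1 + norm x / r)" if "\<xi> \<in> dual_cap x" for \<xi>
  proof -
    have x: "\<xi> \<in> dual_cone" "(x, 1) \<bullet> \<xi> \<le> 1" using that by (auto simp: dual_cap_def)
    have "r * norm (fst \<xi>) \<le> 1" using dual_cone_norm_le[OF r(2,1) x(1)] x(2) by linarith
    then have 1: "norm (fst \<xi>) \<le> 1 / r" using r(1) by (simp add: field_simps)
    have "snd \<xi> \<le> 1 - x \<bullet> fst \<xi>" using x(2) by (simp add: inner_prod_def)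
    also have "\<dots> \<le> 1 + norm x * norm (fst \<xi>)"
      using Cauchy_Schwarz_ineq2[of x "fst \<xi>"] by linarith
    also have "\<dots> \<le> 1 + norm x * (1 / r)" using 1 by (intro add_mono mult_left_mono) auto
    finally have "\<bar>snd \<xi>\<bar> \<le> 1 + norm x / r" using dual_cone_snd_nonneg[OF x(1)] by simp
    then show ?thesis using 1 norm_Pair_le[of "fst \<xi>" "snd \<xi>"] by simp
  qed
  then show ?thesis unfolding bounded_iff by blast
qed

lemma compact_dual_cap: "x \<in> U \<Longrightarrow> compact (dual_cap x)"
  by (simp add: compact_eq_bounded_closed bounded_dual_cap closed_dual_cap)

lemma dual_volume_finite: "x \<in> U \<Longrightarrow> dual_volume x < \<infinity>"
  unfolding dual_volume_def by (rule emeasure_bounded_finite[OF bounded_dual_cap])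

lemma dual_volume_pos:
  assumes "x \<in> U"
  shows "dual_volume x \<noteq> 0"
proof -
  obtain M where M: "0 < M" "\<And>y. y \<in> U \<Longrightarrow> norm y < M"
    using bounded_U bounded_pos_less by blast
  \<comment> \<open>Near-constant functionals: on \<open>U\<close> the linear part is at most 1/4 in
    absolute value, so all values lie between 0 and 3/4.\<close>
  let ?B = "ball 0 (1 / (4 * M)) \<times> {1/4<..<1/2} :: ('a \<times> real) set"
  have "\<xi> \<in> dual_cap x" if "\<xi> \<in> ?B" for \<xi>
  proof -
    have *: "norm (fst \<xi>) * M \<le> 1 / 4" using that M(1) by (auto simp: field_simps)
    have "\<bar>y \<bullet> fst \<xi>\<bar> \<le> 1 / 4" if "y \<in> U" for y
    proof -
      have "\<bar>y \<bullet> fst \<xi>\<bar> \<le> norm y * norm (fst \<xi>)" by (rule Cauchy_Schwarz_ineq2)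
      also have "\<dots> \<le> M * norm (fst \<xi>)" using M(2)[OF that] by (intro mult_right_mono) auto
      finally show ?thesis using * by (simp add: mult.commute)
    qed
    then show ?thesis using assms that
      by (fastforce simp: dual_cap_def dual_cone_def inner_prod_def abs_le_iff)
  qed
  then have "?B \<subseteq> dual_cap x" by blast
  moreover have "open ?B" by (intro open_Times) auto
  moreover have "(0, 3/8) \<in> ?B" using M(1) by simp
  ultimately show ?thesis
    unfolding dual_volume_def using closed_dual_cap[of x] emeasure_mono[of ?B "dual_cap x" lborel]
      emeasure_lborel_open_pos[of ?B] by (auto simp: borel_closed)
qed

lemma borel_cone_cap: "{(\<xi>, v). v \<in> cone_cap \<xi>} \<in> sets borel"
proof -
  let ?f = "\<lambda>p::('a \<times> real) \<times> 'a \<times> real. inverse (snd (snd p)) *\<^sub>R fst (snd p)"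
  have "{(\<xi>, v). v \<in> cone_cap \<xi>} = {p. 0 < snd (snd p)} \<inter> ?f -` U \<inter> {p. snd p \<bullet> fst p \<le> 1}"
    by (auto simp: cone_cap_def)
  moreover have "?f \<in> borel_measurable borel"
    by (intro borel_measurable_scaleR borel_measurable_inverse borel_measurable_continuous_onI
        continuous_intros)
  then have "?f -` U \<in> sets borel"
    using measurable_sets[of ?f borel borel U] borel_open[OF open_U] by simp
  moreover have "open {p::('a \<times> real) \<times> 'a \<times> real. 0 < snd (snd p)}"
    by (intro open_Collect_less continuous_intros)
  moreover have "closed {p::('a \<times> real) \<times> 'a \<times> real. snd p \<bullet> fst p \<le> 1}"
    by (intro closed_Collect_le continuous_intros)
  ultimately show ?thesis by (simp add: sets.Int borel_open borel_closed)
qed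

lemma borel_cone_cap': "cone_cap \<xi> \<in> sets borel"
proof -
  have "{(\<xi>, v). v \<in> cone_cap \<xi>} \<in> sets (lborel \<Otimes>\<^sub>M lborel)"
    using borel_cone_cap unfolding sets_lborel_pair .
  from sets_Pair1[OF this, of \<xi>] show ?thesis by (simp add: vimage_def)
qed

lemma measurable_emeasure_cone_cap:
  "(\<lambda>\<xi>. emeasure lborel (cone_cap \<xi>)) \<in> borel_measurable borel"
proof -
  have "{(\<xi>, v). v \<in> cone_cap \<xi>} \<in> sets (lborel \<Otimes>\<^sub>M lborel)"
    using borel_cone_cap unfolding sets_lborel_pair .
  from lborel.measurable_emeasure_Pair[OF this] show ?thesis by (simp add: vimage_def)
qed

text \<open>Translate the section by \<open>- \<xi>\<close>. A point \<omega> of it and its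
  reflection \<open>2 *\<^sub>R \<xi> - \<omega>\<close> are both nonnegative on the cone, and \<xi>
  is at most 1 on \<open>cone_cap \<xi>\<close>, so \<omega> - \<xi> lies between -1 and 1 there.
  The two sets thus form a polar pair.\<close>

lemma emeasure_midpoint_section_le:
  assumes x: "x \<in> U" and \<xi>: "\<xi> \<in> dual_cap x"
  shows "emeasure lborel {\<zeta>\<in>dual_cap x. 2 *\<^sub>R \<xi> - \<zeta> \<in> dual_cap x} * emeasure lborel (cone_cap \<xi>)
    \<le> 4 ^ (DIM('a) + 1)"
proof -
  let ?T = "dual_cap x"
  let ?E = "{\<zeta>\<in>?T. 2 *\<^sub>R \<xi> - \<zeta> \<in> ?T}"
  have "?E = ?T \<inter> (\<lambda>\<zeta>. 2 *\<^sub>R \<xi> - \<zeta>) -` ?T" by auto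
  moreover have "closed ((\<lambda>\<zeta>. 2 *\<^sub>R \<xi> - \<zeta>) -` ?T)"
    by (intro continuous_closed_vimage closed_dual_cap continuous_intros)
  ultimately have cE: "compact ?E" using compact_dual_cap[OF x] by (simp add: compact_Int_closed)
  let ?D = "(\<lambda>\<zeta>. 1 *\<^sub>R \<zeta> + - \<xi>) ` ?E"
  have cD: "compact ?D" by (intro compact_continuous_image cE continuous_intros)
  have "\<bar>\<zeta> \<bullet> v\<bar> \<le> 1" if "\<zeta> \<in> ?D" "v \<in> cone_cap \<xi>" for \<zeta> v
  proof -
    obtain \<omega> where \<omega>: "\<zeta> = \<omega> - \<xi>" "\<omega> \<in> dual_cone" "2 *\<^sub>R \<xi> - \<omega> \<in> dual_cone"
      using \<open>\<zeta> \<in> ?D\<close> by (auto simp: dual_cap_def)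
    have v: "0 < snd v" "inverse (snd v) *\<^sub>R fst v \<in> U" "v \<bullet> \<xi> \<le> 1"
      using that(2) by (auto simp: cone_cap_def)
    have *: "v = snd v *\<^sub>R (inverse (snd v) *\<^sub>R fst v, 1)"
      using v(1) by (simp add: prod_eq_iff)
    have "0 \<le> v \<bullet> \<eta>" if "\<eta> \<in> dual_cone" for \<eta>
    proof -
      have "0 \<le> (inverse (snd v) *\<^sub>R fst v, 1) \<bullet> \<eta>" using that v(2) by (auto simp: dual_cone_def)
      then have "0 \<le> snd v * ((inverse (snd v) *\<^sub>R fst v, 1) \<bullet> \<eta>)" using v(1) by simp
      then show ?thesis by (subst *) (simp only: inner_scaleR_left)
    qed
    from this[OF \<omega>(2)] this[OF \<omega>(3)] show ?thesis
      using v(3) unfolding \<omega>(1) by (simp add: inner_diff_left inner_diff_right inner_commute abs_le_iff)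
  qed
  then have "emeasure lborel ?D * emeasure lborel (cone_cap \<xi>) \<le> 4 ^ DIM('a \<times> real)"
    by (rule emeasure_polar_pair_le[OF cD borel_cone_cap'])
  moreover have "emeasure lborel ?D = emeasure lborel ?E"
    using emeasure_lborel_affine_image(2)[of 1 ?E "- \<xi>"] cE by (simp add: borel_compact)
  ultimately show ?thesis by simp
qed

lemma borel_cap: "cap \<xi> \<in> sets borel"
proof -
  have "cap \<xi> = U \<inter> {x. (x, 1) \<bullet> \<xi> \<le> 1}" by (auto simp: cap_def)
  also have "\<dots> \<in> sets borel" using borel_open[OF open_U] by measurable
  finally show ?thesis .
qed

text \<open>At each height \<open>s\<close> in [1/2, 1] the truncated cone contains
  \<open>cap \<xi>\<close> scaled by \<open>s\<close>. The factor 2^n comes from the worst scale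
  1/2, one more 2 from the length of the interval.\<close>

lemma emeasure_cap_le: "emeasure lborel (cap \<xi>) \<le> 2 ^ (DIM('a) + 1) * emeasure lborel (cone_cap \<xi>)"
proof -
  let ?N = "DIM('a)"
  have "ennreal ((1/2) ^ ?N) * emeasure lborel (cap \<xi>) * indicator {1/2..1} s
      \<le> emeasure lborel {u. (u, s) \<in> cone_cap \<xi>}" for s :: real
  proof (cases "s \<in> {1/2..1}")
    case True
    have "(*\<^sub>R) s ` cap \<xi> \<subseteq> {u. (u, s) \<in> cone_cap \<xi>}"
    proof clarify
      fix x assume x: "x \<in> cap \<xi>"
      have "(s *\<^sub>R x, s) \<bullet> \<xi> = s * ((x, 1) \<bullet> \<xi>)" by (simp add: inner_prod_def algebra_simps)
      also have "\<dots> \<le> s * 1" using x True by (intro mult_left_mono) (auto simp: cap_def)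
      finally show "(s *\<^sub>R x, s) \<in> cone_cap \<xi>"
        using x True by (auto simp: cone_cap_def cap_def)
    qed
    then have "emeasure lborel ((*\<^sub>R) s ` cap \<xi>) \<le> emeasure lborel {u. (u, s) \<in> cone_cap \<xi>}"
      by (intro emeasure_mono) (use emeasure_lborel_sections(2)[OF borel_cone_cap'] in simp_all)
    moreover have "emeasure lborel ((*\<^sub>R) s ` cap \<xi>) = ennreal (\<bar>s\<bar> ^ ?N) * emeasure lborel (cap \<xi>)"
      using True by (intro emeasure_lborel_scaleR_image borel_cap) auto
    moreover have "ennreal ((1/2) ^ ?N) \<le> ennreal (\<bar>s\<bar> ^ ?N)"
      using True by (intro ennreal_leI power_mono) auto
    ultimately have "ennreal ((1/2) ^ ?N) * emeasure lborel (cap \<xi>) \<le> emeasure lborel {u. (u, s) \<in> cone_cap \<xi>}"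
      by (metis (no_types, lifting) mult_right_mono order_trans zero_le)
    then show ?thesis using True by simp
  qed simp
  then have "(\<integral>\<^sup>+s. ennreal ((1/2) ^ ?N) * emeasure lborel (cap \<xi>) * indicator {1/2..1::real} s \<partial>lborel)
      \<le> emeasure lborel (cone_cap \<xi>)"
    unfolding emeasure_lborel_sections(1)[OF borel_cone_cap'] by (rule nn_integral_mono)
  also have "(\<integral>\<^sup>+s. ennreal ((1/2) ^ ?N) * emeasure lborel (cap \<xi>) * indicator {1/2..1::real} s \<partial>lborel)
      = ennreal ((1/2) ^ ?N) * emeasure lborel (cap \<xi>) * ennreal (1/2)"
    by (subst nn_integral_cmult_indicator) auto
  finally have *: "ennreal ((1/2) ^ ?N) * emeasure lborel (cap \<xi>) * ennreal (1/2) \<le> emeasure lborel (cone_cap \<xi>)" .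
  have "2 ^ (?N + 1) * (ennreal ((1/2) ^ ?N) * ennreal (1/2)) = ennreal (2 ^ (?N+1) * ((1/2) ^ ?N * (1/2)))"
  proof -
    have "(2::ennreal) ^ (?N + 1) = ennreal (2 ^ (?N + 1))"
      by (metis ennreal_numeral ennreal_power zero_le_numeral)
    moreover have "ennreal (2 ^ (?N+1) * ((1/2) ^ ?N * (1/2)))
        = ennreal (2 ^ (?N + 1)) * (ennreal ((1/2) ^ ?N) * ennreal (1/2))"
      by (subst ennreal_mult, simp, simp, subst ennreal_mult) simp_all
    ultimately show ?thesis by (simp only:)
  qed
  also have "2 ^ (?N+1) * ((1/2::real) ^ ?N * (1/2)) = 1"
    using power_mult_distrib[of 2 "1/2::real" ?N] by simp
  finally have "emeasure lborel (cap \<xi>) = 2 ^ (?N + 1) * (ennreal ((1/2) ^ ?N) * emeasure lborel (cap \<xi>) * ennreal (1/2))"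
    by (metis (no_types, lifting) ennreal_1 mult.assoc mult.commute mult_1)
  also have "\<dots> \<le> 2 ^ (?N + 1) * emeasure lborel (cone_cap \<xi>)"
    by (intro mult_left_mono *) auto
  finally show ?thesis .
qed

end

text \<open>Only an inequality, because in \<open>ennreal\<close> the product is 0 when
  \<open>b\<close> is 0 or infinite.\<close>

lemma ennreal_mult_inverse_le_one: "inverse b * b \<le> (1::ennreal)"
  and ennreal_mult_inverse_eq_one: "b \<noteq> 0 \<Longrightarrow> b \<noteq> \<infinity> \<Longrightarrow> b * inverse b = (1::ennreal)"
proof -
  have *: "b * inverse b = 1" if "b \<noteq> 0" "b \<noteq> \<infinity>"
  proof -
    from that obtain r where "b = ennreal r" "0 < r" by (cases b) (auto simp: less_le)
    then show ?thesis by (simp add: inverse_ennreal flip: ennreal_mult)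
  qed
  then show "b \<noteq> 0 \<Longrightarrow> b \<noteq> \<infinity> \<Longrightarrow> b * inverse b = 1" .
  show "inverse b * b \<le> 1"
    using * by (cases "b = 0 \<or> b = \<infinity>") (auto simp: mult.commute)
qed

text \<open>The degenerate divisors are harmless: for \<open>b\<close> = 0 the right side is
  infinite since \<open>c\<close> is nonzero, and an infinite \<open>b\<close> forces
  \<open>a\<close> = 0 since \<open>c\<close> is finite.\<close>

lemma ennreal_le_mult_inverse:
  fixes a b c :: ennreal
  assumes "a * b \<le> c" "c \<noteq> 0" "c < \<infinity>"
  shows "a \<le> c * inverse b"
proof (cases "b = 0 \<or> b = \<infinity>")
  case True
  moreover have "a = 0" if "b = \<infinity>"
    using assms(1,3) that by (auto simp: ennreal_mult_top top_unique split: if_splits)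
  ultimately show ?thesis using assms(2) by (auto simp: ennreal_mult_top)
next
  case False
  then have "b * inverse b = 1"
    by (simp add: ennreal_mult_inverse_eq_one)
  then have "a = a * b * inverse b" by (simp add: mult.assoc)
  also have "\<dots> \<le> c * inverse b" by (intro mult_right_mono assms) auto
  finally show ?thesis .
qed

section \<open>Boundary layers of the domain and of its dual cone\<close>

context bounded_convex_domain
begin

text \<open>A boundary layer measured by homothety from the origin instead of distance, so that its
  volume is explicit.\<close>

definition shell :: "real \<Rightarrow> 'a set" where
  "shell \<epsilon> = (if \<epsilon> < 1 then U - (*\<^sub>R) (1 - \<epsilon>) ` U else U)"

lemma borel_shell: "shell \<epsilon> \<in> sets borel"
  using open_U emeasure_lborel_scaleR_image(1)[of "1 - \<epsilon>" U] by (auto simp: shell_def)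

text \<open>Bernoulli's inequality for the contracted copy; for \<epsilon> at least 1 the bound
  exceeds the volume of \<open>U\<close>.\<close>

lemma emeasure_shell_le:
  fixes \<epsilon> :: real
  assumes "0 < \<epsilon>"
  shows "emeasure lborel (shell \<epsilon>) \<le> ennreal (DIM('a) * \<epsilon> * measure lborel U)"
proof -
  let ?n = "DIM('a)"
  have fin: "emeasure lborel U < \<infinity>" by (rule emeasure_bounded_finite[OF bounded_U])
  then have U: "emeasure lborel U = ennreal (measure lborel U)"
    by (simp add: emeasure_eq_ennreal_measure)
  show ?thesis
  proof (cases "\<epsilon> < 1")
    case True
    let ?A = "(*\<^sub>R) (1 - \<epsilon>) ` U"
    have A: "?A \<in> sets borel" "emeasure lborel ?A = ennreal ((1 - \<epsilon>) ^ ?n * measure lborel U)"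
      using emeasure_lborel_scaleR_image[of "1 - \<epsilon>" U] True open_U U by (auto simp: ennreal_mult')
    have "?A \<subseteq> U"
    proof clarify
      fix x assume "x \<in> U"
      then have "(1 - \<epsilon>) *\<^sub>R x + \<epsilon> *\<^sub>R 0 \<in> U"
        using True assms by (intro convexD[OF convex_U] zero_in_U) auto
      then show "(1 - \<epsilon>) *\<^sub>R x \<in> U" by simp
    qed
    then have "emeasure lborel (shell \<epsilon>) = emeasure lborel U - emeasure lborel ?A"
      unfolding shell_def using True A fin open_U by (simp add: emeasure_Diff borel_open)
    also have "\<dots> = ennreal (measure lborel U - (1 - \<epsilon>) ^ ?n * measure lborel U)"
      unfolding U A(2) using True by (simp add: ennreal_minus)
    also have "\<dots> \<le> ennreal (?n * \<epsilon> * measure lborel U)"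
    proof (rule ennreal_leI)
      have "1 - ?n * \<epsilon> \<le> (1 - \<epsilon>) ^ ?n" using Bernoulli_inequality[of "- \<epsilon>" ?n] True by simp
      then have "(1 - ?n * \<epsilon>) * measure lborel U \<le> (1 - \<epsilon>) ^ ?n * measure lborel U"
        by (intro mult_right_mono) auto
      then show "measure lborel U - (1 - \<epsilon>) ^ ?n * measure lborel U \<le> ?n * \<epsilon> * measure lborel U"
        by (simp add: algebra_simps)
    qed
    finally show ?thesis .
  next
    case False
    have "1 \<le> ?n * \<epsilon>" using False mult_mono[of 1 "real ?n" 1 \<epsilon>] by (simp add: Suc_leI)
    then have "1 * measure lborel U \<le> ?n * \<epsilon> * measure lborel U" by (intro mult_right_mono) auto
    then show ?thesis using False by (auto simp: shell_def U intro!: ennreal_leI)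
  qed
qed

text \<open>The size of a dual vector is \<open>snd \<xi>\<close>, its value at the origin of
  \<open>U\<close>. Slabs are therefore homothetic, with volume of degree n + 1 in
  \<open>s\<close>.\<close>

definition dual_slab :: "real \<Rightarrow> ('a \<times> real) set" where
  "dual_slab s = {\<xi>\<in>dual_cone. snd \<xi> \<le> s}"

lemma closed_dual_slab: "closed (dual_slab s)"
proof -
  have "dual_slab s = dual_cone \<inter> {\<xi>. snd \<xi> \<le> s}" by (auto simp: dual_slab_def)
  then show ?thesis by (simp add: closed_Int closed_dual_cone closed_Collect_le continuous_intros)
qed

lemma dual_slab_finite: "emeasure lborel (dual_slab s) < \<infinity>"
proof -
  obtain r where r: "0 < r" "cball 0 r \<subseteq> U" using open_U zero_in_U open_contains_cball by blast
  have "norm \<xi> \<le> s / r + s" if "\<xi> \<in> dual_slab s" for \<xi>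
  proof -
    have x: "\<xi> \<in> dual_cone" "snd \<xi> \<le> s" using that by (auto simp: dual_slab_def)
    have "r * norm (fst \<xi>) \<le> s" using dual_cone_norm_le[OF r(2,1) x(1)] x(2) by (simp add: inner_prod_def)
    then have "norm (fst \<xi>) \<le> s / r" using r(1) by (simp add: field_simps)
    then show ?thesis using norm_Pair_le[of "fst \<xi>" "snd \<xi>"] x(2) dual_cone_snd_nonneg[OF x(1)] by simp
  qed
  then have "bounded (dual_slab s)" unfolding bounded_iff by blast
  then show ?thesis by (rule emeasure_bounded_finite)
qed

lemma emeasure_dual_slab:
  fixes s :: real
  assumes "0 < s"
  shows "emeasure lborel (dual_slab s) = ennreal (s ^ (DIM('a) + 1) * measure lborel (dual_slab 1))"
proof -
  have "dual_slab s = (*\<^sub>R) s ` dual_slab 1"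
  proof (intro set_eqI iffI)
    fix \<xi> assume "\<xi> \<in> dual_slab s"
    then show "\<xi> \<in> (*\<^sub>R) s ` dual_slab 1"
      using assms by (intro image_eqI[of _ _ "inverse s *\<^sub>R \<xi>"]) (auto simp: dual_slab_def dual_cone_def field_simps)
  next
    fix \<xi> assume "\<xi> \<in> (*\<^sub>R) s ` dual_slab 1"
    then obtain \<eta> where \<eta>: "\<xi> = s *\<^sub>R \<eta>" "\<eta> \<in> dual_cone" "snd \<eta> \<le> 1" by (auto simp: dual_slab_def)
    have "0 \<le> (y, 1) \<bullet> \<xi>" if "y \<in> U" for y
      using \<eta>(2) that assms unfolding \<eta>(1) inner_scaleR_right dual_cone_def by auto
    moreover have "snd \<xi> \<le> s" using \<eta> assms by simp
    ultimately show "\<xi> \<in> dual_slab s" by (auto simp: dual_slab_def dual_cone_def)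
  qed
  then have "emeasure lborel (dual_slab s) = ennreal (\<bar>s\<bar> ^ DIM('a \<times> real)) * emeasure lborel (dual_slab 1)"
    using emeasure_lborel_scaleR_image(2)[of s "dual_slab 1"] assms closed_dual_slab by (simp add: borel_closed)
  also have "emeasure lborel (dual_slab 1) = ennreal (measure lborel (dual_slab 1))"
    using dual_slab_finite[of 1] by (intro emeasure_eq_ennreal_measure) auto
  finally show ?thesis using assms by (simp add: ennreal_mult')
qed

text \<open>Lowering \<xi> by the constant functional 2 takes it out of the dual cone as soon as its
  value at some point of \<open>U\<close> is at most 1. All \<xi> of size at most \<open>s\<close>
  with nonempty \<open>cap \<xi>\<close> are thus in this layer, whose width does not grow with
  \<open>s\<close>.\<close>

definition dual_shell :: "real \<Rightarrow> ('a \<times> real) set" where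
  "dual_shell s = (if 2 < s then dual_slab s - (\<lambda>\<xi>. 1 *\<^sub>R \<xi> + (0, 2)) ` dual_slab (s - 2) else dual_slab s)"

lemma borel_dual_shell: "dual_shell s \<in> sets borel"
  using emeasure_lborel_affine_image(1)[of 1 "dual_slab (s - 2)" "(0, 2)"] closed_dual_slab
  by (auto simp: dual_shell_def borel_closed)

lemma dual_shellI:
  assumes "\<xi> \<in> dual_cone" "snd \<xi> \<le> s" "x \<in> U" "(x, 1) \<bullet> \<xi> \<le> 1"
  shows "\<xi> \<in> dual_shell s"
proof -
  have "\<eta> \<notin> dual_cone" if "\<xi> = \<eta> + (0, 2)" for \<eta>
  proof
    assume "\<eta> \<in> dual_cone"
    then have "0 \<le> (x, 1) \<bullet> \<eta>" using assms(3) by (auto simp: dual_cone_def)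
    then show False using assms(4) unfolding that by (simp add: inner_prod_def inner_add_right)
  qed
  then show ?thesis using assms(1,2) by (auto simp: dual_shell_def dual_slab_def)
qed

text \<open>The difference of the volumes of two slabs of heights \<open>s\<close> and
  \<open>s - 2\<close>, of degree n + 1, loses one degree by Bernoulli's inequality.\<close>

lemma emeasure_dual_shell_le:
  fixes s :: real
  assumes "1 \<le> s"
  shows "emeasure lborel (dual_shell s)
    \<le> ennreal (2 * (DIM('a) + 1) * measure lborel (dual_slab 1) * s ^ DIM('a))"
proof -
  let ?n = "DIM('a)" and ?k = "measure lborel (dual_slab 1)"
  show ?thesis
  proof (cases "2 < s")
    case True
    let ?A = "(\<lambda>\<xi>. 1 *\<^sub>R \<xi> + (0, 2)) ` dual_slab (s - 2)"
    have A: "?A \<in> sets borel" "emeasure lborel ?A = ennreal ((s - 2) ^ (?n + 1) * ?k)"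
      using emeasure_lborel_affine_image[of 1 "dual_slab (s - 2)" "(0, 2)"] closed_dual_slab
        emeasure_dual_slab[of "s - 2"] True by (auto simp: borel_closed)
    have "?A \<subseteq> dual_slab s"
      by (force simp: dual_slab_def dual_cone_def inner_prod_def)
    then have "emeasure lborel (dual_shell s) = emeasure lborel (dual_slab s) - emeasure lborel ?A"
      unfolding dual_shell_def using True A closed_dual_slab[of s]
      by (simp add: emeasure_Diff borel_closed)
    also have "\<dots> = ennreal (s ^ (?n + 1) * ?k - (s - 2) ^ (?n + 1) * ?k)"
      unfolding A(2) using True emeasure_dual_slab[of s] by (simp add: ennreal_minus)
    also have "\<dots> \<le> ennreal (2 * (?n + 1) * ?k * s ^ ?n)"
    proof (rule ennreal_leI)
      have "1 - (?n + 1) * (2 / s) \<le> (1 - 2 / s) ^ (?n + 1)"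
        using Bernoulli_inequality[of "- (2 / s)" "?n + 1"] True by simp
      then have "s ^ (?n + 1) * (1 - (?n + 1) * (2 / s)) \<le> s ^ (?n + 1) * (1 - 2 / s) ^ (?n + 1)"
        using True by (intro mult_left_mono) auto
      also have "\<dots> = (s - 2) ^ (?n + 1)"
        using True by (simp only: power_mult_distrib[symmetric]) (simp add: right_diff_distrib)
      also have "s ^ (?n + 1) * (1 - (?n + 1) * (2 / s)) = s ^ (?n + 1) - 2 * (?n + 1) * s ^ ?n"
        using True by (simp add: field_simps)
      finally have "(s ^ (?n + 1) - (s - 2) ^ (?n + 1)) * ?k \<le> 2 * (?n + 1) * s ^ ?n * ?k"
        by (intro mult_right_mono) auto
      then show "s ^ (?n + 1) * ?k - (s - 2) ^ (?n + 1) * ?k \<le> 2 * (?n + 1) * ?k * s ^ ?n"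
        by (simp add: algebra_simps)
    qed
    finally show ?thesis .
  next
    case False
    have "s * s ^ ?n * ?k \<le> (2 * (?n + 1)) * s ^ ?n * ?k"
      using False assms by (intro mult_right_mono) auto
    then have "s ^ (?n + 1) * ?k \<le> 2 * (?n + 1) * ?k * s ^ ?n" by (simp add: ac_simps)
    then have "ennreal (s ^ (?n + 1) * ?k) \<le> ennreal (2 * (?n + 1) * ?k * s ^ ?n)" by (rule ennreal_leI)
    then show ?thesis using False assms emeasure_dual_slab[of s]
      by (simp only: dual_shell_def if_False)
  qed
qed

lemma scaled_closure_subset:
  assumes "0 < \<delta>" "\<delta> \<le> 1"
  shows "(*\<^sub>R) (1 - \<delta>) ` closure U \<subseteq> U"
proof clarify
  fix z assume "z \<in> closure U"
  then have "z - \<delta> *\<^sub>R (z - 0) \<in> interior U"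
    using assms open_U zero_in_U by (intro mem_interior_closure_convex_shrink convex_U) (auto simp: interior_open)
  then show "(1 - \<delta>) *\<^sub>R z \<in> U"
    using interior_subset by (auto simp: scaleR_diff_left)
qed

text \<open>The value of \<xi> at the contracted point is a convex combination of its values at
  \<open>z\<close>, which is nonnegative by closure, and at the origin, which is
  \<open>snd \<xi>\<close> with weight \<delta>.\<close>

lemma dual_cap_snd_le:
  assumes "z \<in> closure U" "0 < \<delta>" "\<delta> \<le> 1" "\<xi> \<in> dual_cap ((1 - \<delta>) *\<^sub>R z)"
  shows "\<delta> * snd \<xi> \<le> 1"
proof -
  have "U \<subseteq> {y. 0 \<le> y \<bullet> fst \<xi> + snd \<xi>}"
    using assms(4) by (auto simp: dual_cap_def dual_cone_def inner_prod_def)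
  moreover have "closed {y. 0 \<le> y \<bullet> fst \<xi> + snd \<xi>}"
    by (intro closed_Collect_le continuous_intros)
  ultimately have "0 \<le> z \<bullet> fst \<xi> + snd \<xi>" using assms(1) closure_minimal by blast
  then have "0 \<le> (1 - \<delta>) * (z \<bullet> fst \<xi> + snd \<xi>)" using assms(3) by simp
  moreover have "((1 - \<delta>) *\<^sub>R z) \<bullet> fst \<xi> + snd \<xi> \<le> 1"
    using assms(4) by (simp add: dual_cap_def inner_prod_def)
  ultimately show ?thesis by (simp add: algebra_simps)
qed

text \<open>The integral over part of \<open>dual_cap x\<close> of the polarity bound for the
  midpoint sections. The indicator lives on pairs \<open>(x, \<xi>)\<close> so that Fubini applies
  to \<open>x\<close> and \<xi> jointly.\<close>

definition dual_weight :: "real \<Rightarrow> 'a \<Rightarrow> ennreal" where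
  "dual_weight s x = (\<integral>\<^sup>+\<xi>. inverse (emeasure lborel (cone_cap \<xi>)) *
     indicator {(x, \<xi>). x \<in> U \<and> \<xi> \<in> dual_cap x \<and> snd \<xi> \<le> s} (x, \<xi>) \<partial>lborel)"

lemma borel_dual_incidence: "{(x, \<xi>). x \<in> U \<and> \<xi> \<in> dual_cap x \<and> snd \<xi> \<le> s} \<in> sets borel"
proof -
  have "{(x, \<xi>). x \<in> U \<and> \<xi> \<in> dual_cap x \<and> snd \<xi> \<le> s}
      = (U \<times> UNIV) \<inter> (snd -` dual_cone \<inter> {p. (fst p, 1) \<bullet> snd p \<le> 1} \<inter> {p. snd (snd p) \<le> s})"
    by (auto simp: dual_cap_def)
  moreover have "open (U \<times> (UNIV :: ('a \<times> real) set))" by (intro open_Times open_U open_UNIV)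
  moreover have "closed (snd -` dual_cone \<inter> {p::'a \<times> 'a \<times> real. (fst p, 1) \<bullet> snd p \<le> 1} \<inter> {p. snd (snd p) \<le> s})"
    by (intro closed_Int continuous_closed_vimage closed_dual_cone closed_Collect_le continuous_intros)
  ultimately show ?thesis by (simp only: sets.Int borel_open borel_closed)
qed

lemma measurable_dual_weight_integrand:
  "(\<lambda>(x, \<xi>). inverse (emeasure lborel (cone_cap \<xi>)) *
     indicator {(x, \<xi>). x \<in> U \<and> \<xi> \<in> dual_cap x \<and> snd \<xi> \<le> s} (x, \<xi>))
   \<in> borel_measurable (lborel \<Otimes>\<^sub>M lborel)"
proof -
  have "(\<lambda>p. emeasure lborel (cone_cap (snd p))) \<in> borel_measurable (lborel \<Otimes>\<^sub>M lborel)"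
    using measurable_compose[OF measurable_snd, of "\<lambda>\<xi>. emeasure lborel (cone_cap \<xi>)" lborel borel lborel]
      measurable_emeasure_cone_cap by simp
  moreover have "{(x, \<xi>). x \<in> U \<and> \<xi> \<in> dual_cap x \<and> snd \<xi> \<le> s} \<in> sets (lborel \<Otimes>\<^sub>M lborel)"
    using borel_dual_incidence unfolding sets_lborel_pair .
  ultimately have "(\<lambda>p. inverse (emeasure lborel (cone_cap (snd p))) *
     indicator {(x, \<xi>). x \<in> U \<and> \<xi> \<in> dual_cap x \<and> snd \<xi> \<le> s} p)
   \<in> borel_measurable (lborel \<Otimes>\<^sub>M lborel)"
    by (intro borel_measurable_times_ennreal borel_measurable_inverse_ennreal borel_measurable_indicator)
  then show ?thesis by (simp add: case_prod_beta')
qed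

lemma measurable_dual_weight: "dual_weight s \<in> borel_measurable borel"
  using lborel.borel_measurable_nn_integral[OF measurable_dual_weight_integrand, of s]
  by (simp add: dual_weight_def[abs_def])

text \<open>For fixed \<xi> the admissible \<open>x\<close> fill at most \<open>cap \<xi>\<close>,
  whose volume is bounded by that of \<open>cone_cap \<xi>\<close> and so cancels the weight. Only
  \<xi> in \<open>dual_shell s\<close> admit such an \<open>x\<close>.\<close>

lemma nn_integral_dual_weight_le:
  "(\<integral>\<^sup>+x. dual_weight s x \<partial>lborel) \<le> 2 ^ (DIM('a) + 1) * emeasure lborel (dual_shell s)"
proof -
  let ?I = "{(x, \<xi>). x \<in> U \<and> \<xi> \<in> dual_cap x \<and> snd \<xi> \<le> s}"
  have "(\<integral>\<^sup>+x. dual_weight s x \<partial>lborel)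
      = (\<integral>\<^sup>+\<xi>. \<integral>\<^sup>+x. inverse (emeasure lborel (cone_cap \<xi>)) * indicator ?I (x, \<xi>) \<partial>lborel \<partial>lborel)"
    unfolding dual_weight_def
    by (rule lborel_pair.Fubini'[OF measurable_dual_weight_integrand, symmetric])
  also have "\<dots> \<le> (\<integral>\<^sup>+\<xi>. 2 ^ (DIM('a) + 1) * indicator (dual_shell s) \<xi> \<partial>lborel)"
  proof (rule nn_integral_mono)
    fix \<xi>
    have "(\<integral>\<^sup>+x. inverse (emeasure lborel (cone_cap \<xi>)) * indicator ?I (x, \<xi>) \<partial>lborel)
       \<le> (\<integral>\<^sup>+x. inverse (emeasure lborel (cone_cap \<xi>)) * indicator (dual_shell s) \<xi> * indicator (cap \<xi>) x \<partial>lborel)"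
      by (intro nn_integral_mono) (auto simp: indicator_def cap_def dual_cap_def intro: dual_shellI)
    also have "\<dots> = inverse (emeasure lborel (cone_cap \<xi>)) * indicator (dual_shell s) \<xi> * emeasure lborel (cap \<xi>)"
      using borel_cap by (subst nn_integral_cmult_indicator) auto
    also have "\<dots> \<le> inverse (emeasure lborel (cone_cap \<xi>)) * indicator (dual_shell s) \<xi>
        * (2 ^ (DIM('a) + 1) * emeasure lborel (cone_cap \<xi>))"
      by (intro mult_left_mono emeasure_cap_le) auto
    also have "\<dots> = (inverse (emeasure lborel (cone_cap \<xi>)) * emeasure lborel (cone_cap \<xi>))
        * (2 ^ (DIM('a) + 1) * indicator (dual_shell s) \<xi>)"
      by (simp add: ac_simps)
    also have "\<dots> \<le> 1 * (2 ^ (DIM('a) + 1) * indicator (dual_shell s) \<xi>)"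
      by (intro mult_right_mono ennreal_mult_inverse_le_one) auto
    finally show "(\<integral>\<^sup>+x. inverse (emeasure lborel (cone_cap \<xi>)) * indicator ?I (x, \<xi>) \<partial>lborel)
       \<le> 2 ^ (DIM('a) + 1) * indicator (dual_shell s) \<xi>" by simp
  qed
  also have "\<dots> = 2 ^ (DIM('a) + 1) * emeasure lborel (dual_shell s)"
    using borel_dual_shell by (subst nn_integral_cmult_indicator) auto
  finally show ?thesis .
qed

end

section \<open>Summation of the duality estimate over dyadic scales\<close>

context bounded_convex_domain
begin

text \<open>At scale \<open>4 ^ k\<close> either \<open>dual_volume x\<close> is at most \<open>2 ^ (k * N)\<close>, where \<open>N = DIM('a) + 1\<close>, or it
  is larger and then the duality estimate forces most of the truncated cones \<open>cone_cap \<xi>\<close> to be small.\<close>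

lemma dual_volume_le_sum:
  fixes \<delta> :: real
  assumes \<delta>: "0 < \<delta>" "\<delta> \<le> 1" "1 \<le> \<delta> * 4 ^ M" and x: "x \<in> (*\<^sub>R) (1 - \<delta>) ` closure U"
  shows "dual_volume x \<le> 2 ^ (DIM('a) + 1) * (\<Sum>k\<le>M.
     ennreal (2 ^ (k * (DIM('a) + 1))) * indicator (shell (4 / 4 ^ k)) x
     + 4 ^ (DIM('a) + 1) * ennreal (1 / 2 ^ (k * (DIM('a) + 1))) * dual_weight (4 ^ k) x)"
proof -
  let ?N = "DIM('a) + 1" and ?T = "dual_cap x" and ?\<rho> = "dual_volume x"
  define m where "m \<xi> = emeasure lborel {\<zeta>\<in>?T. 2 *\<^sub>R \<xi> - \<zeta> \<in> ?T}" for \<xi>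
  define P where "P k = {\<xi>\<in>?T. snd \<xi> \<le> 4 ^ k \<and> (k = 0 \<or> 4 ^ (k - 1) < snd \<xi>)}" for k :: nat
  define c where "c k = ennreal (2 ^ (k * ?N))" for k :: nat
  let ?a = "\<lambda>k. c k * indicator (shell (4 / 4 ^ k)) x
     + 4 ^ ?N * ennreal (1 / 2 ^ (k * ?N)) * dual_weight (4 ^ k) x"
  obtain z where z: "z \<in> closure U" "x = (1 - \<delta>) *\<^sub>R z" using x by blast
  have xU: "x \<in> U" using scaled_closure_subset[OF \<delta>(1,2)] x by blast
  have T: "closed ?T" "convex ?T" by (rule closed_dual_cap convex_dual_cap)+
  have mle: "m \<xi> \<le> ?\<rho>" for \<xi>
    unfolding m_def dual_volume_def using T(1) by (intro emeasure_mono) auto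
  have mle': "m \<xi> \<le> 4 ^ ?N * inverse (emeasure lborel (cone_cap \<xi>))" if "\<xi> \<in> ?T" for \<xi>
    unfolding m_def
  proof (rule ennreal_le_mult_inverse)
    show "(4::ennreal) ^ ?N < \<infinity>"
      by (metis ennreal_numeral ennreal_power ennreal_less_top infinity_ennreal_def zero_le_numeral)
  qed (use emeasure_midpoint_section_le[OF xU that] in auto)
  have borelP: "P k \<in> sets borel" for k
  proof -
    have "P k = ?T \<inter> ({\<xi>. snd \<xi> \<le> 4 ^ k} \<inter> (if k = 0 then UNIV else {\<xi>. 4 ^ (k - 1) < snd \<xi>}))"
      by (auto simp: P_def)
    also have "\<dots> \<in> sets borel"
    proof (intro sets.Int)
      show "?T \<in> sets borel" using T(1) by (rule borel_closed)
      show "{\<xi>::'a \<times> real. snd \<xi> \<le> 4 ^ k} \<in> sets borel"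
        by (intro borel_closed closed_Collect_le continuous_intros)
      have "open {\<xi>::'a \<times> real. 4 ^ (k - 1) < snd \<xi>}"
        by (intro open_Collect_less continuous_intros)
      then show "(if k = 0 then UNIV else {\<xi>::'a \<times> real. 4 ^ (k - 1) < snd \<xi>}) \<in> sets borel"
        by (auto intro: borel_open)
    qed
    finally show ?thesis .
  qed
  \<comment> \<open>Both cases split off a factor \<open>?\<rho>\<close>, to be cancelled against
    the square at the end.\<close>
  have piece: "(\<integral>\<^sup>+\<xi>\<in>P k. m \<xi> \<partial>lborel) \<le> ?\<rho> * ?a k" for k
  proof (cases "?\<rho> \<le> c k")
    case True
    show ?thesis
    proof (cases "P k = {}")
      case False
      then obtain \<xi> where \<xi>: "\<xi> \<in> ?T" "snd \<xi> \<le> 4 ^ k" "k = 0 \<or> 4 ^ (k - 1) < snd \<xi>" by (auto simp: P_def)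
      \<comment> \<open>If \<open>x\<close> were a point of \<open>U\<close> contracted by 1 - 4 /
        4^k, its value under \<xi> would be at least (4 / 4^k) times \<open>snd \<xi>\<close>, hence
        above 1. The numerator 4 compensates for the lower size bound \<open>4 ^ (k - 1)\<close>;
        for \<open>k\<close> = 0 the layer is all of \<open>U\<close>.\<close>
      have sh: "x \<in> shell (4 / 4 ^ k)"
      proof (cases "4 / 4 ^ k < (1::real)")
        case True
        then have k: "k \<noteq> 0" by (intro notI) simp
        have "False" if "y \<in> U" "x = (1 - 4 / 4 ^ k) *\<^sub>R y" for y
        proof -
          have "0 \<le> (y, 1) \<bullet> \<xi>" using \<xi>(1) that by (auto simp: dual_cap_def dual_cone_def)
          then have "0 \<le> (1 - 4 / 4 ^ k) * ((y, 1) \<bullet> \<xi>)" using True by simp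
          moreover have "(x, 1) \<bullet> \<xi> = (1 - 4 / 4 ^ k) * ((y, 1) \<bullet> \<xi>) + (4 / 4 ^ k) * snd \<xi>"
            unfolding that(2) by (simp add: inner_prod_def algebra_simps add_divide_distrib)
          moreover have "1 < (4 / 4 ^ k) * snd \<xi>"
          proof -
            have "(4::real) ^ k = 4 * 4 ^ (k - 1)" using k by (cases k) auto
            then show ?thesis using \<xi>(3) k by (simp add: field_simps)
          qed
          moreover have "(x, 1) \<bullet> \<xi> \<le> 1" using \<xi>(1) by (simp add: dual_cap_def)
          ultimately show False by linarith
        qed
        then show ?thesis using xU by (auto simp: shell_def)
      qed (use xU in \<open>simp add: shell_def\<close>)
      have "(\<integral>\<^sup>+\<xi>\<in>P k. m \<xi> \<partial>lborel) \<le> (\<integral>\<^sup>+\<xi>\<in>?T. ?\<rho> \<partial>lborel)"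
        using mle by (intro nn_integral_mono) (auto simp: indicator_def P_def)
      also have "\<dots> = ?\<rho> * ?\<rho>"
        unfolding dual_volume_def using T(1) by (subst nn_integral_cmult_indicator) auto
      also have "\<dots> \<le> ?\<rho> * ?a k"
        using True sh by (intro mult_left_mono) (auto intro: order_trans)
      finally show ?thesis .
    qed simp
  next
    case False
    have "(\<integral>\<^sup>+\<xi>\<in>P k. m \<xi> \<partial>lborel) \<le> (\<integral>\<^sup>+\<xi>. 4 ^ ?N * (inverse (emeasure lborel (cone_cap \<xi>)) *
        indicator {(x, \<xi>). x \<in> U \<and> \<xi> \<in> dual_cap x \<and> snd \<xi> \<le> 4 ^ k} (x, \<xi>)) \<partial>lborel)"
      using mle' xU by (intro nn_integral_mono) (auto simp: indicator_def P_def)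
    also have "\<dots> = 4 ^ ?N * dual_weight (4 ^ k) x"
      unfolding dual_weight_def
      using measurable_Pair2[OF measurable_dual_weight_integrand, of x "4 ^ k"]
      by (intro nn_integral_cmult) simp
    \<comment> \<open>Inserting \<open>c k\<close> times its inverse makes room to enlarge
      \<open>c k\<close> to \<open>?\<rho>\<close>, which is larger in this case.\<close>
    also have "\<dots> = c k * (4 ^ ?N * ennreal (1 / 2 ^ (k * ?N)) * dual_weight (4 ^ k) x)"
    proof -
      have "c k * (b * e * w) = c k * e * (b * w)" for b e w :: ennreal
        by (simp only: ac_simps)
      moreover have "c k * ennreal (1 / 2 ^ (k * ?N)) = 1"
        unfolding c_def by (subst ennreal_mult[symmetric]) auto
      ultimately show ?thesis by simp
    qed
    also have "\<dots> \<le> ?\<rho> * ?a k"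
      using False by (intro mult_mono) auto
    finally show ?thesis .
  qed
  have square: "?\<rho> * ?\<rho> = 2 ^ ?N * (\<integral>\<^sup>+\<xi>\<in>?T. m \<xi> \<partial>lborel)"
    using emeasure_square_eq_midpoints[OF T] unfolding dual_volume_def m_def by simp
  have "(\<integral>\<^sup>+\<xi>\<in>?T. m \<xi> \<partial>lborel) \<le> (\<integral>\<^sup>+\<xi>. (\<Sum>k\<le>M. m \<xi> * indicator (P k) \<xi>) \<partial>lborel)"
  proof (rule nn_integral_mono)
    fix \<xi>
    show "m \<xi> * indicator ?T \<xi> \<le> (\<Sum>k\<le>M. m \<xi> * indicator (P k) \<xi>)"
    proof (cases "\<xi> \<in> ?T")
      case True
      \<comment> \<open>Sizes are at most 1/\<delta>, hence at most 4^M: the scales up to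
        \<open>M\<close> exhaust \<open>dual_cap x\<close>.\<close>
      have "\<delta> * snd \<xi> \<le> 1" using dual_cap_snd_le[OF z(1) \<delta>(1,2)] True z(2) by simp
      then have "\<delta> * snd \<xi> \<le> \<delta> * 4 ^ M" using \<delta>(3) by linarith
      then have M: "snd \<xi> \<le> 4 ^ M" using \<delta>(1) by simp
      define k where "k = (LEAST k. snd \<xi> \<le> 4 ^ k)"
      have k: "snd \<xi> \<le> 4 ^ k" "k \<le> M" unfolding k_def using M by (auto intro: LeastI Least_le)
      have "k = 0 \<or> 4 ^ (k - 1) < snd \<xi>"
      proof (rule ccontr)
        assume *: "\<not> ?thesis"
        then have "k - 1 < k" "snd \<xi> \<le> 4 ^ (k - 1)" by auto
        then show False unfolding k_def by (metis not_less_Least)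
      qed
      then have "\<xi> \<in> P k" using True k(1) by (auto simp: P_def)
      then have "m \<xi> * indicator ?T \<xi> = m \<xi> * indicator (P k) \<xi>" using True by simp
      also have "\<dots> \<le> (\<Sum>k\<le>M. m \<xi> * indicator (P k) \<xi>)"
        using k(2) by (intro member_le_sum) auto
      finally show ?thesis .
    qed simp
  qed
  also have "\<dots> = (\<Sum>k\<le>M. \<integral>\<^sup>+\<xi>\<in>P k. m \<xi> \<partial>lborel)"
  proof (rule nn_integral_sum)
    have "{(\<xi>, \<zeta>). \<zeta> \<in> ?T \<and> 2 *\<^sub>R \<xi> - \<zeta> \<in> ?T} = snd -` ?T \<inter> (\<lambda>p. 2 *\<^sub>R fst p - snd p) -` ?T" by auto
    moreover have "closed (snd -` ?T \<inter> (\<lambda>p::('a \<times> real) \<times> ('a \<times> real). 2 *\<^sub>R fst p - snd p) -` ?T)"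
      using T(1) by (intro closed_Int continuous_closed_vimage continuous_intros)
    ultimately have "{(\<xi>, \<zeta>). \<zeta> \<in> ?T \<and> 2 *\<^sub>R \<xi> - \<zeta> \<in> ?T} \<in> sets (lborel \<Otimes>\<^sub>M lborel)"
      unfolding sets_lborel_pair by (simp add: borel_closed)
    from lborel.measurable_emeasure_Pair[OF this]
    have "m \<in> borel_measurable lborel" by (simp add: m_def[abs_def] vimage_def)
    then show "(\<lambda>\<xi>. m \<xi> * indicator (P k) \<xi>) \<in> borel_measurable lborel" for k
      using borelP by simp
  qed
  also have "\<dots> \<le> (\<Sum>k\<le>M. ?\<rho> * ?a k)" by (intro sum_mono piece)
  also have "\<dots> = ?\<rho> * (\<Sum>k\<le>M. ?a k)" by (simp add: sum_distrib_left)
  finally have "?\<rho> * ?\<rho> \<le> 2 ^ ?N * (?\<rho> * (\<Sum>k\<le>M. ?a k))"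
    unfolding square by (rule mult_left_mono) simp
  also have "\<dots> = ?\<rho> * (2 ^ ?N * (\<Sum>k\<le>M. ?a k))" by (simp only: ac_simps)
  finally have "?\<rho> * ?\<rho> \<le> ?\<rho> * (2 ^ ?N * (\<Sum>k\<le>M. ?a k))" .
  then have "?\<rho> \<le> 2 ^ ?N * (\<Sum>k\<le>M. ?a k)"
    using dual_volume_pos[OF xU] dual_volume_finite[OF xU]
    by (subst (asm) ennreal_mult_le_mult_iff) auto
  then show ?thesis unfolding c_def .
qed

text \<open>The balance of the two regimes at \<open>s\<close> = 4^k: threshold times layer width,
  and dual layer volume divided by threshold, both of order s^((n - 1)/2).\<close>

lemma power_scale_identities:
  assumes "n \<ge> 1"
  shows "(2::real) ^ (k * (n + 1)) * (4 / 4 ^ k) = 4 * 2 ^ (k * (n - 1))"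
    and "1 / 2 ^ (k * (n + 1)) * (4 ^ k) ^ n = (2::real) ^ (k * (n - 1))"
proof -
  obtain j where n: "n = Suc j" using assms by (cases n) auto
  have 4: "(4::real) ^ k = 2 ^ (k * 2)" by (subst mult.commute) (simp add: power_mult)
  show "(2::real) ^ (k * (n + 1)) * (4 / 4 ^ k) = 4 * 2 ^ (k * (n - 1))"
    unfolding 4 n by (simp add: power_add[symmetric] field_simps flip: power_add)
  have "(4 ^ k) ^ n = (2::real) ^ (k * (n + 1)) * 2 ^ (k * (n - 1))"
    unfolding 4 n by (simp flip: power_mult power_add add: algebra_simps)
  then show "1 / 2 ^ (k * (n + 1)) * (4 ^ k) ^ n = (2::real) ^ (k * (n - 1))" by simp
qed

text \<open>Every scale is bounded by the last one. The resulting factor M + 1 is only linear in the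
  radius; for n = 1 all scales do contribute equally to the bound.\<close>

lemma nn_integral_dual_volume_le:
  obtains C :: real where "0 \<le> C"
    "\<And>M \<delta>. 0 < \<delta> \<Longrightarrow> \<delta> \<le> 1 \<Longrightarrow> 1 \<le> \<delta> * 4 ^ M \<Longrightarrow>
      (\<integral>\<^sup>+x\<in>(*\<^sub>R) (1 - \<delta>) ` closure U. dual_volume x \<partial>lborel)
        \<le> ennreal (C * (real M + 1) * 2 ^ (M * (DIM('a) - 1)))"
proof -
  let ?n = "DIM('a)" and ?N = "DIM('a) + 1"
  define u where "u = measure lborel U"
  define \<kappa> where "\<kappa> = measure lborel (dual_slab 1)"
  define D where "D = 4 * ?n * u + 4 ^ ?N * 2 ^ ?N * (2 * ?N * \<kappa>)"
  have nonneg: "0 \<le> u" "0 \<le> \<kappa>" "0 \<le> D" by (auto simp: u_def \<kappa>_def D_def)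
  have n1: "?n \<ge> 1" by (simp add: Suc_leI)
  have "(\<integral>\<^sup>+x\<in>(*\<^sub>R) (1 - \<delta>) ` closure U. dual_volume x \<partial>lborel)
      \<le> ennreal (2 ^ ?N * D * (real M + 1) * 2 ^ (M * (?n - 1)))"
    if \<delta>: "0 < \<delta>" "\<delta> \<le> 1" "1 \<le> \<delta> * 4 ^ M" for M \<delta>
  proof -
    let ?a = "\<lambda>k x. ennreal (2 ^ (k * ?N)) * indicator (shell (4 / 4 ^ k)) x
     + 4 ^ ?N * ennreal (1 / 2 ^ (k * ?N)) * dual_weight (4 ^ k) x"
    have summand: "(\<integral>\<^sup>+x. ?a k x \<partial>lborel) \<le> ennreal (D * 2 ^ (k * (?n - 1)))" for k
    proof -
      have "(\<integral>\<^sup>+x. ?a k x \<partial>lborel) = ennreal (2 ^ (k * ?N)) * emeasure lborel (shell (4 / 4 ^ k))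
          + 4 ^ ?N * ennreal (1 / 2 ^ (k * ?N)) * (\<integral>\<^sup>+x. dual_weight (4 ^ k) x \<partial>lborel)"
        using borel_shell measurable_dual_weight
        by (subst nn_integral_add) (auto simp: nn_integral_cmult nn_integral_cmult_indicator)
      also have "\<dots> \<le> ennreal (2 ^ (k * ?N)) * ennreal (?n * (4 / 4 ^ k) * u)
          + 4 ^ ?N * ennreal (1 / 2 ^ (k * ?N)) * (2 ^ ?N * ennreal (2 * ?N * \<kappa> * (4 ^ k) ^ ?n))"
        unfolding u_def \<kappa>_def
        by (intro add_mono mult_left_mono emeasure_shell_le
            order_trans[OF nn_integral_dual_weight_le] emeasure_dual_shell_le) auto
      also have "\<dots> = ennreal (2 ^ (k * ?N)) * ennreal (?n * (4 / 4 ^ k) * u)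
          + ennreal (4 ^ ?N) * ennreal (1 / 2 ^ (k * ?N)) * (ennreal (2 ^ ?N) * ennreal (2 * ?N * \<kappa> * (4 ^ k) ^ ?n))"
        by (metis ennreal_numeral ennreal_power zero_le_numeral)
      also have "\<dots> = ennreal (2 ^ (k * ?N) * (?n * (4 / 4 ^ k) * u)
          + 4 ^ ?N * (1 / 2 ^ (k * ?N)) * (2 ^ ?N * (2 * ?N * \<kappa> * (4 ^ k) ^ ?n)))"
      proof -
        have "ennreal a * ennreal b + ennreal c * ennreal d * (ennreal e * ennreal f)
            = ennreal (a * b + c * d * (e * f))"
          if "0 \<le> a" "0 \<le> b" "0 \<le> c" "0 \<le> d" "0 \<le> e" "0 \<le> f" for a b c d e f
          using that by (simp add: ennreal_mult)
        from this show ?thesis by this (use nonneg in auto)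
      qed
      also have "2 ^ (k * ?N) * (?n * (4 / 4 ^ k) * u)
          + 4 ^ ?N * (1 / 2 ^ (k * ?N)) * (2 ^ ?N * (2 * ?N * \<kappa> * (4 ^ k) ^ ?n))
        = ?n * u * (2 ^ (k * ?N) * (4 / 4 ^ k))
          + 4 ^ ?N * 2 ^ ?N * (2 * ?N * \<kappa>) * (1 / 2 ^ (k * ?N) * (4 ^ k) ^ ?n)"
        by (simp only: ac_simps)
      also have "\<dots> = D * 2 ^ (k * (?n - 1))"
        unfolding power_scale_identities[OF n1] D_def by (simp add: algebra_simps)
      finally show ?thesis .
    qed
    have "(\<integral>\<^sup>+x\<in>(*\<^sub>R) (1 - \<delta>) ` closure U. dual_volume x \<partial>lborel)
        \<le> (\<integral>\<^sup>+x. 2 ^ ?N * (\<Sum>k\<le>M. ?a k x) \<partial>lborel)"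
      using dual_volume_le_sum[OF \<delta>] by (intro nn_integral_mono) (auto simp: indicator_def)
    also have "\<dots> = 2 ^ ?N * (\<Sum>k\<le>M. \<integral>\<^sup>+x. ?a k x \<partial>lborel)"
      using borel_shell measurable_dual_weight
      by (subst nn_integral_cmult, simp, subst nn_integral_sum) auto
    also have "\<dots> \<le> 2 ^ ?N * (\<Sum>k\<le>M. ennreal (D * 2 ^ (k * (?n - 1))))"
      by (intro mult_left_mono sum_mono summand) auto
    also have "\<dots> = ennreal (2 ^ ?N * (\<Sum>k\<le>M. D * 2 ^ (k * (?n - 1))))"
    proof -
      have "2 ^ ?N = ennreal (2 ^ ?N)" by (metis ennreal_numeral ennreal_power zero_le_numeral)
      moreover have "(\<Sum>k\<le>M. ennreal (D * 2 ^ (k * (?n - 1)))) = ennreal (\<Sum>k\<le>M. D * 2 ^ (k * (?n - 1)))"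
        using nonneg by (intro sum_ennreal) auto
      ultimately show ?thesis using nonneg by (simp only:) (rule ennreal_mult[symmetric], auto intro!: sum_nonneg)
    qed
    also have "\<dots> \<le> ennreal (2 ^ ?N * D * (real M + 1) * 2 ^ (M * (?n - 1)))"
    proof (rule ennreal_leI)
      have "(\<Sum>k\<le>M. D * 2 ^ (k * (?n - 1))) \<le> (\<Sum>k\<le>M. D * 2 ^ (M * (?n - 1)))"
        using nonneg by (intro sum_mono mult_left_mono power_increasing) auto
      also have "\<dots> = D * (real M + 1) * 2 ^ (M * (?n - 1))" by simp
      finally show "2 ^ ?N * (\<Sum>k\<le>M. D * 2 ^ (k * (?n - 1))) \<le> 2 ^ ?N * D * (real M + 1) * 2 ^ (M * (?n - 1))"
        by (simp only: mult.assoc mult_le_cancel_left_pos zero_less_power zero_less_numeral)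
    qed
    finally show ?thesis .
  qed
  then show ?thesis using that[of "2 ^ ?N * D"] nonneg by simp
qed

section \<open>The slice at height 0 of the polar of \<open>dual_cap x\<close>\<close>

definition polar_section :: "'a \<Rightarrow> 'a set" where
  "polar_section x = {u. \<forall>\<xi>\<in>dual_cap x. \<bar>fst \<xi> \<bullet> u\<bar> \<le> 1}"

lemma closed_polar_section: "closed (polar_section x)"
proof -
  have "polar_section x = {u. \<forall>\<eta>\<in>fst ` dual_cap x. \<bar>\<eta> \<bullet> u\<bar> \<le> 1}" by (auto simp: polar_section_def)
  then show ?thesis by (simp only: closed_polar)
qed

text \<open>Since (0, 1) lies in \<open>dual_cap x\<close>, its polar \<open>?Z\<close> lives at
  heights in [-1, 1]. Half the difference of two points at one height lies in the slice at height 0,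
  so each slice fits into a translate of twice that one. The volume of \<open>?Z\<close> is then
  controlled by the slice, and the lower bound for polar pairs applies.\<close>

lemma dual_volume_mult_polar_section_ge:
  assumes "x \<in> U"
  shows "ennreal ((2 / real (DIM('a) + 1) ^ 2) ^ (DIM('a) + 1))
    \<le> 2 ^ (DIM('a) + 1) * dual_volume x * emeasure lborel (polar_section x)"
proof -
  let ?T = "dual_cap x" and ?n = "DIM('a)"
  let ?Z = "{y. \<forall>\<xi>\<in>?T. \<bar>\<xi> \<bullet> y\<bar> \<le> 1}"
  have "?Z \<in> sets borel" by (simp add: closed_polar borel_closed)
  note sec = emeasure_lborel_sections[OF this]
  have "emeasure lborel {u. (u, s) \<in> ?Z} \<le> 2 ^ ?n * emeasure lborel (polar_section x) * indicator {-1..1} s" for s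
  proof (cases "{u. (u, s) \<in> ?Z} = {}")
    case False
    then obtain u0 where u0: "(u0, s) \<in> ?Z" by blast
    then have "\<bar>s\<bar> \<le> 1" using e_in_dual_cap[of x] by (force simp: inner_prod_def)
    then have s: "s \<in> {-1..1}" by (auto simp: abs_le_iff)
    have "{u. (u, s) \<in> ?Z} \<subseteq> (\<lambda>w. 2 *\<^sub>R w + u0) ` polar_section x"
    proof clarify
      fix u assume u: "\<forall>\<xi>\<in>?T. \<bar>\<xi> \<bullet> (u, s)\<bar> \<le> 1"
      have "\<bar>fst \<xi> \<bullet> ((1/2) *\<^sub>R (u - u0))\<bar> \<le> 1" if "\<xi> \<in> ?T" for \<xi>
      proof -
        have "fst \<xi> \<bullet> ((1/2) *\<^sub>R (u - u0)) = (\<xi> \<bullet> (u, s) - \<xi> \<bullet> (u0, s)) / 2"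
          by (simp add: inner_prod_def inner_diff_right)
        moreover have "\<bar>\<xi> \<bullet> (u, s)\<bar> \<le> 1" "\<bar>\<xi> \<bullet> (u0, s)\<bar> \<le> 1" using u u0 that by auto
        moreover have "\<bar>(a - b) / 2\<bar> \<le> 1" if "\<bar>a\<bar> \<le> 1" "\<bar>b\<bar> \<le> 1" for a b :: real
          using that abs_triangle_ineq4[of a b] by (simp add: abs_divide)
        ultimately show ?thesis by (simp only:)
      qed
      then show "u \<in> (\<lambda>w. 2 *\<^sub>R w + u0) ` polar_section x"
        by (intro image_eqI[of _ _ "(1/2) *\<^sub>R (u - u0)"]) (auto simp: polar_section_def)
    qed
    then have "emeasure lborel {u. (u, s) \<in> ?Z} \<le> emeasure lborel ((\<lambda>w. 2 *\<^sub>R w + u0) ` polar_section x)"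
      using emeasure_lborel_affine_image(1)[of 2 "polar_section x" u0] closed_polar_section
      by (intro emeasure_mono) (auto simp: borel_closed)
    also have "\<dots> = ennreal (2 ^ ?n) * emeasure lborel (polar_section x)"
      using emeasure_lborel_affine_image(2)[of 2 "polar_section x" u0] closed_polar_section
      by (simp add: borel_closed)
    also have "ennreal (2 ^ ?n) = 2 ^ ?n" by (metis ennreal_numeral ennreal_power zero_le_numeral)
    finally show ?thesis using s by simp
  qed (simp only: emeasure_empty zero_le)
  then have "emeasure lborel ?Z \<le> (\<integral>\<^sup>+s. 2 ^ ?n * emeasure lborel (polar_section x) * indicator {-1..1::real} s \<partial>lborel)"
    unfolding sec(1) by (rule nn_integral_mono)
  also have "\<dots> = 2 ^ ?n * emeasure lborel (polar_section x) * 2"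
    by (subst nn_integral_cmult_indicator) auto
  finally have Z: "emeasure lborel ?Z \<le> 2 ^ (?n + 1) * emeasure lborel (polar_section x)"
    by (simp add: ac_simps)
  have "ennreal ((2 / real DIM('a \<times> real) ^ 2) ^ DIM('a \<times> real)) \<le> emeasure lborel ?T * emeasure lborel ?Z"
    using assms dual_volume_pos[OF assms] zero_in_dual_cap convex_dual_cap compact_dual_cap
    by (intro emeasure_polar_pair_ge) (auto simp: dual_volume_def)
  also have "\<dots> \<le> emeasure lborel ?T * (2 ^ (?n + 1) * emeasure lborel (polar_section x))"
    by (intro mult_left_mono Z) auto
  finally show ?thesis by (simp add: dual_volume_def ac_simps)
qed

end

section \<open>Affine charts of proper convex domains\<close>

lemma proj_point_eq_iff:
  assumes "v \<noteq> 0" "w \<noteq> 0"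
  shows "proj_point v = proj_point w \<longleftrightarrow> (\<exists>c. w = c *\<^sub>R v)"
proof -
  have "proportional v v" "proportional w w"
    using assms unfolding proportional_def by (metis scaleR_one)+
  then have "proportional v w \<longleftrightarrow> proj_point v = proj_point w"
    using Quotient_rel[OF Quotient_proj] by blast
  then show ?thesis using assms unfolding proportional_def by blast
qed

lemma proj_point_cases:
  obtains v where "v \<noteq> 0" "P = proj_point v"
proof -
  have "proportional (rep_proj P) (rep_proj P)" "proj_point (rep_proj P) = P"
    using Quotient_rep_reflp[OF Quotient_proj] Quotient_abs_rep[OF Quotient_proj] by blast+
  then show ?thesis using that unfolding proportional_def by metis
qed

lemma proj_point_scaleR: "c \<noteq> 0 \<Longrightarrow> v \<noteq> 0 \<Longrightarrow> proj_point (c *\<^sub>R v) = proj_point v"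
  by (metis proj_point_eq_iff scaleR_eq_0_iff)

lemma proj_line_span2:
  assumes "v \<noteq> 0" "\<And>c. w \<noteq> c *\<^sub>R v"
  shows "proj_line (proj_point ` (span {v, w} - {0}))"
    and "\<And>x. x \<in> span {v, w} \<longleftrightarrow> (\<exists>\<alpha> \<beta>. x = \<alpha> *\<^sub>R v + \<beta> *\<^sub>R w)"
    and "independent {v, w}" and "v \<noteq> w"
proof -
  show "v \<noteq> w" using assms(2)[of 1] by auto
  have "w \<notin> span {v}" using assms(2) by (auto simp: span_singleton)
  then have "independent {w, v}"
    using assms(1) by (simp add: independent_insert)
  then show ind: "independent {v, w}" by (simp add: insert_commute)
  then have "dim {v, w} = 2" using \<open>v \<noteq> w\<close> by (simp add: dim_eq_card_independent)
  then show "proj_line (proj_point ` (span {v, w} - {0}))"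
    unfolding proj_line_def by (intro exI[of _ "span {v, w}"]) auto
  show "x \<in> span {v, w} \<longleftrightarrow> (\<exists>\<alpha> \<beta>. x = \<alpha> *\<^sub>R v + \<beta> *\<^sub>R w)" for x
    by (force simp: span_insert span_singleton algebra_simps)
qed

section \<open>Lifting the domain to one half of its double cone\<close>

definition cone_over :: "'a::euclidean_space proj set \<Rightarrow> 'a set" where
  "cone_over \<Omega> = {v. v \<noteq> 0 \<and> proj_point v \<in> \<Omega>}"

lemma cone_over_scaleR_iff: "c \<noteq> 0 \<Longrightarrow> c *\<^sub>R v \<in> cone_over \<Omega> \<longleftrightarrow> v \<in> cone_over \<Omega>"
  unfolding cone_over_def by (cases "v = 0") (auto simp: proj_point_scaleR)

lemma cone_over_uminus_iff: "- v \<in> cone_over \<Omega> \<longleftrightarrow> v \<in> cone_over \<Omega>"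
  using cone_over_scaleR_iff[of "-1" v] by simp

lemma open_cone_over_iff: "open (cone_over \<Omega>) \<longleftrightarrow> open \<Omega>"
  unfolding cone_over_def open_proj_def ..

text \<open>If both segments left the cone, the two points where they do would separate the trace
  of the domain on the projective line through \<open>[v]\<close> and \<open>[w]\<close>.\<close>

lemma segment_or_opposite_in_cone:
  fixes v w :: "'a::euclidean_space"
  assumes conv: "proj_convex \<Omega>"
    and vw: "v \<in> cone_over \<Omega>" "w \<in> cone_over \<Omega>" "\<And>c. w \<noteq> c *\<^sub>R v"
  shows "closed_segment v w \<subseteq> cone_over \<Omega> \<or> closed_segment v (- w) \<subseteq> cone_over \<Omega>"
proof (rule ccontr)
  assume "\<not> ?thesis"
  then obtain s t where
    s: "0 \<le> s" "s \<le> 1" "(1 - s) *\<^sub>R v + s *\<^sub>R w \<notin> cone_over \<Omega>" and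
    t: "0 \<le> t" "t \<le> 1" "(1 - t) *\<^sub>R v + t *\<^sub>R (- w) \<notin> cone_over \<Omega>"
    by (auto simp: closed_segment_def)
  have "s \<noteq> 0" "s \<noteq> 1" "t \<noteq> 0" "t \<noteq> 1"
    using s t vw cone_over_uminus_iff[of w] by (auto intro!: notI)
  then have st: "0 < s" "s < 1" "0 < t" "t < 1" using s t by auto
  have v0: "v \<noteq> 0" using vw(1) by (simp add: cone_over_def)
  note sp = proj_line_span2[OF v0 vw(3)]
  let ?l = "proj_point ` (span {v, w} - {0})"
  obtain a :: "'a \<Rightarrow> real" where a: "linear a" "a v = 1" "a w = 0"
    using linear_independent_extend[OF sp(3), of "\<lambda>x. if x = v then 1 else 0"] sp(4) by auto
  obtain b :: "'a \<Rightarrow> real" where b: "linear b" "b v = 0" "b w = 1"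
    using linear_independent_extend[OF sp(3), of "\<lambda>x. if x = v then 0 else 1"] sp(4) by auto
  \<comment> \<open>A product of two linear forms on the plane, vanishing exactly along the two
    directions that miss the cone. Being homogeneous of even degree, its sign is well defined on
    projective points; it is positive at \<open>v\<close> and negative at \<open>w\<close>.\<close>
  define q where "q x = (a x * s - b x * (1 - s)) * (a x * t + b x * (1 - t))" for x
  have q2: "q (c *\<^sub>R x) = c\<^sup>2 * q x" for c x
    using a(1) b(1) by (simp add: q_def linear_cmul power2_eq_square algebra_simps)
  have "continuous_on UNIV a" "continuous_on UNIV b"
    using a(1) b(1) linear_continuous_on linear_conv_bounded_linear by auto
  then have cq: "continuous_on UNIV q"
    unfolding q_def by (intro continuous_intros)
  have open_pos: "open {P. \<exists>x. x \<noteq> 0 \<and> P = proj_point x \<and> 0 < \<sigma> * q x}" for \<sigma> :: real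
  proof -
    have "{v. v \<noteq> 0 \<and> proj_point v \<in> {P. \<exists>x. x \<noteq> 0 \<and> P = proj_point x \<and> 0 < \<sigma> * q x}}
        = - {0} \<inter> {x. 0 < \<sigma> * q x}"
    proof -
      have "0 < \<sigma> * q y" if xy: "y \<noteq> 0" "x \<noteq> 0" "proj_point y = proj_point x" "0 < \<sigma> * q x" for x y
      proof -
        obtain c where c: "y = c *\<^sub>R x" using proj_point_eq_iff[of x y] xy(1-3) by auto
        then have "c \<noteq> 0" using xy(1) by auto
        then have "0 < c\<^sup>2 * (\<sigma> * q x)" using xy(4) by simp
        then show ?thesis by (simp add: c q2 ac_simps)
      qed
      then show ?thesis by auto
    qed
    moreover have "open {x. 0 < \<sigma> * q x}"
      by (intro open_Collect_less continuous_on_mult cq continuous_on_const)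
    ultimately show ?thesis unfolding open_proj_def by auto
  qed
  let ?P = "{P. \<exists>x. x \<noteq> 0 \<and> P = proj_point x \<and> 0 < 1 * q x}"
  let ?N = "{P. \<exists>x. x \<noteq> 0 \<and> P = proj_point x \<and> 0 < -1 * q x}"
  have disj: "?P \<inter> ?N = {}"
  proof -
    have False if xy: "x \<noteq> 0" "y \<noteq> 0" "proj_point x = proj_point y" "0 < q x" "q y < 0" for x y
    proof -
      obtain c where c: "y = c *\<^sub>R x" using proj_point_eq_iff[of x y] xy by auto
      then have "0 \<le> q y" using xy(4) by (simp add: q2)
      then show False using xy(5) by simp
    qed
    then show ?thesis by auto
  qed
  have cover: "\<Omega> \<inter> ?l \<subseteq> ?P \<union> ?N"
  proof
    fix Q assume Q: "Q \<in> \<Omega> \<inter> ?l"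
    then obtain x where x: "x \<in> span {v, w}" "x \<noteq> 0" "Q = proj_point x" by blast
    then obtain \<alpha> \<beta> where \<alpha>\<beta>: "x = \<alpha> *\<^sub>R v + \<beta> *\<^sub>R w" using sp(2) by blast
    have ab: "a x = \<alpha>" "b x = \<beta>" using a b by (simp_all add: \<alpha>\<beta> linear_add linear_cmul)
    have xC: "x \<in> cone_over \<Omega>" using Q x by (simp add: cone_over_def)
    have "q x \<noteq> 0"
    proof
      assume "q x = 0"
      then consider "\<alpha> * s = \<beta> * (1 - s)" | "\<alpha> * t = - \<beta> * (1 - t)"
        by (auto simp: q_def ab)
      then show False
      proof cases
        case 1
        have "x = (\<beta> / s) *\<^sub>R ((1 - s) *\<^sub>R v + s *\<^sub>R w)"
        proof -
          have "\<alpha> = \<beta> / s * (1 - s)" using 1 st by (simp add: field_simps)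
          then show ?thesis unfolding \<alpha>\<beta> using st by (simp add: scaleR_add_right)
        qed
        then show False using s(3) xC x(2) cone_over_scaleR_iff by (metis scaleR_zero_left)
      next
        case 2
        have "x = (- \<beta> / t) *\<^sub>R ((1 - t) *\<^sub>R v + t *\<^sub>R (- w))"
        proof -
          have "\<alpha> = - \<beta> / t * (1 - t)" using 2 st by (simp add: field_simps)
          then show ?thesis unfolding \<alpha>\<beta> using st by (simp add: scaleR_diff_right)
        qed
        then show False using t(3) xC x(2) cone_over_scaleR_iff by (metis scaleR_zero_left)
      qed
    qed
    then show "Q \<in> ?P \<union> ?N" using x by (cases "0 < q x") auto
  qed
  have "connected (\<Omega> \<inter> ?l)" using conv sp(1) unfolding proj_convex_def by blast
  then have "?P \<inter> (\<Omega> \<inter> ?l) = {} \<or> ?N \<inter> (\<Omega> \<inter> ?l) = {}"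
    using connectedD[of "\<Omega> \<inter> ?l" ?P ?N] open_pos[of 1] open_pos[of "-1"] disj cover by blast
  moreover have "proj_point v \<in> ?P \<inter> (\<Omega> \<inter> ?l)"
  proof -
    have "0 < q v" using st by (simp add: q_def a b)
    then show ?thesis using vw(1) v0 by (auto simp: cone_over_def span_base)
  qed
  moreover have "proj_point w \<in> ?N \<inter> (\<Omega> \<inter> ?l)"
  proof -
    have "0 < (1 - s) * (1 - t)" using st by simp
    then have "0 < - q w" by (simp add: q_def a b algebra_simps)
    then show ?thesis using vw(2) by (auto simp: cone_over_def span_base)
  qed
  ultimately show False by blast
qed

text \<open>The two segments sweep out two adjacent quadrants of the plane; with the antipodes every
  nonzero vector of the plane is covered, so a whole projective line would lie in the
  domain.\<close>

lemma not_segment_and_opposite_in_cone: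
  fixes v w :: "'a::euclidean_space"
  assumes "proj_proper \<Omega>" and v: "v \<in> cone_over \<Omega>" and w: "\<And>c. w \<noteq> c *\<^sub>R v"
    and seg: "closed_segment v w \<subseteq> cone_over \<Omega>" "closed_segment v (- w) \<subseteq> cone_over \<Omega>"
  shows False
proof -
  have v0: "v \<noteq> 0" using v by (simp add: cone_over_def)
  note sp = proj_line_span2[OF v0 w]
  have "x \<in> cone_over \<Omega>" if x_in: "x \<in> span {v, w}" "x \<noteq> 0" for x
  proof -
    obtain \<alpha> \<beta> where x: "x = \<alpha> *\<^sub>R v + \<beta> *\<^sub>R w" using sp(2) x_in(1) by blast
    have key: "\<alpha> *\<^sub>R v + \<beta> *\<^sub>R u \<in> cone_over \<Omega>"
      if u: "0 \<le> \<alpha>" "0 \<le> \<beta>" "0 < \<alpha> + \<beta>" "closed_segment v u \<subseteq> cone_over \<Omega>" for \<alpha> \<beta> u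
    proof -
      let ?y = "(1 - \<beta> / (\<alpha> + \<beta>)) *\<^sub>R v + (\<beta> / (\<alpha> + \<beta>)) *\<^sub>R u"
      have "0 \<le> \<beta> / (\<alpha> + \<beta>)" "\<beta> / (\<alpha> + \<beta>) \<le> 1" using u by auto
      then have "?y \<in> cone_over \<Omega>" using u(4) unfolding closed_segment_def by blast
      then have "(\<alpha> + \<beta>) *\<^sub>R ?y \<in> cone_over \<Omega>" using u(3) cone_over_scaleR_iff by (metis less_irrefl)
      moreover have "(\<alpha> + \<beta>) * (1 - \<beta> / (\<alpha> + \<beta>)) = \<alpha>" using u(3) by (simp add: field_simps)
      ultimately show ?thesis using u(3) by (simp add: scaleR_add_right)
    qed
    have nz: "\<alpha> \<noteq> 0 \<or> \<beta> \<noteq> 0" using x x_in(2) by auto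
    consider "0 \<le> \<alpha>" "0 \<le> \<beta>" | "0 \<le> \<alpha>" "\<beta> \<le> 0" | "\<alpha> \<le> 0" "0 \<le> \<beta>" | "\<alpha> \<le> 0" "\<beta> \<le> 0"
      by linarith
    then show ?thesis
    proof cases
      case 1
      then show ?thesis unfolding x using key[of \<alpha> \<beta> w] seg nz by auto
    next
      case 2
      then show ?thesis unfolding x using key[of \<alpha> "- \<beta>" "- w"] seg nz by auto
    next
      case 3
      then have "- x \<in> cone_over \<Omega>" unfolding x using key[of "- \<alpha>" \<beta> "- w"] seg nz by auto
      then show ?thesis by (simp add: cone_over_uminus_iff)
    next
      case 4
      then have "- x \<in> cone_over \<Omega>" unfolding x using key[of "- \<alpha>" "- \<beta>" w] seg nz by auto
      then show ?thesis by (simp add: cone_over_uminus_iff)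
    qed
  qed
  then have "proj_point ` (span {v, w} - {0}) \<subseteq> \<Omega>" by (auto simp: cone_over_def)
  then show False using assms(1) sp(1) closure_subset unfolding proj_proper_def by blast
qed

text \<open>One half of the double cone is selected as the set of vectors joined to a fixed
  \<open>v0\<close> by a segment inside it. Projective convexity puts \<open>v\<close> or
  \<open>- v\<close> into it, and properness excludes both.\<close>

lemma proper_convex_domain_lift:
  fixes \<Omega> :: "'a::euclidean_space proj set"
  assumes dom: "proper_convex_domain \<Omega>"
  obtains \<Gamma> :: "'a set" where "open \<Gamma>" "convex \<Gamma>" "\<Gamma> \<noteq> {}" "\<And>v t. v \<in> \<Gamma> \<Longrightarrow> 0 < t \<Longrightarrow> t *\<^sub>R v \<in> \<Gamma>"
    "\<And>v. v \<in> cone_over \<Omega> \<longleftrightarrow> v \<in> \<Gamma> \<or> - v \<in> \<Gamma>" "\<And>v. v \<in> \<Gamma> \<Longrightarrow> - v \<notin> \<Gamma>"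
proof -
  have conv: "proj_convex \<Omega>" and proper: "proj_proper \<Omega>" and op: "open (cone_over \<Omega>)" and ne: "\<Omega> \<noteq> {}"
    using dom unfolding proper_convex_domain_def open_cone_over_iff by auto
  let ?C = "cone_over \<Omega>"
  obtain v0 where v0: "v0 \<in> ?C" 
    using ne proj_point_cases unfolding cone_over_def by (metis (mono_tags, lifting) equals0I mem_Collect_eq)
  have z: "0 \<notin> ?C" by (simp add: cone_over_def)
  define \<Gamma> where "\<Gamma> = {v. closed_segment v0 v \<subseteq> ?C}"
  have \<Gamma>C: "v \<in> ?C" if "v \<in> \<Gamma>" for v using that unfolding \<Gamma>_def by auto
  have scale: "t *\<^sub>R v \<in> \<Gamma>" if "v \<in> \<Gamma>" "0 < t" for v t
  proof -
    have "(1 - s) *\<^sub>R v0 + s *\<^sub>R (t *\<^sub>R v) \<in> ?C" if s: "0 \<le> s" "s \<le> 1" for s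
    proof -
      \<comment> \<open>Up to the positive factor \<open>c\<close>, the point on the segment to the
        scaled vector is a point on the segment to \<open>v\<close>.\<close>
      define c where "c = 1 - s + s * t"
      have c: "0 < c" using s \<open>0 < t\<close> by (cases "s = 1") (auto simp: c_def add_pos_nonneg)
      have "0 \<le> s * t / c" "s * t / c \<le> 1" using s \<open>0 < t\<close> c by (auto simp: c_def field_simps)
      then have "(1 - s * t / c) *\<^sub>R v0 + (s * t / c) *\<^sub>R v \<in> ?C"
        using \<open>v \<in> \<Gamma>\<close> unfolding \<Gamma>_def closed_segment_def by blast
      then have "c *\<^sub>R ((1 - s * t / c) *\<^sub>R v0 + (s * t / c) *\<^sub>R v) \<in> ?C"
        using c cone_over_scaleR_iff by (metis less_irrefl)
      moreover have "c * (1 - s * t / c) = 1 - s" using c by (simp add: field_simps c_def)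
      ultimately show ?thesis using c by (simp add: scaleR_add_right)
    qed
    then show ?thesis unfolding \<Gamma>_def closed_segment_def by blast
  qed
  have v0\<Gamma>: "v0 \<in> \<Gamma>" using v0 by (simp add: \<Gamma>_def)
  have either: "v \<in> \<Gamma> \<or> - v \<in> \<Gamma>" if v: "v \<in> ?C" for v
  proof (cases "\<exists>c. v = c *\<^sub>R v0")
    case True
    then obtain c where c: "v = c *\<^sub>R v0" by blast
    then have "c \<noteq> 0" using v z by auto
    then show ?thesis using scale[OF v0\<Gamma>, of c] scale[OF v0\<Gamma>, of "- c"] c by (cases "0 < c") auto
  next
    case False
    then show ?thesis using segment_or_opposite_in_cone[OF conv v0 v] unfolding \<Gamma>_def by auto
  qed
  have notboth: False if vv: "v \<in> \<Gamma>" "- v \<in> \<Gamma>" for v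
  proof (cases "\<exists>c. v = c *\<^sub>R v0")
    case False
    then show False using not_segment_and_opposite_in_cone[OF proper v0, of v] vv unfolding \<Gamma>_def by auto
  next
    case True
    then obtain c where c: "v = c *\<^sub>R v0" by blast
    then have "c \<noteq> 0" using vv \<Gamma>C z by auto
    then have "- v0 \<in> \<Gamma>"
      using scale[OF vv(1), of "- inverse c"] scale[OF vv(2), of "inverse c"] c
      by (cases "0 < c") auto
    then have "closed_segment v0 (- v0) \<subseteq> ?C" by (simp add: \<Gamma>_def)
    moreover have "0 \<in> closed_segment v0 (- v0)"
      unfolding closed_segment_def by (rule CollectI, rule exI[of _ "1/2"]) simp
    ultimately show False using z by blast
  qed
  have open\<Gamma>: "open \<Gamma>"
    unfolding open_contains_ball
  proof (intro ballI)
    fix v assume "v \<in> \<Gamma>"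
    then have "closed_segment v0 v \<subseteq> ?C" by (simp add: \<Gamma>_def)
    then obtain e where e: "0 < e" "(\<Union>x\<in>closed_segment v0 v. ball x e) \<subseteq> ?C"
      using compact_subset_open_imp_ball_epsilon_subset[OF compact_segment op] by blast
    have "w \<in> \<Gamma>" if "w \<in> ball v e" for w
    proof -
      have "(1 - s) *\<^sub>R v0 + s *\<^sub>R w \<in> ?C" if s: "0 \<le> s" "s \<le> 1" for s
      proof -
        let ?x = "(1 - s) *\<^sub>R v0 + s *\<^sub>R v"
        have "dist ?x ((1 - s) *\<^sub>R v0 + s *\<^sub>R w) = s * dist v w"
          using s(1) by (simp add: dist_norm flip: scaleR_diff_right)
        also have "\<dots> \<le> dist v w" using s by (simp add: mult_left_le_one_le)
        also have "\<dots> < e" using \<open>w \<in> ball v e\<close> by simp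
        finally have "(1 - s) *\<^sub>R v0 + s *\<^sub>R w \<in> ball ?x e" by simp
        moreover have "?x \<in> closed_segment v0 v" using s by (auto simp: closed_segment_def)
        ultimately show ?thesis using e(2) by blast
      qed
      then show ?thesis unfolding \<Gamma>_def closed_segment_def by blast
    qed
    then show "\<exists>e>0. ball v e \<subseteq> \<Gamma>" using e(1) by blast
  qed
  have open\<Gamma>': "open (uminus ` \<Gamma>)" using open_negations[OF open\<Gamma>] by simp
  \<comment> \<open>\<Gamma> and its negative are disjoint open sets covering the double cone, so a
    connected set in the double cone that meets \<Gamma> stays in \<Gamma>.\<close>
  have seg_in: "closed_segment x y \<subseteq> \<Gamma>" if "x \<in> \<Gamma>" "closed_segment x y \<subseteq> ?C" for x y
  proof -
    have "closed_segment x y \<subseteq> \<Gamma> \<union> uminus ` \<Gamma>"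
    proof
      fix p assume "p \<in> closed_segment x y"
      then have "p \<in> \<Gamma> \<or> - p \<in> \<Gamma>" using that(2) either by blast
      then show "p \<in> \<Gamma> \<union> uminus ` \<Gamma>"
        using image_eqI[of p uminus "- p" \<Gamma>] by auto
    qed
    moreover have "\<Gamma> \<inter> uminus ` \<Gamma> \<inter> closed_segment x y = {}" using notboth by auto
    ultimately have "\<Gamma> \<inter> closed_segment x y = {} \<or> uminus ` \<Gamma> \<inter> closed_segment x y = {}"
      using connectedD[OF connected_segment(1) open\<Gamma> open\<Gamma>'] by blast
    then show ?thesis using \<open>closed_segment x y \<subseteq> \<Gamma> \<union> uminus ` \<Gamma>\<close> that(1) by blast
  qed
  have "convex \<Gamma>"
    unfolding convex_contains_segment
  proof (intro ballI)
    fix v w assume vw: "v \<in> \<Gamma>" "w \<in> \<Gamma>"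
    have v_nz: "v \<noteq> 0" using vw(1) \<Gamma>C z by auto
    show "closed_segment v w \<subseteq> \<Gamma>"
    proof (cases "\<exists>c. w = c *\<^sub>R v")
      case True
      then obtain c where c: "w = c *\<^sub>R v" by blast
      have "0 < c"
      proof (rule ccontr)
        assume "\<not> 0 < c"
        moreover have "c \<noteq> 0" using c vw(2) \<Gamma>C z by auto
        ultimately have "(- c) *\<^sub>R v \<in> \<Gamma>" using scale[OF vw(1), of "- c"] by simp
        then show False using notboth[OF vw(2)] c by simp
      qed
      have "(1 - s) *\<^sub>R v + s *\<^sub>R w \<in> \<Gamma>" if s: "0 \<le> s" "s \<le> 1" for s
      proof -
        have "0 < 1 - s + s * c" using s \<open>0 < c\<close> by (cases "s = 1") (auto simp: add_pos_nonneg)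
        from scale[OF vw(1) this] show ?thesis by (simp add: c scaleR_add_left)
      qed
      then show ?thesis unfolding closed_segment_def by blast
    next
      case False
      then have "closed_segment v w \<subseteq> ?C \<or> closed_segment v (- w) \<subseteq> ?C"
        using segment_or_opposite_in_cone[OF conv \<Gamma>C[OF vw(1)] \<Gamma>C[OF vw(2)]] by blast
      moreover have "\<not> closed_segment v (- w) \<subseteq> ?C"
      proof
        assume "closed_segment v (- w) \<subseteq> ?C"
        then have "- w \<in> \<Gamma>" using seg_in[OF vw(1)] by auto
        then show False using notboth[OF vw(2)] by blast
      qed
      ultimately show ?thesis using seg_in[OF vw(1)] by blast
    qed
  qed
  moreover have "v \<in> ?C \<longleftrightarrow> v \<in> \<Gamma> \<or> - v \<in> \<Gamma>" for v
    using either \<Gamma>C cone_over_uminus_iff by blast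
  ultimately show ?thesis using that open\<Gamma> v0\<Gamma> scale notboth by blast
qed

text \<open>A line in the closure of the cone, translated into the open cone, would span a projective
  line contained in the closure of the domain.\<close>

lemma lift_closure_pointed:
  fixes \<Gamma> :: "'a::euclidean_space set"
  assumes dim: "2 \<le> DIM('a)" and proper: "proj_proper \<Omega>"
    and \<Gamma>: "open \<Gamma>" "convex \<Gamma>" "\<Gamma> \<noteq> {}" "\<And>v t. v \<in> \<Gamma> \<Longrightarrow> 0 < t \<Longrightarrow> t *\<^sub>R v \<in> \<Gamma>"
      "\<Gamma> \<subseteq> cone_over \<Omega>"
    and z: "z \<in> closure \<Gamma>" "- z \<in> closure \<Gamma>"
  shows "z = 0"
proof (rule ccontr)
  assume z0: "z \<noteq> 0"
  have "\<not> \<Gamma> \<subseteq> span {z}"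
  proof
    assume "\<Gamma> \<subseteq> span {z}"
    then have "dim \<Gamma> \<le> 1" using dim_subset[of \<Gamma> "span {z}"] z0 by (simp add: dim_singleton)
    moreover have "\<not> dim \<Gamma> < DIM('a)"
      using empty_interior_lowdim[of \<Gamma>] \<Gamma>(1,3) by (auto simp: interior_open)
    ultimately show False using dim by simp
  qed
  then obtain u where u: "u \<in> \<Gamma>" "\<And>c. u \<noteq> c *\<^sub>R z" by (auto simp: span_singleton)
  note sp = proj_line_span2[OF z0 u(2)]
  \<comment> \<open>Moving \<open>y\<close> towards the interior point \<open>u\<close> by 1/(1 + t)
    lands in \<Gamma>; rescaling by 1 + t gives exactly \<open>u + t *\<^sub>R y\<close>.\<close>
  have shift: "u + t *\<^sub>R y \<in> \<Gamma>" if y: "y \<in> closure \<Gamma>" and t: "0 \<le> t" for t y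
  proof -
    let ?e = "1 / (1 + t)"
    have "y - ?e *\<^sub>R (y - u) \<in> interior \<Gamma>"
      using \<Gamma>(1,2) u(1) y t by (intro mem_interior_closure_convex_shrink) (auto simp: interior_open)
    then have "(1 + t) *\<^sub>R (y - ?e *\<^sub>R (y - u)) \<in> \<Gamma>"
      using \<Gamma>(4) t interior_subset by (metis add_pos_nonneg subset_iff zero_less_one)
    moreover have "(1 + t) *\<^sub>R (y - ?e *\<^sub>R (y - u)) = u + t *\<^sub>R y"
      using t by (simp add: scaleR_diff_right scaleR_add_left)
    ultimately show ?thesis by simp
  qed
  have line: "u + t *\<^sub>R z \<in> \<Gamma>" for t
    using shift[OF z(1), of t] shift[OF z(2), of "- t"] by (cases "0 \<le> t") auto
  have "proj_point x \<in> closure \<Omega>" if x: "x \<in> span {z, u}" "x \<noteq> 0" for x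
  proof -
    obtain \<alpha> \<beta> where \<alpha>\<beta>: "x = \<alpha> *\<^sub>R z + \<beta> *\<^sub>R u" using sp(2) x(1) by blast
    show ?thesis
    proof (cases "\<beta> = 0")
      case False
      then have "x = \<beta> *\<^sub>R (u + (\<alpha> / \<beta>) *\<^sub>R z)" by (simp add: \<alpha>\<beta> scaleR_add_right add.commute)
      then have "x \<in> cone_over \<Omega>" using line \<Gamma>(5) False cone_over_scaleR_iff by (metis subset_iff)
      then show ?thesis using closure_subset by (auto simp: cone_over_def)
    next
      case True
      \<comment> \<open>The one remaining point \<open>[z]\<close> of the projective line is reached
        as a limit, since \<open>z\<close> is in the closure of \<Gamma>.\<close>
      then have xz: "proj_point x = proj_point z" using \<alpha>\<beta> x(2) z0 proj_point_scaleR by auto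
      show ?thesis unfolding xz
      proof (rule ccontr)
        assume *: "proj_point z \<notin> closure \<Omega>"
        have "open (- closure \<Omega>)" by (simp add: open_Compl)
        then have "open (cone_over (- closure \<Omega>))" by (simp add: open_cone_over_iff)
        moreover have "z \<in> cone_over (- closure \<Omega>)" using * z0 by (simp add: cone_over_def)
        ultimately have "cone_over (- closure \<Omega>) \<inter> \<Gamma> \<noteq> {}"
          using z(1) by (metis IntI empty_iff open_Int_closure_eq_empty)
        then show False using \<Gamma>(5) closure_subset[of \<Omega>] by (auto simp: cone_over_def)
      qed
    qed
  qed
  then have "proj_point ` (span {z, u} - {0}) \<subseteq> closure \<Omega>" by blast
  then show False using proper sp(1) unfolding proj_proper_def by blast
qed

text \<open>Pointedness makes the closed cone without 0 convex, so the hull of its unit vectors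
  misses 0. This hull is compact, and separating it strictly from 0 gives the uniform constant
  \<open>b\<close>.\<close>

lemma pointed_cone_positive_functional:
  fixes \<Gamma> :: "'a::euclidean_space set"
  assumes conv: "convex \<Gamma>" and scale: "\<And>v t. v \<in> \<Gamma> \<Longrightarrow> 0 < t \<Longrightarrow> t *\<^sub>R v \<in> \<Gamma>"
    and pointed: "\<And>z. z \<in> closure \<Gamma> \<Longrightarrow> - z \<in> closure \<Gamma> \<Longrightarrow> z = 0"
  obtains a b where "0 < b" "\<And>z. z \<in> \<Gamma> \<Longrightarrow> b * norm z \<le> a \<bullet> z"
proof -
  have scale': "t *\<^sub>R v \<in> closure \<Gamma>" if "v \<in> closure \<Gamma>" "0 < t" for v t
  proof -
    have "(*\<^sub>R) t ` closure \<Gamma> \<subseteq> closure \<Gamma>"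
      using scale[OF _ that(2)] closure_subset
      by (intro image_closure_subset) (auto intro!: continuous_intros)
    then show ?thesis using that(1) by blast
  qed
  let ?S = "closure \<Gamma> - {0}"
  have "convex ?S"
  proof (rule convexI)
    fix x y s t assume xy: "x \<in> ?S" "y \<in> ?S" and st: "0 \<le> s" "0 \<le> t" "s + t = (1::real)"
    have "s *\<^sub>R x + t *\<^sub>R y \<in> closure \<Gamma>"
      using xy st convex_closure[OF conv] by (auto intro: convexD)
    moreover have "s *\<^sub>R x + t *\<^sub>R y \<noteq> 0"
    proof
      assume *: "s *\<^sub>R x + t *\<^sub>R y = 0"
      have "s \<noteq> 0" "t \<noteq> 0" using * xy st by auto
      then have "0 < s" "0 < t" using st by auto
      then have "t *\<^sub>R y \<in> closure \<Gamma>" "s *\<^sub>R x \<in> closure \<Gamma>" using scale' xy by auto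
      moreover have "t *\<^sub>R y = - (s *\<^sub>R x)" using * by (simp add: eq_neg_iff_add_eq_0 add.commute)
      ultimately have "s *\<^sub>R x = 0" using pointed[of "s *\<^sub>R x"] by simp
      then show False using \<open>s \<noteq> 0\<close> xy by simp
    qed
    ultimately show "s *\<^sub>R x + t *\<^sub>R y \<in> ?S" by simp
  qed
  moreover have "closure \<Gamma> \<inter> sphere 0 1 \<subseteq> ?S" by auto
  ultimately have hull: "convex hull (closure \<Gamma> \<inter> sphere 0 1) \<subseteq> ?S" by (intro hull_minimal)
  have "compact (closure \<Gamma> \<inter> sphere 0 1)" by (simp add: closed_Int_compact)
  then have "closed (convex hull (closure \<Gamma> \<inter> sphere 0 1))"
    by (simp add: compact_convex_hull compact_imp_closed)
  moreover have "0 \<notin> convex hull (closure \<Gamma> \<inter> sphere 0 1)" using hull by blast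
  ultimately obtain a b where ab: "0 < b" "\<And>x. x \<in> convex hull (closure \<Gamma> \<inter> sphere 0 1) \<Longrightarrow> b < a \<bullet> x"
    using separating_hyperplane_closed_0[OF convex_convex_hull] by metis
  have "b * norm z \<le> a \<bullet> z" if "z \<in> \<Gamma>" for z
  proof (cases "z = 0")
    case False
    then have "inverse (norm z) *\<^sub>R z \<in> closure \<Gamma> \<inter> sphere 0 1"
      using scale'[of z "inverse (norm z)"] that closure_subset by auto
    then have "b < a \<bullet> (inverse (norm z) *\<^sub>R z)" using ab(2) hull_inc by metis
    then show ?thesis using False by (simp add: field_simps)
  qed simp
  then show ?thesis using that ab(1) by blast
qed

text \<open>The hyperplane at infinity is the kernel of the positive functional \<open>a\<close>. In
  the slice where \<open>a\<close> equals 1, the bound by \<open>b * norm z\<close> makes the domain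
  bounded; the lift \<open>q\<close> of \<open>p\<close> in this slice becomes the origin.\<close>

lemma proper_convex_domain_chart:
  fixes \<Omega> :: "'n::finite rp set"
  assumes dom: "proper_convex_domain \<Omega>" and p: "p \<in> \<Omega>"
  obtains A :: "(real, 'n) vec \<times> real \<Rightarrow> (real, 'n) vec \<times> real" where
    "affine_chart A" "\<Omega> \<subseteq> range (chart_at A)" "chart_at A 0 = p"
    "open (chart_at A -` \<Omega>)" "convex (chart_at A -` \<Omega>)" "bounded (chart_at A -` \<Omega>)"
proof -
  let ?V = "TYPE((real, 'n) vec \<times> real)"
  obtain \<Gamma> :: "((real, 'n) vec \<times> real) set" where
    \<Gamma>: "open \<Gamma>" "convex \<Gamma>" "\<Gamma> \<noteq> {}" "\<And>v t. v \<in> \<Gamma> \<Longrightarrow> 0 < t \<Longrightarrow> t *\<^sub>R v \<in> \<Gamma>"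
    and cone: "\<And>v. v \<in> cone_over \<Omega> \<longleftrightarrow> v \<in> \<Gamma> \<or> - v \<in> \<Gamma>" "\<And>v. v \<in> \<Gamma> \<Longrightarrow> - v \<notin> \<Gamma>"
    using proper_convex_domain_lift[OF dom] by metis
  have proper: "proj_proper \<Omega>" using dom by (simp add: proper_convex_domain_def)
  have "2 \<le> DIM((real, 'n) vec \<times> real)" by (simp add: Suc_leI)
  then have "z = 0" if "z \<in> closure \<Gamma>" "- z \<in> closure \<Gamma>" for z
    using lift_closure_pointed[OF _ proper \<Gamma> _ that] cone(1) by blast
  then obtain a b where ab: "0 < b" "\<And>z. z \<in> \<Gamma> \<Longrightarrow> b * norm z \<le> a \<bullet> z"
    using pointed_cone_positive_functional[OF \<Gamma>(2,4)] by metis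
  have \<Gamma>0: "z \<noteq> 0" if "z \<in> \<Gamma>" for z using that cone by fastforce
  have apos: "0 < a \<bullet> z" if "z \<in> \<Gamma>" for z
    using ab(2)[OF that] ab(1) \<Gamma>0[OF that] by (smt (verit) mult_pos_pos zero_less_norm_iff)
  obtain v where v: "v \<noteq> 0" "p = proj_point v" by (rule proj_point_cases)
  then have "v \<in> cone_over \<Omega>" using p by (simp add: cone_over_def)
  moreover have "proj_point (- v) = proj_point v" using proj_point_scaleR[of "-1" v] v(1) by simp
  ultimately obtain v' where v': "v' \<in> \<Gamma>" "p = proj_point v'"
    using cone(1)[of v] v(2) by metis
  define q where "q = inverse (a \<bullet> v') *\<^sub>R v'"
  have q: "q \<in> \<Gamma>" "a \<bullet> q = 1" "proj_point q = p"
    unfolding q_def using \<Gamma>(4)[OF v'(1), of "inverse (a \<bullet> v')"] apos[OF v'(1)] v'(2) \<Gamma>0[OF v'(1)]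
      proj_point_scaleR[of "inverse (a \<bullet> v')" v'] by auto
  have "a \<noteq> 0" using q(2) by auto
  then have "dim {z. a \<bullet> z = 0} = DIM((real, 'n) vec)" by (simp add: dim_hyperplane)
  then obtain L where L: "linear L" "L ` (UNIV :: (real, 'n) vec set) = {z. a \<bullet> z = 0}" "\<And>x. norm (L x) = norm x"
    using isometry_subspaces[of "UNIV :: (real, 'n) vec set" "{z. a \<bullet> z = 0}"]
    by (auto simp: subspace_hyperplane dim_UNIV)
  define A where "A z = L (fst z) + snd z *\<^sub>R q" for z :: "(real, 'n) vec \<times> real"
  have lA: "linear A" unfolding A_def
    using L(1) by (intro linearI) (simp_all add: linear_add linear_cmul algebra_simps)
  have aL: "a \<bullet> L x = 0" for x using L(2) by blast
  have aA: "a \<bullet> A z = snd z" for z by (simp add: A_def inner_add_right aL q)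
  have "A z = 0 \<Longrightarrow> z = 0" for z
  proof -
    assume z: "A z = 0"
    then have s: "snd z = 0" using aA[of z] by simp
    then have "norm (L (fst z)) = 0" using z by (simp add: A_def)
    then show "z = 0" using L(3) s by (simp add: prod_eq_iff)
  qed
  then have injA: "inj A" using linear_injective_0[OF lA] by blast
  have chart: "affine_chart A"
    unfolding affine_chart_def bij_def using lA injA linear_injective_imp_surjective[OF lA] by auto
  have U: "chart_at A -` \<Omega> = {x. A (x, 1) \<in> \<Gamma>}"
  proof -
    have "chart_at A x \<in> \<Omega> \<longleftrightarrow> A (x, 1) \<in> \<Gamma>" for x
    proof -
      have 1: "a \<bullet> A (x, 1) = 1" by (simp add: aA)
      then have "A (x, 1) \<noteq> 0" by auto
      then have "chart_at A x \<in> \<Omega> \<longleftrightarrow> A (x, 1) \<in> cone_over \<Omega>" by (simp add: chart_at_def cone_over_def)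
      moreover have "- A (x, 1) \<notin> \<Gamma>" using apos[of "- A (x, 1)"] 1 by auto
      ultimately show ?thesis using cone(1) by blast
    qed
    then show ?thesis by auto
  qed
  have affA: "A (x, 1) = L x + q" for x by (simp add: A_def)
  show ?thesis
  proof
    show "affine_chart A" by (rule chart)
    show "\<Omega> \<subseteq> range (chart_at A)"
    proof
      fix P assume P: "P \<in> \<Omega>"
      obtain w where w: "w \<noteq> 0" "P = proj_point w" by (rule proj_point_cases)
      then have "w \<in> cone_over \<Omega>" using P by (simp add: cone_over_def)
      moreover have "proj_point (- w) = proj_point w" using proj_point_scaleR[of "-1" w] w(1) by simp
  ultimately obtain w' where w': "w' \<in> \<Gamma>" "P = proj_point w'"
        using cone(1)[of w] w(2) by metis
      obtain z where z: "inverse (a \<bullet> w') *\<^sub>R w' = A z"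
        using chart unfolding affine_chart_def bij_def by (metis surjD)
      have "snd z = 1" using aA[of z] apos[OF w'(1)] unfolding z[symmetric] by simp
      then have "P = chart_at A (fst z)"
        using w' apos[OF w'(1)] \<Gamma>0[OF w'(1)] proj_point_scaleR[of "inverse (a \<bullet> w')" w'] z
        unfolding chart_at_def by (metis inverse_nonzero_iff_nonzero less_irrefl prod.collapse)
      then show "P \<in> range (chart_at A)" by blast
    qed
    show "chart_at A 0 = p" by (simp add: chart_at_def affA linear_0[OF L(1)] q)
    have cL: "continuous_on UNIV (\<lambda>x. L x + q)"
      using L(1) by (intro continuous_intros linear_continuous_on) (simp add: linear_conv_bounded_linear)
    have "open ((\<lambda>x. L x + q) -` \<Gamma>)" using cL \<Gamma>(1) by (simp add: open_vimage continuous_on_eq_continuous_at)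
    then show "open (chart_at A -` \<Omega>)" unfolding U affA by (simp add: vimage_def)
    show "convex (chart_at A -` \<Omega>)"
    proof (rule convexI)
      fix x y s t assume *: "x \<in> chart_at A -` \<Omega>" "y \<in> chart_at A -` \<Omega>" "0 \<le> s" "0 \<le> t" "s + t = (1::real)"
      then have "s *\<^sub>R (L x + q) + t *\<^sub>R (L y + q) \<in> \<Gamma>" using \<Gamma>(2) by (auto simp: U affA intro: convexD)
      moreover have "s *\<^sub>R (L x + q) + t *\<^sub>R (L y + q) = L (s *\<^sub>R x + t *\<^sub>R y) + (s + t) *\<^sub>R q"
        using L(1) by (simp add: linear_add linear_cmul algebra_simps)
      ultimately show "s *\<^sub>R x + t *\<^sub>R y \<in> chart_at A -` \<Omega>" using *(5) by (simp add: U affA)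
    qed
    have "norm x \<le> 1 / b + norm q" if "x \<in> chart_at A -` \<Omega>" for x
    proof -
      have "b * norm (L x + q) \<le> a \<bullet> (L x + q)" using that ab(2) by (simp add: U affA)
      also have "\<dots> = 1" by (simp add: inner_add_right aL q)
      finally have "norm (L x + q) \<le> 1 / b" using ab(1) by (simp add: field_simps)
      moreover have "norm x \<le> norm (L x + q) + norm q"
        using norm_triangle_ineq4[of "L x + q" q] L(3)[of x] by simp
      ultimately show ?thesis by linarith
    qed
    then show "bounded (chart_at A -` \<Omega>)" unfolding bounded_iff by blast
  qed
qed

section \<open>The Hilbert distance in a chart\<close>

lemma line_chart_coeffs:
  assumes "line_chart e f" "\<alpha> *\<^sub>R e + \<beta> *\<^sub>R f = 0"
  shows "\<alpha> = 0 \<and> \<beta> = 0"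
proof -
  have ef: "independent {e, f}" "e \<noteq> f" using assms(1) by (auto simp: line_chart_def)
  then have f: "f \<noteq> 0" and e: "e \<noteq> 0" using dependent_zero by auto
  have "e \<notin> span {f}" using ef by (simp add: independent_insert)
  then have "\<alpha> = 0"
    using assms(2) span_scale[of f "{f}" "- \<beta> / \<alpha>"] 
    by (smt (verit) add_eq_0_iff divideR_right eq_vector_fraction_iff scaleR_minus_left span_base singletonI)
  then show ?thesis using assms(2) f by simp
qed

lemma line_chartI:
  assumes "e \<noteq> 0" "\<And>c. f \<noteq> c *\<^sub>R e"
  shows "line_chart e f"
  using proj_line_span2[OF assms] by (simp add: line_chart_def)

lemma line_chart_unique_coeffs:
  assumes "line_chart e f" "\<alpha> *\<^sub>R e + \<beta> *\<^sub>R f = \<gamma> *\<^sub>R e + \<delta> *\<^sub>R f"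
  shows "\<alpha> = \<gamma>" "\<beta> = \<delta>"
proof -
  have "(\<alpha> - \<gamma>) *\<^sub>R e + (\<beta> - \<delta>) *\<^sub>R f = 0" using assms(2) by (simp add: algebra_simps)
  from line_chart_coeffs[OF assms(1) this] show "\<alpha> = \<gamma>" "\<beta> = \<delta>" by auto
qed

lemma line_chart_nonzero:
  assumes "line_chart e f"
  shows "e \<noteq> 0" "s *\<^sub>R e + f \<noteq> 0"
  using line_chart_coeffs[OF assms, of 1 0] line_chart_coeffs[OF assms, of s 1] by auto

text \<open>Two charts agreeing at 0, 1 and infinity have proportional \<open>e\<close> and
  proportional \<open>f\<close>, and the point 1 forces the same factor. The coordinate of the
  fourth point is then unique.\<close>

lemma cross_ratio_line_chart:
  assumes ef: "line_chart e f"
  shows "cross_ratio (line_at e f 0) (line_at e f 1) (proj_point e) (line_at e f t) = t"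
  unfolding cross_ratio_def
proof (rule the_equality)
  show "\<exists>e' f'. line_chart e' f' \<and> line_at e f 0 = line_at e' f' 0 \<and> line_at e f 1 = line_at e' f' 1 \<and>
      proj_point e = proj_point e' \<and> line_at e f t = line_at e' f' t"
    using ef by blast
next
  fix t' assume "\<exists>e' f'. line_chart e' f' \<and> line_at e f 0 = line_at e' f' 0 \<and> line_at e f 1 = line_at e' f' 1 \<and>
      proj_point e = proj_point e' \<and> line_at e f t = line_at e' f' t'"
  then obtain e' f' where ef': "line_chart e' f'"
    and eq: "line_at e f 0 = line_at e' f' 0" "line_at e f 1 = line_at e' f' 1"
      "proj_point e = proj_point e'" "line_at e f t = line_at e' f' t'"
    by blast
  note nz = line_chart_nonzero[OF ef] line_chart_nonzero[OF ef']
  have rel: "\<exists>c. r' *\<^sub>R e' + f' = c *\<^sub>R (r *\<^sub>R e + f)" if "line_at e f r = line_at e' f' r'" for r r'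
    using that nz unfolding line_at_def by (simp add: proj_point_eq_iff)
  obtain \<mu> where \<mu>: "f' = \<mu> *\<^sub>R f" using rel[OF eq(1)] by auto
  obtain \<nu> where \<nu>: "e' = \<nu> *\<^sub>R e" using eq(3) nz by (auto simp: proj_point_eq_iff)
  obtain \<kappa> where "e' + f' = \<kappa> *\<^sub>R (e + f)" using rel[OF eq(2)] by auto
  then have "\<nu> *\<^sub>R e + \<mu> *\<^sub>R f = \<kappa> *\<^sub>R e + \<kappa> *\<^sub>R f" by (simp add: \<mu> \<nu> scaleR_add_right)
  from line_chart_unique_coeffs[OF ef this] have \<mu>\<nu>: "\<mu> = \<nu>" by simp
  obtain \<tau> where "t' *\<^sub>R e' + f' = \<tau> *\<^sub>R (t *\<^sub>R e + f)" using rel[OF eq(4)] by auto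
  then have "(t' * \<nu>) *\<^sub>R e + \<nu> *\<^sub>R f = (\<tau> * t) *\<^sub>R e + \<tau> *\<^sub>R f" by (simp add: \<mu> \<nu> \<mu>\<nu> scaleR_add_right)
  from line_chart_unique_coeffs[OF ef this] have "t' * \<nu> = \<nu> * t" by simp
  moreover have "\<nu> \<noteq> 0" using \<nu> nz by auto
  ultimately show "t' = t" by simp
qed

section \<open>Topology of the domain in a bounded affine chart\<close>

locale bounded_chart =
  fixes \<Omega> :: "'n::finite rp set" and A :: "(real, 'n) vec \<times> real \<Rightarrow> (real, 'n) vec \<times> real"
  assumes chart: "affine_chart A" and range_chart: "\<Omega> \<subseteq> range (chart_at A)"
    and open_\<Omega>: "open \<Omega>"
    and open_dom: "open (chart_at A -` \<Omega>)" and convex_dom: "convex (chart_at A -` \<Omega>)"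
    and bounded_dom: "bounded (chart_at A -` \<Omega>)"
begin

abbreviation "U \<equiv> chart_at A -` \<Omega>"

lemma linear_A: "linear A" and inj_A: "inj A" and surj_A: "surj A"
  using chart by (auto simp: affine_chart_def bij_def)

lemma A_eq_iff: "A z = A w \<longleftrightarrow> z = w"
  using inj_A by (simp add: inj_eq)

lemma A_nonzero: "A (x, 1) \<noteq> 0"
  using A_eq_iff[of "(x, 1)" 0] linear_0[OF linear_A] by (auto simp: zero_prod_def)

lemma A_scaleR: "c *\<^sub>R A z = A (c *\<^sub>R z)" and A_add: "A z + A w = A (z + w)"
  using linear_A by (simp_all add: linear_add linear_cmul)

lemma chart_at_eq_iff: "chart_at A x = chart_at A y \<longleftrightarrow> x = y"
proof
  assume "chart_at A x = chart_at A y"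
  then obtain c where "A (y, 1) = c *\<^sub>R A (x, 1)"
    using A_nonzero unfolding chart_at_def by (auto simp: proj_point_eq_iff)
  then show "x = y" by (auto simp: A_scaleR A_eq_iff)
qed simp

lemma continuous_chart_at: "continuous_on UNIV (chart_at A)"
  unfolding continuous_on_open_vimage[OF open_UNIV]
proof (intro allI impI)
  fix O' :: "'n rp set" assume "open O'"
  then have "open (cone_over O')" by (simp add: open_cone_over_iff)
  moreover have "continuous_on UNIV (\<lambda>x. A (x, 1))"
    using linear_A linear_conv_bounded_linear
    by (intro continuous_on_compose2[OF linear_continuous_on, of A UNIV] continuous_intros) auto
  ultimately have "open ((\<lambda>x. A (x, 1)) -` cone_over O')"
    using open_vimage by blast
  moreover have "(\<lambda>x. A (x, 1)) -` cone_over O' = chart_at A -` O' \<inter> UNIV"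
    using A_nonzero by (auto simp: cone_over_def chart_at_def)
  ultimately show "open (chart_at A -` O' \<inter> UNIV)" by simp
qed

text \<open>In linear coordinates the preimage of the image consists of the nonzero vectors
  \<open>(r *\<^sub>R x, r)\<close> with \<open>x\<close> in \<open>S\<close>. Adding 0, this is the
  projection of a closed relation along the compact factor \<open>S\<close>, hence closed.\<close>

lemma closed_chart_image:
  assumes "compact S"
  shows "closed (chart_at A ` S)"
proof -
  obtain B where B: "linear B" "B \<circ> A = id"
    using linear_injective_left_inverse[OF linear_A inj_A] by blast
  have AB: "A (B v) = v" for v using B(2) surj_A by (metis comp_apply id_apply surjD)
  let ?K = "{p. \<exists>x. x \<in> S \<and> (x, p) \<in> {q. fst (snd q) = snd (snd q) *\<^sub>R fst q}}"
  have "closed {q :: (real, 'n) vec \<times> (real, 'n) vec \<times> real. fst (snd q) = snd (snd q) *\<^sub>R fst q}"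
    by (intro closed_Collect_eq continuous_intros)
  then have "closed ?K" using assms closed_compact_projection by blast
  then have "closed (B -` ?K)"
    using B(1) by (intro continuous_closed_vimage) (simp_all add: linear_continuous_at linear_conv_bounded_linear)
  then have "open (- {0} \<inter> - (B -` ?K))" by (intro open_Int open_Compl) auto
  moreover have "cone_over (- chart_at A ` S) = - {0} \<inter> - (B -` ?K)"
  proof -
    have "proj_point v \<in> chart_at A ` S \<longleftrightarrow> B v \<in> ?K" if v: "v \<noteq> 0" for v
    proof
      assume "proj_point v \<in> chart_at A ` S"
      then obtain x where x: "x \<in> S" "proj_point v = proj_point (A (x, 1))" by (auto simp: chart_at_def)
      then obtain c where "v = c *\<^sub>R A (x, 1)" using proj_point_eq_iff[OF A_nonzero v] by metis
      then have "v = A (c *\<^sub>R x, c)" by (simp add: A_scaleR)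
      then have "B v = (c *\<^sub>R x, c)" using B(2) by (metis comp_apply id_apply)
      then show "B v \<in> ?K" using x(1) by auto
    next
      assume "B v \<in> ?K"
      then obtain x where x: "x \<in> S" "fst (B v) = snd (B v) *\<^sub>R x" by auto
      have "B v = snd (B v) *\<^sub>R (x, 1)" using x(2) by (simp add: prod_eq_iff)
      from arg_cong[OF this, of A] have "v = A (snd (B v) *\<^sub>R (x, 1))" unfolding AB .
      then have "v = snd (B v) *\<^sub>R A (x, 1)" by (simp only: A_scaleR)
      then have "proj_point v = chart_at A x"
        using v unfolding chart_at_def by (metis A_nonzero proj_point_scaleR scaleR_zero_left)
      then show "proj_point v \<in> chart_at A ` S" using x(1) by blast
    qed
    then show ?thesis by (auto simp: cone_over_def)
  qed
  ultimately have "open (- chart_at A ` S)" using open_cone_over_iff by metis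
  then show ?thesis by (simp add: closed_def)
qed

lemma image_U: "chart_at A ` U = \<Omega>"
  using range_chart by auto

lemma closure_\<Omega>: "closure \<Omega> = chart_at A ` closure U"
proof
  have "closed (chart_at A ` closure U)"
    using bounded_dom by (intro closed_chart_image) simp
  moreover have "\<Omega> \<subseteq> chart_at A ` closure U" using image_U closure_subset by blast
  ultimately show "closure \<Omega> \<subseteq> chart_at A ` closure U" by (rule closure_minimal[rotated])
  show "chart_at A ` closure U \<subseteq> closure \<Omega>"
    using continuous_on_subset[OF continuous_chart_at] closure_subset
    by (intro image_closure_subset) auto
qed

lemma frontier_\<Omega>: "frontier \<Omega> = chart_at A ` frontier U"
proof -
  have "chart_at A ` closure U - \<Omega> = chart_at A ` (closure U - U)" by auto
  then show ?thesis using open_\<Omega> open_dom by (simp add: frontier_def closure_\<Omega> interior_open)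
qed

lemma ray_in_U:
  assumes "x \<in> U" "x + w \<in> closure U" "0 \<le> s" "s < 1"
  shows "x + s *\<^sub>R w \<in> U"
proof -
  have "(x + w) - (1 - s) *\<^sub>R ((x + w) - x) \<in> interior U"
    using assms open_dom by (intro mem_interior_closure_convex_shrink convex_dom) (auto simp: interior_open)
  then show ?thesis using interior_subset by (auto simp: scaleR_diff_left)
qed

lemma frontier_ray_unique:
  assumes "x \<in> U" "x + s *\<^sub>R u \<in> frontier U" "x + t *\<^sub>R u \<in> frontier U" "0 < s" "0 < t"
  shows "s = t"
proof -
  have *: False if "x + s *\<^sub>R u \<in> frontier U" "x + t *\<^sub>R u \<in> frontier U" "0 < s" "s < t" for s t
  proof -
    have "x + (s / t) *\<^sub>R (t *\<^sub>R u) \<in> U"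
      using assms(1) that by (intro ray_in_U) (auto simp: frontier_def)
    then have "x + s *\<^sub>R u \<in> U" using that by simp
    then show False using that(1) open_dom by (auto simp: frontier_def interior_open)
  qed
  show ?thesis using *[of s t] *[of t s] assms by (cases s t rule: linorder_cases) auto
qed

lemma exit_exists:
  assumes "x \<in> U" "u \<noteq> 0"
  obtains b where "0 < b" "x + (1 / b) *\<^sub>R u \<in> frontier U"
proof -
  have "x \<in> interior U" using assms(1) open_dom by (simp add: interior_open)
  then obtain d where "0 < d" "x + d *\<^sub>R u \<in> frontier U"
    using ray_to_frontier[OF bounded_dom _ assms(2)] by metis
  then show ?thesis using that[of "1 / d"] by simp
qed

end

text \<open>\<open>a\<close> and \<open>b\<close> are the inverse exit times from \<open>x\<close> in the directions \<open>- u\<close> and \<open>u\<close>, that is, the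
  values at \<open>- u\<close> and \<open>u\<close> of the gauge of \<open>U\<close> centred at \<open>x\<close>.\<close>

locale chord = bounded_chart \<Omega> A for \<Omega> :: "'n::finite rp set" and A +
  fixes x u :: "real ^ 'n" and a b :: real
  assumes x: "x \<in> U" and u: "u \<noteq> 0" and a: "0 < a" and b: "0 < b"
    and fa: "x - (1 / a) *\<^sub>R u \<in> frontier U" and fb: "x + (1 / b) *\<^sub>R u \<in> frontier U"
begin

definition "e0 = A (u, 0)"
definition "f0 = A (x, 1)"
definition "l = proj_point ` (span {e0, f0} - {0})"

lemma e0_nonzero: "e0 \<noteq> 0"
  using A_eq_iff[of "(u, 0)" 0] linear_0[OF linear_A] u by (auto simp: e0_def zero_prod_def)

lemma f0_independent: "f0 \<noteq> c *\<^sub>R e0"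
  by (simp add: e0_def f0_def A_scaleR A_eq_iff)

lemma comb: "\<alpha> *\<^sub>R e0 + \<beta> *\<^sub>R f0 = A (\<alpha> *\<^sub>R u + \<beta> *\<^sub>R x, \<beta>)"
  by (simp add: e0_def f0_def A_scaleR A_add)

lemma line_chart0: "line_chart e0 f0"
  using line_chartI[OF e0_nonzero f0_independent] .

lemma line_at0: "line_at e0 f0 s = chart_at A (x + s *\<^sub>R u)"
  using comb[of s 1] by (simp add: line_at_def chart_at_def add.commute)

lemma proj_line_l: "proj_line l"
  unfolding l_def by (rule proj_line_span2(1)[OF e0_nonzero f0_independent])

lemma line_at0_in_l: "line_at e0 f0 s \<in> l"
  unfolding l_def line_at_def
proof (rule imageI)
  have "s *\<^sub>R e0 + f0 \<in> span {e0, f0}" by (intro span_add span_scale span_base) auto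
  then show "s *\<^sub>R e0 + f0 \<in> span {e0, f0} - {0}"
    using line_chart_nonzero(2)[OF line_chart0, of s] by blast
qed

lemma l_chartD:
  assumes "chart_at A z \<in> l"
  obtains s where "z = x + s *\<^sub>R u"
proof -
  obtain v where v: "v \<in> span {e0, f0}" "v \<noteq> 0" "proj_point (A (z, 1)) = proj_point v"
    using assms by (auto simp: l_def chart_at_def)
  obtain \<alpha> \<beta> where "v = \<alpha> *\<^sub>R e0 + \<beta> *\<^sub>R f0"
    using v(1) proj_line_span2(2)[OF e0_nonzero f0_independent] by blast
  moreover obtain c where "A (z, 1) = c *\<^sub>R v" using v proj_point_eq_iff[OF v(2) A_nonzero] by metis
  ultimately have "(z, 1) = c *\<^sub>R (\<alpha> *\<^sub>R u + \<beta> *\<^sub>R x, \<beta>)" by (simp only: comb A_scaleR A_eq_iff)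
  then have "c * \<beta> = 1" "z = (c * \<alpha>) *\<^sub>R u + (c * \<beta>) *\<^sub>R x" by (auto simp: scaleR_add_right)
  then show ?thesis using that[of "c * \<alpha>"] by (simp add: add.commute)
qed

lemma l_inter_frontier: "l \<inter> frontier \<Omega> = {chart_at A (x - (1 / a) *\<^sub>R u), chart_at A (x + (1 / b) *\<^sub>R u)}"
proof
  show "{chart_at A (x - (1 / a) *\<^sub>R u), chart_at A (x + (1 / b) *\<^sub>R u)} \<subseteq> l \<inter> frontier \<Omega>"
    using fa fb line_at0_in_l[of "- (1 / a)"] line_at0_in_l[of "1 / b"] by (auto simp: line_at0 frontier_\<Omega>)
  show "l \<inter> frontier \<Omega> \<subseteq> {chart_at A (x - (1 / a) *\<^sub>R u), chart_at A (x + (1 / b) *\<^sub>R u)}"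
  proof
    fix P assume P: "P \<in> l \<inter> frontier \<Omega>"
    then obtain z where z: "z \<in> frontier U" "P = chart_at A z" by (auto simp: frontier_\<Omega>)
    then obtain s where s: "z = x + s *\<^sub>R u" using P l_chartD by blast
    have "s \<noteq> 0" using x z s open_dom by (auto simp: frontier_def interior_open)
    then consider "0 < s" | "s < 0" by linarith
    then have "s = 1 / b \<or> s = - (1 / a)"
    proof cases
      case 1
      then show ?thesis using frontier_ray_unique[OF x, of s u "1 / b"] z s fb b by simp
    next
      case 2
      then show ?thesis using frontier_ray_unique[OF x, of "- s" "- u" "1 / a"] z s fa a by simp
    qed
    then show "P \<in> {chart_at A (x - (1 / a) *\<^sub>R u), chart_at A (x + (1 / b) *\<^sub>R u)}" using z(2) s by auto
  qed
qed

lemma closure_inter_l: "closure \<Omega> \<inter> l \<subseteq> range (line_at e0 f0)"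
proof
  fix P assume P: "P \<in> closure \<Omega> \<inter> l"
  then obtain z where "P = chart_at A z" by (auto simp: closure_\<Omega>)
  then show "P \<in> range (line_at e0 f0)" using P l_chartD line_at0 by (metis IntD2 rangeI)
qed

lemma proj_line_unique:
  assumes "proj_line l'" "line_at e0 f0 0 \<in> l'" "line_at e0 f0 1 \<in> l'"
  shows "l' = l"
proof -
  obtain W where W: "subspace W" "dim W = 2" "l' = proj_point ` (W - {0})"
    using assms(1) by (auto simp: proj_line_def)
  have in_W: "s *\<^sub>R e0 + f0 \<in> W" if s: "line_at e0 f0 s \<in> l'" for s
  proof -
    obtain w where w: "w \<in> W" "w \<noteq> 0" "proj_point (s *\<^sub>R e0 + f0) = proj_point w"
      using s W(3) unfolding line_at_def by blast
    then obtain c where "s *\<^sub>R e0 + f0 = c *\<^sub>R w"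
      using proj_point_eq_iff[OF w(2) line_chart_nonzero(2)[OF line_chart0]] by metis
    then show ?thesis using W(1) w(1) by (simp add: subspace_scale)
  qed
  have f: "f0 \<in> W" using in_W[OF assms(2)] by simp
  have "e0 \<in> W" using subspace_diff[OF W(1) in_W[OF assms(3)] f] by simp
  then have "span {e0, f0} \<subseteq> W" using f W(1) by (intro span_minimal) auto
  moreover have "dim (span {e0, f0}) = 2"
    using line_chart0 by (simp add: line_chart_def dim_eq_card_independent)
  ultimately have "span {e0, f0} = W" using W subspace_dim_equal[of "span {e0, f0}" W] by auto
  then show ?thesis by (simp add: l_def W(3))
qed

text \<open>The \<open>f\<close>-coefficient \<open>\<phi>\<close> is affine in the parameter and has no zero on the chord, so a chart
  of the line cannot reverse the order of three points of the chord.\<close>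

lemma not_between_reversed:
  assumes b1: "b < 1"
  shows "\<not> between_in \<Omega> l (line_at e0 f0 (1 / b)) (line_at e0 f0 0) (line_at e0 f0 1)"
proof
  assume "between_in \<Omega> l (line_at e0 f0 (1 / b)) (line_at e0 f0 0) (line_at e0 f0 1)"
  then obtain e f \<alpha> \<xi> \<eta> where ef: "line_chart e f" and sub: "closure \<Omega> \<inter> l \<subseteq> range (line_at e f)"
    and eq: "line_at e0 f0 (1 / b) = line_at e f \<alpha>" "line_at e0 f0 0 = line_at e f \<xi>" "line_at e0 f0 1 = line_at e f \<eta>"
    and ord: "\<alpha> < \<xi>" "\<xi> < \<eta>"
    unfolding between_in_def by blast
  have rel: "\<exists>c. c \<noteq> 0 \<and> s *\<^sub>R e0 + f0 = (c * s') *\<^sub>R e + c *\<^sub>R f" if st: "line_at e0 f0 s = line_at e f s'" for s s'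
  proof -
    obtain c where c: "s *\<^sub>R e0 + f0 = c *\<^sub>R (s' *\<^sub>R e + f)"
      using st proj_point_eq_iff[OF line_chart_nonzero(2)[OF ef] line_chart_nonzero(2)[OF line_chart0], of s' s]
      unfolding line_at_def by metis
    then have "c \<noteq> 0" using line_chart_nonzero(2)[OF line_chart0, of s] by auto
    then show ?thesis using c by (auto simp: scaleR_add_right)
  qed
  obtain k0 where k0: "0 *\<^sub>R e0 + f0 = (k0 * \<xi>) *\<^sub>R e + k0 *\<^sub>R f" "k0 \<noteq> 0" using rel[OF eq(2)] by blast
  obtain k1 where k1: "1 *\<^sub>R e0 + f0 = (k1 * \<eta>) *\<^sub>R e + k1 *\<^sub>R f" "k1 \<noteq> 0" using rel[OF eq(3)] by blast
  obtain kb where kb: "(1 / b) *\<^sub>R e0 + f0 = (kb * \<alpha>) *\<^sub>R e + kb *\<^sub>R f" "kb \<noteq> 0" using rel[OF eq(1)] by blast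
  define \<phi> where "\<phi> s = k0 + s * (k1 - k0)" for s
  have e0: "e0 = (k1 * \<eta> - k0 * \<xi>) *\<^sub>R e + (k1 - k0) *\<^sub>R f"
    using k0(1) k1(1) by (simp add: algebra_simps)
  have gen: "s *\<^sub>R e0 + f0 = (k0 * \<xi> + s * (k1 * \<eta> - k0 * \<xi>)) *\<^sub>R e + \<phi> s *\<^sub>R f" for s
    using k0(1) unfolding e0 \<phi>_def by (simp add: algebra_simps)
  have kb\<phi>: "kb = \<phi> (1 / b)" "kb * \<alpha> = k0 * \<xi> + (1 / b) * (k1 * \<eta> - k0 * \<xi>)"
    using line_chart_unique_coeffs[OF ef, of "kb * \<alpha>" kb "k0 * \<xi> + (1 / b) * (k1 * \<eta> - k0 * \<xi>)" "\<phi> (1 / b)"]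
    using kb(1) gen[of "1 / b"] by simp_all
  have nz: "\<phi> s \<noteq> 0" if s: "0 \<le> s" "s \<le> 1 / b" for s
  proof -
    have "x + s *\<^sub>R u \<in> closure U"
    proof (cases "s = 1 / b")
      case True
      then show ?thesis using fb by (simp add: frontier_def)
    next
      case False
      then have "x + (s * b) *\<^sub>R ((1 / b) *\<^sub>R u) \<in> U"
        using s b fb by (intro ray_in_U x) (auto simp: frontier_def field_simps)
      then have "x + s *\<^sub>R u \<in> U" using b by simp
      then show ?thesis by (rule subsetD[OF closure_subset])
    qed
    then have "line_at e0 f0 s \<in> closure \<Omega> \<inter> l" using line_at0_in_l by (auto simp: closure_\<Omega> line_at0)
    then obtain s' where "line_at e0 f0 s = line_at e f s'" using sub by blast
    then obtain c where "c \<noteq> 0" "s *\<^sub>R e0 + f0 = (c * s') *\<^sub>R e + c *\<^sub>R f" using rel by blast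
    then show ?thesis using line_chart_unique_coeffs(2)[OF ef] gen[of s] by metis
  qed
  have b1': "1 < 1 / b" using b b1 by simp
  have k1\<phi>: "k1 = \<phi> 1" by (simp add: \<phi>_def)
  \<comment> \<open>A sign change would give \<phi> a zero between 1 and 1/b, a point of the chord
    at infinity for the chart.\<close>
  have same: "0 < k1 * kb"
  proof (rule ccontr)
    assume "\<not> 0 < k1 * kb"
    then have neg: "k1 * kb < 0" using k1(2) kb(2) by (simp add: less_le)
    have "\<phi> 1 \<le> 0 \<and> 0 \<le> \<phi> (1 / b) \<or> 0 \<le> \<phi> 1 \<and> \<phi> (1 / b) \<le> 0"
      using neg unfolding k1\<phi> kb\<phi>(1) by (auto simp: mult_less_0_iff)
    moreover have "continuous_on {1..1 / b} \<phi>" unfolding \<phi>_def by (intro continuous_intros)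
    ultimately obtain s where "1 \<le> s" "s \<le> 1 / b" "\<phi> s = 0"
      using IVT'[of \<phi> 1 0 "1 / b"] IVT2'[of \<phi> "1 / b" 0 1] b1' by (metis less_imp_le)
    then show False using nz[of s] by simp
  qed
  have "b * kb = b * k0 + (k1 - k0)" using b unfolding kb\<phi>(1) \<phi>_def by (simp add: field_simps)
  moreover have "b * (kb * \<alpha>) = b * (k0 * \<xi>) + (k1 * \<eta> - k0 * \<xi>)" using b unfolding kb\<phi>(2) by (simp add: field_simps)
  \<comment> \<open>Eliminating \<open>k0\<close> relates the two gaps; after multiplication by
    \<open>k1\<close> the left side is negative and the right side positive.\<close>
  ultimately have "b * kb * (\<alpha> - \<xi>) = k1 * (\<eta> - \<xi>)" by algebra
  then have "k1 * (b * kb * (\<alpha> - \<xi>)) = k1 * (k1 * (\<eta> - \<xi>))" by simp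
  then have "b * (k1 * kb) * (\<alpha> - \<xi>) = k1 * k1 * (\<eta> - \<xi>)" by (simp add: ac_simps)
  moreover have "b * (k1 * kb) * (\<alpha> - \<xi>) < 0" using b same ord(1) by (simp add: mult_pos_neg)
  moreover have "0 < k1 * k1 * (\<eta> - \<xi>)" using k1(2) ord(2) by (simp add: zero_less_mult_iff) linarith
  ultimately show False by linarith
qed

text \<open>Lifts of the two endpoints are scaled so that their sum is a multiple of
  \<open>f0\<close>, which gives \<open>x\<close> the coordinate 1; the coordinate of the second
  point can then be read off.\<close>

lemma cross_ratio_chord:
  assumes b1: "b < 1"
  shows "cross_ratio (line_at e0 f0 (- (1 / a))) (line_at e0 f0 0) (line_at e0 f0 (1 / b)) (line_at e0 f0 1)
    = (1 + a) / (1 - b)"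
proof -
  let ?e = "b *\<^sub>R f0 + e0" and ?f = "a *\<^sub>R f0 - e0" and ?t = "(1 + a) / (1 - b)"
  have e: "?e = b *\<^sub>R ((1 / b) *\<^sub>R e0 + f0)" using b by (simp add: scaleR_add_right)
  have f: "?f = a *\<^sub>R ((- (1 / a)) *\<^sub>R e0 + f0)" using a by (simp add: scaleR_diff_right scaleR_add_right)
  have nz0: "s *\<^sub>R e0 + f0 \<noteq> 0" for s by (rule line_chart_nonzero(2)[OF line_chart0])
  have "line_chart ?e ?f"
  proof (rule line_chartI)
    show "?e \<noteq> 0" unfolding e using nz0 b by simp
    fix c show "?f \<noteq> c *\<^sub>R ?e"
    proof
      assume "?f = c *\<^sub>R ?e"
      then have "(- 1) *\<^sub>R e0 + a *\<^sub>R f0 = c *\<^sub>R e0 + (c * b) *\<^sub>R f0" by (simp add: algebra_simps)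
      from line_chart_unique_coeffs[OF line_chart0 this] have "a = - b" by auto
      then show False using a b by simp
    qed
  qed
  note cr = cross_ratio_line_chart[OF this, of ?t]
  have "line_at ?e ?f 0 = line_at e0 f0 (- (1 / a))"
    using proj_point_scaleR[OF _ nz0[of "- (1 / a)"], of a] a unfolding line_at_def f by simp
  moreover have "line_at ?e ?f 1 = line_at e0 f0 0"
  proof -
    have "1 *\<^sub>R ?e + ?f = (a + b) *\<^sub>R (0 *\<^sub>R e0 + f0)" by (simp add: algebra_simps)
    moreover have "proj_point ((a + b) *\<^sub>R (0 *\<^sub>R e0 + f0)) = proj_point (0 *\<^sub>R e0 + f0)"
      using a b by (intro proj_point_scaleR nz0) simp
    ultimately show ?thesis by (simp only: line_at_def)
  qed
  moreover have "proj_point ?e = line_at e0 f0 (1 / b)"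
    using proj_point_scaleR[OF _ nz0[of "1 / b"], of b] b unfolding line_at_def e by simp
  moreover have "line_at ?e ?f ?t = line_at e0 f0 1"
  proof -
    have "?t * b + a = (a + b) / (1 - b)" "?t - 1 = (a + b) / (1 - b)"
      using b1 by (simp_all add: field_simps)
    moreover have "?t *\<^sub>R ?e + ?f = (?t - 1) *\<^sub>R e0 + (?t * b + a) *\<^sub>R f0"
      by (simp only: scaleR_add_right scaleR_scaleR scaleR_add_left scaleR_diff_left) (simp only: add_ac scaleR_one diff_conv_add_uminus)
    ultimately have "?t *\<^sub>R ?e + ?f = ((a + b) / (1 - b)) *\<^sub>R (1 *\<^sub>R e0 + f0)"
      by (simp only: scaleR_add_right scaleR_one)
    moreover have "proj_point (((a + b) / (1 - b)) *\<^sub>R (1 *\<^sub>R e0 + f0)) = proj_point (1 *\<^sub>R e0 + f0)"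
      using a b b1 by (intro proj_point_scaleR nz0) simp
    ultimately show ?thesis by (simp only: line_at_def)
  qed
  ultimately show ?thesis using cr by (simp only:)
qed

text \<open>The description in \<open>hilbert_dist\<close> has one value: the line through the two
  points is unique, its frontier points are known as an unordered pair, and betweenness fixes their
  order. The first claim says that the exit time 1/b lies beyond the second point.\<close>

lemma hilbert_dist_chord:
  assumes y: "x + u \<in> U"
  shows "b < 1" and "hilbert_dist \<Omega> (chart_at A x) (chart_at A (x + u)) = 1 / 2 * ln ((1 + a) / (1 - b))"
proof -
  show b1: "b < 1"
  proof (rule ccontr)
    assume "\<not> b < 1"
    then have "x + (1 / b) *\<^sub>R u \<in> U"
    proof (cases "b = 1")
      case False
      then show ?thesis using \<open>\<not> b < 1\<close> by (intro ray_in_U x subsetD[OF closure_subset y]) auto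
    qed (use y in simp)
    then show False using fb open_dom by (auto simp: frontier_def interior_open)
  qed
  have P: "chart_at A x = line_at e0 f0 0" "chart_at A (x + u) = line_at e0 f0 1"
    "chart_at A (x - (1 / a) *\<^sub>R u) = line_at e0 f0 (- (1 / a))"
    "chart_at A (x + (1 / b) *\<^sub>R u) = line_at e0 f0 (1 / b)"
    by (simp_all add: line_at0)
  have ne: "line_at e0 f0 s \<noteq> line_at e0 f0 t" if "s \<noteq> t" for s t
    using that u by (simp add: line_at0 chart_at_eq_iff)
  let ?Q = "\<lambda>d. \<exists>l a' b'. proj_line l \<and> chart_at A x \<in> l \<and> chart_at A (x + u) \<in> l \<and>
        l \<inter> frontier \<Omega> = {a', b'} \<and> a' \<noteq> b' \<and> between_in \<Omega> l a' (chart_at A x) (chart_at A (x + u)) \<and>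
        d = 1 / 2 * ln \<bar>cross_ratio a' (chart_at A x) b' (chart_at A (x + u))\<bar>"
  have "(THE d. ?Q d) = 1 / 2 * ln ((1 + a) / (1 - b))"
  proof (rule the_equality)
    have "between_in \<Omega> l (line_at e0 f0 (- (1 / a))) (line_at e0 f0 0) (line_at e0 f0 1)"
      unfolding between_in_def using line_chart0 closure_inter_l a
      by (intro exI[of _ e0] exI[of _ f0] exI[of _ "- (1 / a)"] exI[of _ 0] exI[of _ 1]) auto
    moreover have "\<bar>(1 + a) / (1 - b)\<bar> = (1 + a) / (1 - b)" using a b1 by simp
    moreover have "- (1 / a) \<noteq> 1 / b" using a b by (smt (verit) divide_pos_pos)
    ultimately show "?Q (1 / 2 * ln ((1 + a) / (1 - b)))"
      unfolding P using proj_line_l line_at0_in_l l_inter_frontier[unfolded P] ne cross_ratio_chord[OF b1]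
      by (intro exI[of _ l] exI[of _ "line_at e0 f0 (- (1 / a))"] exI[of _ "line_at e0 f0 (1 / b)"]) simp
  next
    fix d assume "?Q d"
    then obtain l' a' b' where Q: "proj_line l'" "line_at e0 f0 0 \<in> l'" "line_at e0 f0 1 \<in> l'"
      "l' \<inter> frontier \<Omega> = {a', b'}" "a' \<noteq> b'" "between_in \<Omega> l' a' (line_at e0 f0 0) (line_at e0 f0 1)"
      "d = 1 / 2 * ln \<bar>cross_ratio a' (line_at e0 f0 0) b' (line_at e0 f0 1)\<bar>"
      unfolding P by blast
    have l': "l' = l" by (rule proj_line_unique[OF Q(1-3)])
    have "{a', b'} = {line_at e0 f0 (- (1 / a)), line_at e0 f0 (1 / b)}"
      using Q(4) l_inter_frontier unfolding P l' by simp
    moreover have "a' \<noteq> line_at e0 f0 (1 / b)" using Q(6) not_between_reversed[OF b1] unfolding l' by auto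
    ultimately have "a' = line_at e0 f0 (- (1 / a))" "b' = line_at e0 f0 (1 / b)"
      using Q(5) by (auto simp: doubleton_eq_iff)
    then have "d = 1 / 2 * ln \<bar>(1 + a) / (1 - b)\<bar>" using Q(7) cross_ratio_chord[OF b1] by simp
    then show "d = 1 / 2 * ln ((1 + a) / (1 - b))" using a b1 by simp
  qed
  moreover have "chart_at A x \<noteq> chart_at A (x + u)" using u by (simp add: chart_at_eq_iff)
  ultimately show "hilbert_dist \<Omega> (chart_at A x) (chart_at A (x + u)) = 1 / 2 * ln ((1 + a) / (1 - b))"
    unfolding hilbert_dist_def by simp
qed

end

section \<open>The Hilbert metric and the volume of balls\<close>

lemma (in bounded_chart) chord_exists:
  assumes "x \<in> U" "u \<noteq> 0"
  obtains a b where "chord \<Omega> A x u a b"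
proof -
  obtain b where b: "0 < b" "x + (1 / b) *\<^sub>R u \<in> frontier U" using exit_exists[OF assms] by blast
  obtain a where a: "0 < a" "x + (1 / a) *\<^sub>R (- u) \<in> frontier U" using exit_exists[of x "- u"] assms by auto
  have "chord \<Omega> A x u a b"
    by unfold_locales (use assms a b in auto)
  then show ?thesis by (rule that)
qed

context chord
begin

text \<open>For negative \<open>t\<close> the inverse exit times change roles and the signed
  expression changes sign; squaring yields one smooth formula on both sides of 0.\<close>

lemma hilbert_dist_chord_scaled:
  fixes t :: real
  assumes t: "\<bar>t\<bar> < min (1 / a) (1 / b)"
  shows "(hilbert_dist \<Omega> (chart_at A x) (chart_at A (x + t *\<^sub>R u)))\<^sup>2
    = (1 / 2 * (ln (1 + t * a) - ln (1 - t * b)))\<^sup>2"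
proof -
  have ta: "\<bar>t\<bar> * a < 1" "\<bar>t\<bar> * b < 1" using t a b by (simp_all add: field_simps)
  consider "t = 0" | "0 < t" | "t < 0" by linarith
  then show ?thesis
  proof cases
    case 1
    then show ?thesis by (simp add: hilbert_dist_def)
  next
    case 2
    have "x + (t * b) *\<^sub>R ((1 / b) *\<^sub>R u) \<in> U"
      using 2 ta b fb by (intro ray_in_U x) (auto simp: frontier_def)
    then have y: "x + t *\<^sub>R u \<in> U" using b by simp
    interpret c: chord \<Omega> A x "t *\<^sub>R u" "t * a" "t * b"
      by unfold_locales (use 2 x u a b fa fb in auto)
    have "0 < 1 + t * a" using 2 a by (simp add: add_pos_pos)
    moreover have "0 < 1 - t * b" using ta 2 by simp
    ultimately have "hilbert_dist \<Omega> (chart_at A x) (chart_at A (x + t *\<^sub>R u))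
        = 1 / 2 * (ln (1 + t * a) - ln (1 - t * b))"
      using c.hilbert_dist_chord(2)[OF y] by (simp add: ln_div)
    then show ?thesis by (simp only:)
  next
    case 3
    have "t * a < 0" using 3 a by (rule mult_neg_pos)
    then have "x + (- t * a) *\<^sub>R (- (1 / a) *\<^sub>R u) \<in> U"
      using 3 ta fa by (intro ray_in_U x) (auto simp: frontier_def)
    then have y: "x + t *\<^sub>R u \<in> U" using a by simp
    interpret c: chord \<Omega> A x "t *\<^sub>R u" "- t * b" "- t * a"
      by unfold_locales (use 3 x u a b fa fb in \<open>auto simp: mult_less_0_iff\<close>)
    have "0 < 1 - t * b" using 3 b mult_neg_pos[of t b] by linarith
    moreover have "0 < 1 + t * a" using ta 3 by simp
    ultimately have "hilbert_dist \<Omega> (chart_at A x) (chart_at A (x + t *\<^sub>R u))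
        = 1 / 2 * (ln (1 - t * b) - ln (1 + t * a))"
      using c.hilbert_dist_chord(2)[OF y] by (simp add: ln_div)
    also have "\<dots> = - (1 / 2 * (ln (1 + t * a) - ln (1 - t * b)))" by (simp add: field_simps)
    finally have "hilbert_dist \<Omega> (chart_at A x) (chart_at A (x + t *\<^sub>R u))
        = - (1 / 2 * (ln (1 + t * a) - ln (1 - t * b)))" .
    then show ?thesis by (simp only: power2_minus)
  qed
qed

text \<open>The squared distance is g^2 near 0 with g(0) = 0, so its second derivative there is 2
  g'(0)^2, and g'(0) = (a + b)/2.\<close>

lemma hilbert_metric_chord: "hilbert_metric \<Omega> A x u = ((a + b) / 2)\<^sup>2"
proof -
  let ?e = "min (1 / a) (1 / b)"
  let ?F = "\<lambda>t. (hilbert_dist \<Omega> (chart_at A x) (chart_at A (x + t *\<^sub>R u)))\<^sup>2"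
  define g where "g t = 1 / 2 * (ln (1 + t * a) - ln (1 - t * b))" for t
  define g' where "g' t = 1 / 2 * (a / (1 + t * a) + b / (1 - t * b))" for t
  have e: "0 < ?e" using a b by simp
  have pos: "0 < 1 + t * a" "0 < 1 - t * b" if t: "\<bar>t\<bar> < ?e" for t
  proof -
    have "\<bar>t * a\<bar> < 1" "\<bar>t * b\<bar> < 1" using t a b by (simp_all add: abs_mult field_simps)
    then show "0 < 1 + t * a" "0 < 1 - t * b" by linarith+
  qed
  have dg: "(g has_real_derivative g' t) (at t)" if t: "\<bar>t\<bar> < ?e" for t
  proof -
    have "((\<lambda>t. ln (1 + t * a)) has_real_derivative a / (1 + t * a)) (at t)"
      using pos[OF t] by (auto intro!: derivative_eq_intros)
    moreover have "((\<lambda>t. ln (1 - t * b)) has_real_derivative - b / (1 - t * b)) (at t)"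
      using pos[OF t] by (auto intro!: derivative_eq_intros)
    ultimately show ?thesis
      using DERIV_cmult[OF DERIV_diff, of _ _ t UNIV _ _ "1 / 2"] unfolding g_def g'_def by fastforce
  qed
  have nhd: "eventually (\<lambda>t. \<bar>t\<bar> < ?e) (nhds s)" if "\<bar>s\<bar> < ?e" for s
  proof -
    have "open {t. \<bar>t\<bar> < ?e}" by (intro open_Collect_less continuous_intros)
    from eventually_nhds_in_open[OF this, of s] show ?thesis using that by simp
  qed
  have "deriv ?F t = 2 * g t * g' t" if t: "\<bar>t\<bar> < ?e" for t
  proof -
    \<comment> \<open>The formula for \<open>?F\<close> is local, while the outer derivative needs
      the inner one at all points near 0; equality is therefore used near every such
      \<open>t\<close>.\<close>
    have "eventually (\<lambda>s. ?F s = (g s)\<^sup>2) (nhds t)"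
      using nhd[OF t] by eventually_elim (simp only: hilbert_dist_chord_scaled g_def)
    then have "deriv ?F t = deriv (\<lambda>s. (g s)\<^sup>2) t" by (rule deriv_cong_ev) simp
    also have "\<dots> = 2 * g t * g' t"
      by (rule DERIV_imp_deriv) (auto intro!: derivative_eq_intros dg t)
    finally show ?thesis .
  qed
  then have "eventually (\<lambda>t. deriv ?F t = 2 * g t * g' t) (nhds 0)"
    using nhd[of 0] e by (auto elim: eventually_mono)
  then have "deriv (deriv ?F) 0 = deriv (\<lambda>t. 2 * g t * g' t) 0" by (rule deriv_cong_ev) simp
  also have "\<dots> = 2 * (g' 0)\<^sup>2"
  proof (rule DERIV_imp_deriv)
    have g0: "g 0 = 0" by (simp add: g_def)
    obtain h where h: "(g' has_real_derivative h) (at 0)"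
    proof -
      have "(g' has_real_derivative (1 / 2 * (- a * a + b * b))) (at 0)"
        unfolding g'_def by (auto intro!: derivative_eq_intros)
      then show ?thesis by (rule that)
    qed
    have "((\<lambda>t. 2 * g t * g' t) has_real_derivative (2 * g' 0 * g' 0 + h * (2 * g 0))) (at 0)"
      using dg[of 0] e h by (auto intro!: derivative_eq_intros)
    then show "((\<lambda>t. 2 * g t * g' t) has_real_derivative 2 * (g' 0)\<^sup>2) (at 0)"
      by (simp add: g0 power2_eq_square mult.assoc)
  qed
  also have "g' 0 = (a + b) / 2" by (simp add: g'_def)
  finally show ?thesis by (simp add: hilbert_metric_def numeral_2_eq_2)
qed

end

lemma (in bounded_chart) hilbert_metric_zero: "hilbert_metric \<Omega> A x 0 = 0"
  by (simp add: hilbert_metric_def hilbert_dist_def numeral_2_eq_2)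

context bounded_convex_domain
begin

text \<open>A supporting hyperplane at the end of the chord gives an element of \<open>dual_cap x\<close> that takes
  the value \<open>b\<close> on \<open>-u\<close>.\<close>

lemma polar_section_chord_le:
  assumes x: "x \<in> U" and b: "0 < b" and fb: "x + (1 / b) *\<^sub>R u \<in> frontier U" and u: "u \<in> polar_section x"
  shows "b \<le> 1"
proof -
  let ?z = "x + (1 / b) *\<^sub>R u"
  have ri: "rel_interior U = U" using open_U by (rule rel_interior_open)
  have "?z \<in> closure U" "?z \<notin> rel_interior U"
    using fb open_U by (auto simp: frontier_def interior_open ri)
  then obtain \<eta> where \<eta>: "\<And>y. y \<in> U \<Longrightarrow> \<eta> \<bullet> ?z < \<eta> \<bullet> y"
    using supporting_hyperplane_relative_frontier[OF convex_U] ri by metis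
  define D where "D = \<eta> \<bullet> x - \<eta> \<bullet> ?z"
  have D: "0 < D" using \<eta>[OF x] by (simp add: D_def)
  \<comment> \<open>The affine function vanishing on the supporting hyperplane, normalized to be 1
    at \<open>x\<close>; along \<open>u\<close> it decreases at rate \<open>b\<close>, reaching 0 at
    time 1/b.\<close>
  let ?\<xi> = "(inverse D *\<^sub>R \<eta>, inverse D * (- (\<eta> \<bullet> ?z)))"
  have val: "(y, 1) \<bullet> ?\<xi> = inverse D * (\<eta> \<bullet> y - \<eta> \<bullet> ?z)" for y
    by (simp add: inner_prod_def algebra_simps inner_commute)
  have "0 \<le> (y, 1) \<bullet> ?\<xi>" if "y \<in> U" for y
    unfolding val using \<eta>[OF that] D by (intro mult_nonneg_nonneg) auto
  moreover have "(x, 1) \<bullet> ?\<xi> \<le> 1" unfolding val using D by (simp add: D_def)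
  ultimately have "?\<xi> \<in> dual_cap x" by (simp add: dual_cap_def dual_cone_def)
  then have "\<bar>fst ?\<xi> \<bullet> u\<bar> \<le> 1" using u unfolding polar_section_def by blast
  moreover have "\<eta> \<bullet> u = - b * D" using b by (simp add: D_def inner_add_right)
  then have "fst ?\<xi> \<bullet> u = - b" using D by simp
  ultimately show "b \<le> 1" using b by simp
qed

lemma uminus_polar_section: "u \<in> polar_section x \<Longrightarrow> - u \<in> polar_section x"
  by (simp add: polar_section_def)

lemma measurable_dual_volume: "dual_volume \<in> borel_measurable borel"
proof -
  have "{(x, \<xi>). \<xi> \<in> dual_cap x} = snd -` dual_cone \<inter> {p. (fst p, 1) \<bullet> snd p \<le> 1}"
    by (auto simp: dual_cap_def)
  moreover have "closed (snd -` dual_cone \<inter> {p::'a \<times> 'a \<times> real. (fst p, 1) \<bullet> snd p \<le> 1})"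
    by (intro closed_Int continuous_closed_vimage closed_dual_cone closed_Collect_le continuous_intros)
  ultimately have "{(x, \<xi>). \<xi> \<in> dual_cap x} \<in> sets (lborel \<Otimes>\<^sub>M lborel)"
    unfolding sets_lborel_pair by (simp add: borel_closed)
  from lborel.measurable_emeasure_Pair[OF this] show ?thesis
    by (simp add: vimage_def dual_volume_def[abs_def])
qed

end

section \<open>Density and volume of balls in a chart centred at the base point\<close>

locale pointed_chart = bounded_chart \<Omega> A for \<Omega> :: "'n::finite rp set" and A +
  assumes zero_in_dom: "0 \<in> chart_at A -` \<Omega>"

sublocale pointed_chart \<subseteq> bounded_convex_domain "chart_at A -` \<Omega>"
  by unfold_locales (use open_dom bounded_dom convex_dom zero_in_dom in auto)

context pointed_chart
begin

text \<open>The supporting functionals at both ends of the chord bound both inverse exit times by 1,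
  hence also their mean, whose square is the metric.\<close>

lemma polar_section_subset_unit_ball:
  assumes x: "x \<in> U"
  shows "polar_section x \<subseteq> {u. hilbert_metric \<Omega> A x u \<le> 1}"
proof
  fix u assume u: "u \<in> polar_section x"
  show "u \<in> {u. hilbert_metric \<Omega> A x u \<le> 1}"
  proof (cases "u = 0")
    case True
    then show ?thesis by (simp add: hilbert_metric_zero)
  next
    case False
    obtain a b where "chord \<Omega> A x u a b" using chord_exists[OF x False] .
    then interpret c: chord \<Omega> A x u a b .
    have "b \<le> 1" using polar_section_chord_le[OF x c.b c.fb u] .
    moreover have "a \<le> 1" using polar_section_chord_le[OF x c.a, of "- u"] c.fa uminus_polar_section[OF u] by simp
    ultimately show ?thesis using c.a c.b by (simp add: c.hilbert_metric_chord power_le_one)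
  qed
qed

text \<open>The density is at most \<open>K\<close> over the volume of the unit ball, which contains
  \<open>polar_section x\<close>; the volume of the latter is bounded below by a constant over
  \<open>dual_volume x\<close>.\<close>

lemma density_le_dual_volume:
  assumes x: "x \<in> U" and K: "0 < K"
    and lower: "0 < ennreal w * emeasure lebesgue {u. hilbert_metric \<Omega> A x u \<le> 1}"
    and upper: "ennreal w * emeasure lebesgue {u. hilbert_metric \<Omega> A x u \<le> 1} \<le> ennreal K"
  shows "ennreal w \<le> ennreal (2 ^ (CARD('n) + 1) * K / (2 / real (CARD('n) + 1) ^ 2) ^ (CARD('n) + 1)) * dual_volume x"
proof -
  let ?N = "CARD('n) + 1" and ?B = "{u. hilbert_metric \<Omega> A x u \<le> 1}"
  define c where "c = (2 / real ?N ^ 2) ^ ?N"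
  have c: "0 < c" by (simp add: c_def)
  have "emeasure lebesgue ?B \<noteq> 0" using lower by auto
  \<comment> \<open>Nonmeasurable sets get measure 0, so the positive lower bound also yields
    measurability of the unit ball.\<close>
  then have "?B \<in> sets lebesgue" using emeasure_notin_sets by blast
  then have "emeasure lebesgue (polar_section x) \<le> emeasure lebesgue ?B"
    by (rule emeasure_mono[OF polar_section_subset_unit_ball[OF x]])
  then have le: "emeasure lborel (polar_section x) \<le> emeasure lebesgue ?B"
    using closed_polar_section[of x] by (simp add: borel_closed)
  have two: "(2::ennreal) ^ ?N = ennreal (2 ^ ?N)" by (metis ennreal_numeral ennreal_power zero_le_numeral)
  have "ennreal w * ennreal c \<le> ennreal w * (2 ^ ?N * dual_volume x * emeasure lborel (polar_section x))"
    using dual_volume_mult_polar_section_ge[OF x] by (intro mult_left_mono) (simp_all add: c_def)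
  also have "\<dots> = 2 ^ ?N * dual_volume x * (ennreal w * emeasure lborel (polar_section x))"
    by (simp only: ac_simps)
  also have "\<dots> \<le> 2 ^ ?N * dual_volume x * ennreal K"
    by (intro mult_left_mono order_trans[OF mult_left_mono[OF le] upper]) auto
  finally have "ennreal w * ennreal c * ennreal (1 / c) \<le> 2 ^ ?N * dual_volume x * ennreal K * ennreal (1 / c)"
    by (rule mult_right_mono) simp
  moreover have "ennreal w * ennreal c * ennreal (1 / c) = ennreal w"
  proof -
    have "ennreal c * ennreal (1 / c) = 1" using c by (simp flip: ennreal_mult)
    then show ?thesis by (simp add: mult.assoc)
  qed
  moreover have "2 ^ ?N * dual_volume x * ennreal K * ennreal (1 / c) = ennreal (2 ^ ?N * K / c) * dual_volume x"
  proof -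
    have "ennreal (2 ^ ?N * K / c) = ennreal (2 ^ ?N) * (ennreal K * ennreal (1 / c))"
      using c K by (simp add: ennreal_mult[symmetric])
    then show ?thesis unfolding two by (simp only: ac_simps)
  qed
  ultimately show ?thesis unfolding c_def by simp
qed

text \<open>Here \<open>b\<close> is the gauge of \<open>U\<close> at the point. From 1 + a > 1 and
  distance below \<open>R\<close> follows 1 - b > exp (- 2 R).\<close>

lemma hilbert_ball_subset:
  assumes R: "0 < R"
  shows "hilbert_ball \<Omega> (chart_at A 0) R \<subseteq> chart_at A ` ((*\<^sub>R) (1 - exp (- 2 * R)) ` closure U)"
proof
  let ?\<delta> = "exp (- 2 * R)"
  have \<delta>: "0 < ?\<delta>" "?\<delta> < 1" using R by auto
  fix P assume "P \<in> hilbert_ball \<Omega> (chart_at A 0) R"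
  then have P: "P \<in> \<Omega>" "hilbert_dist \<Omega> (chart_at A 0) P < R" by (auto simp: hilbert_ball_def)
  obtain x where x: "P = chart_at A x" using P(1) range_chart by blast
  then have xU: "x \<in> U" using P(1) by simp
  have "x \<in> (*\<^sub>R) (1 - ?\<delta>) ` closure U"
  proof (cases "x = 0")
    case True
    then show ?thesis using subsetD[OF closure_subset zero_in_dom] by (intro image_eqI[of _ _ 0]) auto
  next
    case False
    obtain a b where "chord \<Omega> A 0 x a b" using chord_exists[OF zero_in_dom False] .
    then interpret c: chord \<Omega> A 0 x a b .
    have y: "0 + x \<in> U" using xU by simp
    have b1: "b < 1" using c.hilbert_dist_chord(1)[OF y] .
    have "1 / 2 * ln ((1 + a) / (1 - b)) < R" using c.hilbert_dist_chord(2)[OF y] P(2) x by simp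
    then have "ln ((1 + a) / (1 - b)) < 2 * R" by simp
    then have "(1 + a) / (1 - b) < exp (2 * R)" using c.a b1 by (metis add_pos_pos diff_gt_0_iff_gt divide_pos_pos exp_less_cancel_iff exp_ln zero_less_one)
    then have "1 + a < exp (2 * R) * (1 - b)" using b1 by (simp add: pos_divide_less_eq)
    then have "1 < exp (2 * R) * (1 - b)" using c.a by linarith
    then have "?\<delta> * 1 < ?\<delta> * (exp (2 * R) * (1 - b))" using \<delta> by (intro mult_strict_left_mono) auto
    also have "\<dots> = 1 - b" by (simp add: exp_minus)
    finally have b\<delta>: "b < 1 - ?\<delta>" by simp
    have "0 + (b / (1 - ?\<delta>)) *\<^sub>R ((1 / b) *\<^sub>R x) \<in> U"
      using b\<delta> c.b c.fb \<delta> by (intro ray_in_U zero_in_dom) (auto simp: frontier_def)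
    then have "(1 / (1 - ?\<delta>)) *\<^sub>R x \<in> U" using c.b by simp
    then have "(1 / (1 - ?\<delta>)) *\<^sub>R x \<in> closure U" by (rule subsetD[OF closure_subset])
    then show ?thesis using \<delta> by (intro image_eqI[of _ _ "(1 / (1 - ?\<delta>)) *\<^sub>R x"]) auto
  qed
  then show "P \<in> chart_at A ` ((*\<^sub>R) (1 - ?\<delta>) ` closure U)" using x by blast
qed

text \<open>The number of scales \<open>M\<close> is about R / ln 2, the least that makes 4^M reach
  exp (2 R); the largest scale then contributes a constant times exp ((n - 1) R).\<close>

lemma measure_hilbert_ball_le:
  assumes "uniform_volume_form \<Omega> vol"
  obtains C where "1 \<le> C"
    "\<And>R. 1 \<le> R \<Longrightarrow> measure vol (hilbert_ball \<Omega> (chart_at A 0) R) \<le> C * R * exp (real (CARD('n) - 1) * R)"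
proof -
  have vf: "volume_form \<Omega> vol" using assms by (simp add: uniform_volume_form_def)
  obtain K where K: "1 < K" and unif: "\<And>A w x. affine_chart A \<Longrightarrow> chart_density \<Omega> vol A w \<Longrightarrow> chart_at A x \<in> \<Omega> \<Longrightarrow>
        ennreal (1 / K) \<le> ennreal (w x) * emeasure lebesgue {u. hilbert_metric \<Omega> A x u \<le> 1} \<and>
        ennreal (w x) * emeasure lebesgue {u. hilbert_metric \<Omega> A x u \<le> 1} \<le> ennreal K"
    using assms unfolding uniform_volume_form_def by blast
  obtain w where w: "chart_density \<Omega> vol A w" using vf chart unfolding volume_form_def by blast
  have sets_vol: "sets vol = sets borel" using vf by (simp add: volume_form_def)
  define C1 where "C1 = 2 ^ (CARD('n) + 1) * K / (2 / real (CARD('n) + 1) ^ 2) ^ (CARD('n) + 1)"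
  have C1: "0 \<le> C1" using K by (simp add: C1_def)
  have density: "ennreal (w x) \<le> ennreal C1 * dual_volume x" if x: "x \<in> U" for x
  proof -
    have "ennreal (1 / K) \<le> ennreal (w x) * emeasure lebesgue {u. hilbert_metric \<Omega> A x u \<le> 1}"
      "ennreal (w x) * emeasure lebesgue {u. hilbert_metric \<Omega> A x u \<le> 1} \<le> ennreal K"
      using unif[OF chart w, of x] x by auto
    moreover from this(1) have "0 < ennreal (w x) * emeasure lebesgue {u. hilbert_metric \<Omega> A x u \<le> 1}"
      by (rule less_le_trans[rotated]) (use K in simp)
    ultimately show ?thesis unfolding C1_def using K by (intro density_le_dual_volume x) auto
  qed
  obtain C2 where C2: "0 \<le> C2" "\<And>M \<delta>. 0 < \<delta> \<Longrightarrow> \<delta> \<le> 1 \<Longrightarrow> 1 \<le> \<delta> * 4 ^ M \<Longrightarrow>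
      (\<integral>\<^sup>+x\<in>(*\<^sub>R) (1 - \<delta>) ` closure U. dual_volume x \<partial>lborel)
        \<le> ennreal (C2 * (real M + 1) * 2 ^ (M * (CARD('n) - 1)))"
    using nn_integral_dual_volume_le by auto
  let ?m = "CARD('n) - 1"
  \<comment> \<open>The summand 1 ensures that the constant is at least 1, so its logarithm is
    nonnegative when the entropy is estimated.\<close>
  define D where "D = C1 * C2 * (1 / ln 2 + 2) * 2 ^ ?m + 1"
  have D: "1 \<le> D" using C1 C2(1) by (simp add: D_def)
  have "measure vol (hilbert_ball \<Omega> (chart_at A 0) R) \<le> D * R * exp (real ?m * R)" if R: "1 \<le> R" for R
  proof -
    let ?\<delta> = "exp (- 2 * R)"
    let ?X = "(*\<^sub>R) (1 - ?\<delta>) ` closure U"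
    have \<delta>: "0 < ?\<delta>" "?\<delta> \<le> 1" using R by auto
    define M where "M = nat \<lceil>R / ln 2\<rceil>"
    have M: "R / ln 2 \<le> real M" "real M \<le> R / ln 2 + 1"
      using R by (auto simp: M_def of_nat_ceiling intro: less_imp_le)
    have exp_ln2: "exp (t * ln 2) = 2 ^ t'" if "t = real t'" for t t'
      using that by (simp add: exp_of_nat_mult)
    have "R \<le> real M * ln 2" using M(1) by (simp add: pos_divide_le_eq)
    then have "exp R \<le> 2 ^ M" using exp_ln2[of "real M" M] by (metis exp_le_cancel_iff)
    then have "exp R * exp R \<le> 2 ^ M * (2 ^ M :: real)" by (intro mult_mono) auto
    also have "\<dots> = 4 ^ M" by (simp flip: power_mult_distrib)
    finally have "?\<delta> * (exp R * exp R) \<le> ?\<delta> * 4 ^ M" by (intro mult_left_mono) auto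
    moreover have "?\<delta> * (exp R * exp R) = 1" by (simp flip: exp_add)
    ultimately have \<delta>M: "1 \<le> ?\<delta> * 4 ^ M" by (simp only:)
    have "real M * ln 2 \<le> (R / ln 2 + 1) * ln 2" using M(2) by (intro mult_right_mono) auto
    also have "\<dots> = R + ln 2" by (simp add: field_simps)
    finally have "2 ^ M \<le> exp (R + ln 2)" using exp_ln2[of "real M" M] by (metis exp_le_cancel_iff)
    then have "(2 ^ M) ^ ?m \<le> (2 * exp R) ^ ?m"
      by (intro power_mono) (simp_all add: exp_add)
    then have pow: "2 ^ (M * ?m) \<le> 2 ^ ?m * exp (real ?m * R)"
      by (simp only: power_mult power_mult_distrib exp_of_nat_mult)
    have lin: "real M + 1 \<le> (1 / ln 2 + 2) * R"
    proof -
      have "real M + 1 \<le> R / ln 2 + 2 * R" using M(2) R by linarith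
      then show ?thesis by (simp add: algebra_simps)
    qed
    have cX: "compact ?X" using bounded_dom by (intro compact_scaling) simp
    have XU: "?X \<subseteq> U" by (rule scaled_closure_subset[OF \<delta>])
    \<comment> \<open>Monotonicity is applied with a closed, hence measurable, superset: the chart
      image of a compact set.\<close>
    have "emeasure vol (hilbert_ball \<Omega> (chart_at A 0) R) \<le> emeasure vol (chart_at A ` ?X)"
      using R closed_chart_image[OF cX] sets_vol by (intro emeasure_mono hilbert_ball_subset) (auto intro: borel_closed)
    also have "\<dots> = (\<integral>\<^sup>+x\<in>?X. ennreal (w x) \<partial>lborel)"
      using w cX XU unfolding chart_density_def by (simp add: borel_compact)
    also have "\<dots> \<le> (\<integral>\<^sup>+x. ennreal C1 * (dual_volume x * indicator ?X x) \<partial>lborel)"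
      using density XU by (intro nn_integral_mono) (auto simp: indicator_def)
    also have "\<dots> = ennreal C1 * (\<integral>\<^sup>+x\<in>?X. dual_volume x \<partial>lborel)"
      using measurable_dual_volume borel_compact[OF cX]
      by (intro nn_integral_cmult borel_measurable_times_ennreal borel_measurable_indicator)
        (simp_all only: measurable_lborel2 measurable_lborel1 sets_lborel)
    also have "\<dots> \<le> ennreal C1 * ennreal (C2 * (real M + 1) * 2 ^ (M * ?m))"
      by (intro mult_left_mono C2(2) \<delta> \<delta>M) auto
    also have "\<dots> = ennreal (C1 * (C2 * (real M + 1) * 2 ^ (M * ?m)))"
      using C1 C2(1) by (simp add: ennreal_mult)
    finally have "measure vol (hilbert_ball \<Omega> (chart_at A 0) R) \<le> C1 * (C2 * (real M + 1) * 2 ^ (M * ?m))"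
      unfolding measure_def using C1 C2(1) by (intro enn2real_leI) auto
    also have "\<dots> \<le> C1 * (C2 * ((1 / ln 2 + 2) * R) * (2 ^ ?m * exp (real ?m * R)))"
      using C1 C2(1) lin pow R by (intro mult_left_mono mult_mono) auto
    also have "\<dots> = (D - 1) * (R * exp (real ?m * R))" by (simp add: D_def algebra_simps)
    also have "\<dots> \<le> D * (R * exp (real ?m * R))" using R by (intro mult_right_mono) auto
    finally show ?thesis by (simp add: mult.assoc)
  qed
  then show ?thesis using that D by blast
qed

end

text \<open>After taking logarithms and dividing by \<open>R\<close>, the constant and the linear
  factor of the ball bound tend to 0, leaving the exponential rate.\<close>

theorem theoremt:
  fixes \<Omega> :: "'n::finite rp set" and vol :: "'n rp measure" and p :: "'n rp"
  assumes "proper_convex_domain \<Omega>"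
    and "uniform_volume_form \<Omega> vol"
    and "p \<in> \<Omega>"
  shows "volume_entropy \<Omega> vol p \<le> ereal (real CARD('n) - 1)"
proof -
  obtain A :: "(real, 'n) vec \<times> real \<Rightarrow> (real, 'n) vec \<times> real" where
    A: "affine_chart A" "\<Omega> \<subseteq> range (chart_at A)" "chart_at A 0 = p"
    "open (chart_at A -` \<Omega>)" "convex (chart_at A -` \<Omega>)" "bounded (chart_at A -` \<Omega>)"
    using proper_convex_domain_chart[OF assms(1,3)] by metis
  interpret pointed_chart \<Omega> A
    by unfold_locales (use A assms(1,3) in \<open>auto simp: proper_convex_domain_def\<close>)
  obtain C where C: "1 \<le> C"
    "\<And>R. 1 \<le> R \<Longrightarrow> measure vol (hilbert_ball \<Omega> p R) \<le> C * R * exp (real (CARD('n) - 1) * R)"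
    using measure_hilbert_ball_le[OF assms(2)] unfolding A(3) by metis
  let ?m = "real (CARD('n) - 1)"
  have le: "1 / R * ln (measure vol (hilbert_ball \<Omega> p R)) \<le> ln C / R + ln R / R + ?m" if R: "1 \<le> R" for R
  proof -
    let ?v = "measure vol (hilbert_ball \<Omega> p R)"
    have "ln ?v \<le> ln C + ln R + ?m * R"
    \<comment> \<open>By convention \<open>ln 0\<close> is 0, so the degenerate case needs a
      nonnegative right side, guaranteed by \<open>C\<close> and \<open>R\<close> being at least
      1.\<close>
    proof (cases "?v = 0")
      case False
      then have "0 < ?v" by (simp add: zero_less_measure_iff)
      then have "ln ?v \<le> ln (C * R * exp (?m * R))" using C(2)[OF R] by simp
      also have "\<dots> = ln C + ln R + ?m * R" using C(1) R by (simp add: ln_mult)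
      finally show ?thesis .
    qed (use C(1) R in simp)
    then have "1 / R * ln ?v \<le> 1 / R * (ln C + ln R + ?m * R)" using R by (intro mult_left_mono) auto
    also have "\<dots> = ln C / R + ln R / R + ?m" using R by (simp add: field_simps)
    finally show ?thesis .
  qed
  have "((\<lambda>R. ln C / R + ln R / R + ?m) \<longlongrightarrow> 0 + 0 + ?m) at_top"
    by (intro tendsto_intros ln_x_over_x_tendsto_0 tendsto_divide_0[OF tendsto_const] filterlim_at_top_imp_at_infinity filterlim_ident)
  then have lim: "((\<lambda>R. ereal (ln C / R + ln R / R + ?m)) \<longlongrightarrow> ereal ?m) at_top" by simp
  have "volume_entropy \<Omega> vol p \<le> Limsup at_top (\<lambda>R. ereal (ln C / R + ln R / R + ?m))"
    unfolding volume_entropy_def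
    by (intro Limsup_mono eventually_mono[OF eventually_ge_at_top[of 1]])
      (simp only: le ereal_less_eq)
  also have "\<dots> = ereal ?m" by (rule lim_imp_Limsup[OF _ lim]) simp
  also have "?m = real CARD('n) - 1" by (simp add: of_nat_diff Suc_leI)
  finally show ?thesis .
qed

end
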